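(* Let $V$ be a finitely generated $\mathrm{VI}$-module over a field $\Bbbk$ of characteristic zero. Then there exist a polynomial $P\in\mathbb{Q}[T]$ and an integer $N$ such that $\dim_\Bbbk(V_n)=P(q^n)$ for all $n\ge N$.
   Context: Fix a finite field $\mathbb{F}_q$ with $q$ elements. $\mathrm{VI}$ is the category whose objects are finite dimensional $\mathbb{F}_q$-vector spaces and whose morphisms are injective linear maps. A $\mathrm{VI}$-module over a field $\Bbbk$ is a functor from $\mathrm{VI}$ to $\Bbbk$-vector spaces; submodules are subfunctors. Write $V_n=V(\mathbb{F}_q^n)$. $V$ is finitely generated if there is a finite subset $S\subseteq\bigsqcup_n V_n$ such that the only submodule of $V$ containing $S$ is $V$. *)

theory Defs
  imports Main "HOL-Computational_Algebra.Polynomial"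
begin

text \<open>Skeleton of VI: objects are natural numbers n (standing for F_q^n).
  A morphism m to n is an n-by-m matrix A over F_q, stored as A i j =
  j-th coordinate of the image of the i-th standard basis vector
  (entries vanish outside i < m, j < n), which must be injective.\<close>

definition fvec :: "nat \<Rightarrow> (nat \<Rightarrow> 'f::field) set" where
  "fvec n = {v. \<forall>j. n \<le> j \<longrightarrow> v j = 0}"

definition mat_apply :: "nat \<Rightarrow> (nat \<Rightarrow> nat \<Rightarrow> 'f::field) \<Rightarrow> (nat \<Rightarrow> 'f) \<Rightarrow> (nat \<Rightarrow> 'f)" where
  "mat_apply m A v = (\<lambda>j. \<Sum>i<m. v i * A i j)"

definition VI_hom :: "nat \<Rightarrow> nat \<Rightarrow> (nat \<Rightarrow> nat \<Rightarrow> 'f::field) set" where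
  "VI_hom m n = {A. (\<forall>i j. (m \<le> i \<or> n \<le> j) \<longrightarrow> A i j = 0) \<and>
      (\<forall>v\<in>fvec m. mat_apply m A v = (\<lambda>_. 0) \<longrightarrow> v = (\<lambda>_. 0))}"

definition VI_id :: "nat \<Rightarrow> (nat \<Rightarrow> nat \<Rightarrow> 'f::field)" where
  "VI_id m = (\<lambda>i j. if i = j \<and> i < m then 1 else 0)"

definition VI_comp :: "nat \<Rightarrow> (nat \<Rightarrow> nat \<Rightarrow> 'f::field) \<Rightarrow> (nat \<Rightarrow> nat \<Rightarrow> 'f) \<Rightarrow> (nat \<Rightarrow> nat \<Rightarrow> 'f)" where
  "VI_comp n B A = (\<lambda>i k. \<Sum>j<n. A i j * B j k)"

definition is_VI_module ::
  "('k::field \<Rightarrow> 'v::ab_group_add \<Rightarrow> 'v) \<Rightarrow> (nat \<Rightarrow> 'v set) \<Rightarrow>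
   (nat \<Rightarrow> nat \<Rightarrow> (nat \<Rightarrow> nat \<Rightarrow> 'f::{finite,field}) \<Rightarrow> 'v \<Rightarrow> 'v) \<Rightarrow> bool" where
  "is_VI_module scale Vs act \<longleftrightarrow>
     vector_space scale \<and>
     (\<forall>n. module.subspace scale (Vs n)) \<and>
     (\<forall>m n A. A \<in> VI_hom m n \<longrightarrow>
        (\<forall>x\<in>Vs m. act m n A x \<in> Vs n) \<and>
        (\<forall>x\<in>Vs m. \<forall>y\<in>Vs m. act m n A (x + y) = act m n A x + act m n A y) \<and>
        (\<forall>c. \<forall>x\<in>Vs m. act m n A (scale c x) = scale c (act m n A x))) \<and>
     (\<forall>m. \<forall>x\<in>Vs m. act m m (VI_id m) x = x) \<and>
     (\<forall>m n p A B. A \<in> VI_hom m n \<longrightarrow> B \<in> VI_hom n p \<longrightarrow>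
        (\<forall>x\<in>Vs m. act m p (VI_comp n B A) x = act n p B (act m n A x)))"

definition is_VI_submodule ::
  "('k::field \<Rightarrow> 'v::ab_group_add \<Rightarrow> 'v) \<Rightarrow> (nat \<Rightarrow> 'v set) \<Rightarrow>
   (nat \<Rightarrow> nat \<Rightarrow> (nat \<Rightarrow> nat \<Rightarrow> 'f::{finite,field}) \<Rightarrow> 'v \<Rightarrow> 'v) \<Rightarrow> (nat \<Rightarrow> 'v set) \<Rightarrow> bool" where
  "is_VI_submodule scale Vs act W \<longleftrightarrow>
     (\<forall>n. module.subspace scale (W n) \<and> W n \<subseteq> Vs n) \<and>
     (\<forall>m n A. A \<in> VI_hom m n \<longrightarrow> (\<forall>x\<in>W m. act m n A x \<in> W n))"

definition VI_fin_gen ::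
  "('k::field \<Rightarrow> 'v::ab_group_add \<Rightarrow> 'v) \<Rightarrow> (nat \<Rightarrow> 'v set) \<Rightarrow>
   (nat \<Rightarrow> nat \<Rightarrow> (nat \<Rightarrow> nat \<Rightarrow> 'f::{finite,field}) \<Rightarrow> 'v \<Rightarrow> 'v) \<Rightarrow> bool" where
  "VI_fin_gen scale Vs act \<longleftrightarrow>
     (\<exists>S. finite S \<and> (\<forall>(n, x)\<in>S. x \<in> Vs n) \<and>
        (\<forall>W. is_VI_submodule scale Vs act W \<and> (\<forall>(n, x)\<in>S. x \<in> W n) \<longrightarrow> W = Vs))"

end

theory Submission
  imports Defs "HOL-Library.FuncSet"
begin

text \<open>Let \<open>G = GL_n(F_q)\<close>, let \<open>\<chi>\<close> be the character of \<open>V_n\<close> and, for \<open>g \<in> GL_e(F_q)\<close> with \<open>e\<close> at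
  most the generation degree \<open>d\<close>, let \<open>\<theta>\<^sub>g(x)\<close> be the number of injections \<open>f\<close> from \<open>F_q^e\<close> to \<open>F_q^n\<close> with
  \<open>x f = f g\<close>. Two things become independent of \<open>n\<close> after division by the order of \<open>G\<close>. The products
  \<open>\<langle>\<theta>\<^sub>g, \<theta>\<^sub>h\<rangle>\<close> count relative positions of two injections that are fixed by \<open>(g, h)\<close>. The products
  \<open>\<langle>\<theta>\<^sub>g, \<chi>\<rangle>\<close> are traces of \<open>g\<close> on the invariants of the stabilizer of \<open>F_q^e\<close> in \<open>V_n\<close>; averaging maps the
  invariants at \<open>n\<close> onto those at \<open>n + 1\<close> as soon as \<open>n \<ge> e + d\<close>, so their dimensions decrease and
  eventually all these maps are isomorphisms.

  A class function orthogonal to all \<open>\<theta>\<^sub>g\<close> is orthogonal to \<open>\<chi>\<close>, because its sums over all sets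
  \<open>{x. x = x0 on D}\<close> with \<open>dim D \<le> d\<close> vanish. Hence \<open>\<chi>\<close> behaves like a combination of the \<open>\<theta>\<^sub>g\<close>, whose
  coefficients are determined by the two stable families of products and so do not depend on \<open>n\<close>.
  Evaluated at the identity this expresses \<open>dim V_n\<close> through the numbers \<open>\<theta>\<^sub>1(1)\<close> of injections from \<open>F_q^e\<close>
  to \<open>F_q^n\<close>, which are polynomials in \<open>q^n\<close>.\<close>

section \<open>Linear algebra over the finite field\<close>

text \<open>The products are bilinear sums without inverse or conjugate, so they make sense over
  every field of characteristic zero, but no positivity is available there. Positivity enters only
  over the rationals, because the \<open>theta\<close> are integer valued: a rational combination
  orthogonal to all of them has square sum zero. The Gram matrix is singular in general, since
  conjugate \<open>g\<close> give the same function, so linear systems are solved by the alternative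
  in \<open>fredholm\<close> and never by inversion. Two vectors replace a decomposition of the
  character. \<open>y\<close>, found at one large n, writes the products with the character through
  the Gram matrix. A rational \<open>c\<close>, which may vary with n, writes evaluation at the
  identity on the span of the \<open>theta\<close> through products. The delta function at the
  identity minus the combination by \<open>c\<close> is orthogonal to all \<open>theta\<close>,
  hence to the character; in the resulting formula for the dimension \<open>c\<close> recombines
  with the Gram matrix and only \<open>y\<close> is left. The main obstacle is that orthogonality to
  \<open>theta\<close> controls only sums over elements preserving a subspace and acting on it in a
  given way, while matrix coefficients of V_n need all cosets of pointwise stabilizers.\<close>

definition vcomb :: "(nat \<Rightarrow> 'f::field) \<Rightarrow> 'f \<Rightarrow> (nat \<Rightarrow> 'f) \<Rightarrow> (nat \<Rightarrow> 'f)" where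
  "vcomb u c v = (\<lambda>j. u j + c * v j)"

text \<open>One clause about \<open>vcomb\<close> covers addition (\<open>c = 1\<close>),
  differences (\<open>c = -1\<close>) and, with a zero first argument, scaling.\<close>

definition vsub :: "(nat \<Rightarrow> 'f::field) set \<Rightarrow> bool" where
  "vsub D \<longleftrightarrow> (\<lambda>_. 0) \<in> D \<and> (\<forall>u\<in>D. \<forall>v\<in>D. \<forall>c. vcomb u c v \<in> D)"

text \<open>The graph of a linear isomorphism between two subspaces. A relation treats both sides
  alike, so it can be inverted by taking the converse and enlarged one pair at a time.\<close>

definition partial_iso :: "((nat \<Rightarrow> 'f::field) \<times> (nat \<Rightarrow> 'f)) set \<Rightarrow> bool" where
  "partial_iso R \<longleftrightarrow> ((\<lambda>_. 0), (\<lambda>_. 0)) \<in> R \<and>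
     (\<forall>u u' v v' c. (u, u') \<in> R \<longrightarrow> (v, v') \<in> R \<longrightarrow> (vcomb u c v, vcomb u' c v') \<in> R) \<and>
     (\<forall>u u'. (u, u') \<in> R \<longrightarrow> (u = (\<lambda>_. 0) \<longleftrightarrow> u' = (\<lambda>_. 0)))"

definition unit_vec :: "nat \<Rightarrow> nat \<Rightarrow> 'f::field" where
  "unit_vec i = (\<lambda>j. if j = i then 1 else 0)"

lemma vcomb_diff_eq_0: "vcomb u (-1) v = (\<lambda>_. 0) \<longleftrightarrow> u = v"
  by (auto simp: vcomb_def fun_eq_iff)

lemma vcomb_zero [simp]: "vcomb u c (\<lambda>_. 0) = u" "vcomb u 0 v = u"
  by (auto simp: vcomb_def)

lemma fvecD: "v \<in> fvec n \<Longrightarrow> n \<le> j \<Longrightarrow> v j = 0"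
  by (auto simp: fvec_def)

lemma vsub_fvec: "vsub (fvec n)"
  by (auto simp: vsub_def fvec_def vcomb_def)

lemma vsub_vcomb: "vsub D \<Longrightarrow> u \<in> D \<Longrightarrow> v \<in> D \<Longrightarrow> vcomb u c v \<in> D"
  unfolding vsub_def by blast

lemma fvec_mono: "m \<le> n \<Longrightarrow> fvec m \<subseteq> fvec n"
  by (auto simp: fvec_def)

lemma unit_vec_in_fvec: "i < n \<Longrightarrow> unit_vec i \<in> fvec n"
  by (auto simp: fvec_def unit_vec_def)

lemma card_fvec:
  "finite (fvec n :: (nat \<Rightarrow> 'f::{finite,field}) set)"
  "card (fvec n :: (nat \<Rightarrow> 'f) set) = card (UNIV :: 'f set) ^ n"
proof -
  let ?ph = "\<lambda>v::nat \<Rightarrow> 'f. restrict v {..<n}"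
  let ?ex = "\<lambda>v j. if j < n then v j else 0"
  have bij: "bij_betw ?ph (fvec n) ({..<n} \<rightarrow>\<^sub>E UNIV)"
  proof (rule bij_betw_byWitness[where f' = ?ex])
    show "\<forall>v\<in>fvec n. ?ex (?ph v) = v"
      by (intro ballI ext) (simp add: fvec_def)
    show "\<forall>g\<in>{..<n} \<rightarrow>\<^sub>E UNIV. ?ph (?ex g) = g"
      by (intro ballI ext) (simp add: PiE_def extensional_def)
    show "?ph ` fvec n \<subseteq> {..<n} \<rightarrow>\<^sub>E UNIV"
      by (intro image_subsetI) simp
    show "?ex ` ({..<n} \<rightarrow>\<^sub>E UNIV) \<subseteq> fvec n"
      by (intro image_subsetI) (simp add: fvec_def)
  qed
  have "finite ({..<n} \<rightarrow>\<^sub>E (UNIV :: 'f set))"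
    by (simp add: finite_PiE)
  then show "finite (fvec n :: (nat \<Rightarrow> 'f) set)" using bij bij_betw_finite by blast
  show "card (fvec n :: (nat \<Rightarrow> 'f) set) = card (UNIV :: 'f set) ^ n"
    using bij_betw_same_card[OF bij] by (simp add: card_PiE)
qed

lemma card_field_gt_1: "1 < card (UNIV :: 'f::{finite,field} set)"
proof -
  have "card {0, 1 :: 'f} \<le> card (UNIV :: 'f set)" by (rule card_mono) auto
  then show ?thesis by simp
qed

section \<open>Isomorphisms between subspaces and their extension\<close>

lemma partial_isoD:
  assumes "partial_iso R"
  shows "((\<lambda>_. 0), (\<lambda>_. 0)) \<in> R"
    "(u, u') \<in> R \<Longrightarrow> (v, v') \<in> R \<Longrightarrow> (vcomb u c v, vcomb u' c v') \<in> R"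
    "(u, u') \<in> R \<Longrightarrow> u = (\<lambda>_. 0) \<longleftrightarrow> u' = (\<lambda>_. 0)"
  using assms unfolding partial_iso_def by blast+

lemma partial_iso_unique:
  assumes "partial_iso R" "(u, u') \<in> R" "(v, v') \<in> R"
  shows "u = v \<longleftrightarrow> u' = v'"
  using partial_isoD(3)[OF assms(1) partial_isoD(2)[OF assms, of "-1"]] by (simp add: vcomb_diff_eq_0)

lemma partial_iso_card:
  assumes "partial_iso R"
  shows "card (Domain R) = card (Range R)"
proof -
  have "inj_on fst R" "inj_on snd R"
    using partial_iso_unique[OF assms] by (auto simp: inj_on_def)
  then show ?thesis by (metis card_image Domain_fst Range_snd)
qed

lemma partial_iso_sum:
  fixes m :: nat
  assumes "partial_iso R" "\<And>i. i < m \<Longrightarrow> (a i, b i) \<in> R"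
  shows "((\<lambda>j. \<Sum>i<m. c i * a i j), (\<lambda>j. \<Sum>i<m. c i * b i j)) \<in> R"
  using assms(2)
proof (induction m)
  case 0
  then show ?case using partial_isoD(1)[OF assms(1)] by simp
next
  case (Suc m)
  have "(vcomb (\<lambda>j. \<Sum>i<m. c i * a i j) (c m) (a m), vcomb (\<lambda>j. \<Sum>i<m. c i * b i j) (c m) (b m)) \<in> R"
    by (rule partial_isoD(2)[OF assms(1)]) (use Suc in auto)
  then show ?case by (simp add: vcomb_def)
qed

lemma vsub_scale: "vsub D \<Longrightarrow> v \<in> D \<Longrightarrow> (\<lambda>j. c * v j) \<in> D"
proof -
  assume "vsub D" "v \<in> D"
  then have "vcomb (\<lambda>_. 0) c v \<in> D" unfolding vsub_def by blast
  then show ?thesis by (simp add: vcomb_def)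
qed

text \<open>\<open>R'\<close> is the sum of \<open>R\<close> and the line through
  \<open>(u, v)\<close>. It stays injective both ways because \<open>u\<close> and \<open>v\<close>
  are independent of the two sides of \<open>R\<close>.\<close>

lemma partial_iso_insert:
  fixes u v :: "nat \<Rightarrow> 'a::field"
  assumes R: "partial_iso R" and u: "u \<notin> Domain R" and v: "v \<notin> Range R"
  defines "R' \<equiv> {(vcomb a c u, vcomb b c v) | a b c. (a, b) \<in> R}"
  shows "partial_iso R'" "R \<subseteq> R'" "(u, v) \<in> R'"
proof -
  show sub: "R \<subseteq> R'"
  proof
    fix p assume "p \<in> R"
    then show "p \<in> R'"
      unfolding R'_def by (cases p) (force intro!: exI[of _ "0::'a"])
  qed
  have "(vcomb (\<lambda>_. 0) 1 u, vcomb (\<lambda>_. 0) 1 v) \<in> R'"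
    unfolding R'_def using partial_isoD(1)[OF R] by blast
  then show "(u, v) \<in> R'" by (simp add: vcomb_def)
  have zero: "((\<lambda>_. 0), (\<lambda>_. 0)) \<in> R'" using sub partial_isoD(1)[OF R] by blast
  have comb: "(vcomb a c b, vcomb a' c b') \<in> R'" if h: "(a, a') \<in> R'" "(b, b') \<in> R'" for a a' b b' c
  proof -
    obtain a1 a1' s where 1: "(a1, a1') \<in> R" "a = vcomb a1 s u" "a' = vcomb a1' s v"
      using h(1) unfolding R'_def by blast
    obtain b1 b1' t where 2: "(b1, b1') \<in> R" "b = vcomb b1 t u" "b' = vcomb b1' t v"
      using h(2) unfolding R'_def by blast
    have "(vcomb (vcomb a1 c b1) (s + c * t) u, vcomb (vcomb a1' c b1') (s + c * t) v) \<in> R'"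
      unfolding R'_def using partial_isoD(2)[OF R 1(1) 2(1)] by blast
    then show ?thesis unfolding 1 2 vcomb_def by (simp add: algebra_simps)
  qed
  have inj: "a = (\<lambda>_. 0) \<longleftrightarrow> a' = (\<lambda>_. 0)" if h: "(a, a') \<in> R'" for a a'
  proof -
    obtain a1 a1' s where 1: "(a1, a1') \<in> R" "a = vcomb a1 s u" "a' = vcomb a1' s v"
      using h(1) unfolding R'_def by blast
    have 2: "(vcomb (\<lambda>_. 0) (- (1/s)) a1, vcomb (\<lambda>_. 0) (- (1/s)) a1') \<in> R"
      by (rule partial_isoD(2)[OF R partial_isoD(1)[OF R] 1(1)])
    \<comment> \<open>A nonzero coefficient \<open>s\<close> in a vanishing combination would make
      \<open>u\<close> a multiple of \<open>a1\<close>, hence a member of the domain, and likewise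
      \<open>v\<close> on the other side.\<close>
    have d: "w = vcomb (\<lambda>_. 0) (- (1/s)) w1"
      if "vcomb w1 s w = (\<lambda>_. 0)" "s \<noteq> 0" for w w1
    proof -
      have "w1 j + s * w j = 0" for j using that(1) by (simp add: vcomb_def fun_eq_iff)
      then have "w1 j = - (s * w j)" for j by (simp add: eq_neg_iff_add_eq_0)
      then show ?thesis using that(2) by (simp add: vcomb_def fun_eq_iff)
    qed
    show ?thesis
    proof (cases "s = 0")
      case True then show ?thesis using partial_isoD(3)[OF R 1(1)] 1 by simp
    next
      case False
      then show ?thesis using d[of a1 u] d[of a1' v] 1 2 u v by (metis Domain.intros Range.intros)
    qed
  qed
  show "partial_iso R'" unfolding partial_iso_def using zero comb inj by blast
qed

text \<open>Pairs are added until the domain is \<open>D\<close>. Cardinalities do the work of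
  dimensions: domain and range of \<open>R\<close> are equally large, so as long as the domain is
  smaller than \<open>D\<close>, some vector of \<open>T\<close> is still free.\<close>

lemma partial_iso_extend:
  assumes "partial_iso R" "R \<subseteq> D \<times> T" "vsub D" "vsub T" "finite D" "finite T" "card D \<le> card T"
  shows "\<exists>R'. partial_iso R' \<and> R \<subseteq> R' \<and> R' \<subseteq> D \<times> T \<and> Domain R' = D"
  using assms(1,2)
proof (induction "card (D - Domain R)" arbitrary: R rule: less_induct)
  case (less R)
  show ?case
  proof (cases "Domain R = D")
    case True then show ?thesis using less.prems by blast
  next
    case False
    then have sub: "Domain R \<subset> D" using less.prems by blast
    then obtain u where u: "u \<in> D" "u \<notin> Domain R" by blast
    have "card (Range R) < card T"
      using psubset_card_mono[OF assms(5) sub] partial_iso_card[OF less.prems(1)] assms(7) by simp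
    moreover have "Range R \<subseteq> T" using less.prems by blast
    ultimately obtain v where v: "v \<in> T" "v \<notin> Range R" by (metis less_irrefl subsetI subset_antisym)
    define R' where "R' = {(vcomb a c u, vcomb b c v) | a b c. (a, b) \<in> R}"
    note ins = partial_iso_insert[OF less.prems(1) u(2) v(2), folded R'_def]
    have sub': "R' \<subseteq> D \<times> T"
      using less.prems(2) u(1) v(1) assms(3,4) unfolding R'_def vsub_def by auto
    have "D - Domain R' \<subset> D - Domain R" using ins u by blast
    then have "card (D - Domain R') < card (D - Domain R)"
      by (rule psubset_card_mono[rotated]) (use assms(5) in simp)
    from less.hyps[OF this ins(1) sub'] ins(2) show ?thesis by blast
  qed
qed

section \<open>Matrices as linear maps, and the group GL_n\<close>

lemma sum_unit_vec: "u \<in> fvec m \<Longrightarrow> (\<lambda>j. \<Sum>i<m. u i * unit_vec i j) = u"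
proof
  fix j assume u: "u \<in> fvec m"
  have "(\<Sum>i<m. u i * unit_vec i j) = (\<Sum>i<m. if j = i then u i else 0)"
    by (intro sum.cong) (auto simp: unit_vec_def)
  also have "\<dots> = u j" using fvecD[OF u, of j] by (auto simp: sum.delta)
  finally show "(\<Sum>i<m. u i * unit_vec i j) = u j" .
qed

lemma mat_apply_unit_vec: "i < m \<Longrightarrow> mat_apply m A (unit_vec i) = A i"
  by (auto simp: mat_apply_def unit_vec_def if_distrib[of "\<lambda>x. x * _"] sum.delta cong: if_cong)

lemma mat_apply_0 [simp]: "mat_apply m A (\<lambda>_. 0) = (\<lambda>_. 0)"
  by (simp add: mat_apply_def)

lemma mat_apply_vcomb: "mat_apply m A (vcomb u c v) = vcomb (mat_apply m A u) c (mat_apply m A v)"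
  by (simp add: mat_apply_def vcomb_def sum.distrib sum_distrib_left algebra_simps)

lemma VI_hom_apply_in: "A \<in> VI_hom m n \<Longrightarrow> mat_apply m A v \<in> fvec n"
  by (auto simp: VI_hom_def fvec_def mat_apply_def)

lemma VI_hom_row: "A \<in> VI_hom m n \<Longrightarrow> A i \<in> fvec n"
  by (auto simp: VI_hom_def fvec_def)

lemma VI_hom_apply_eq_0:
  "A \<in> VI_hom m n \<Longrightarrow> v \<in> fvec m \<Longrightarrow> mat_apply m A v = (\<lambda>_. 0) \<longleftrightarrow> v = (\<lambda>_. 0)"
  by (auto simp: VI_hom_def)

lemma VI_hom_apply_inj:
  assumes "A \<in> VI_hom m n" "u \<in> fvec m" "v \<in> fvec m"
  shows "mat_apply m A u = mat_apply m A v \<longleftrightarrow> u = v"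
proof -
  have "vcomb u (-1) v \<in> fvec m" using vsub_fvec assms unfolding vsub_def by blast
  from VI_hom_apply_eq_0[OF assms(1) this] show ?thesis
    by (simp add: mat_apply_vcomb vcomb_diff_eq_0)
qed

lemma partial_iso_graph:
  assumes "A \<in> VI_hom m n"
  shows "partial_iso {(u, mat_apply m A u) | u. u \<in> fvec m}"
  unfolding partial_iso_def
  using VI_hom_apply_eq_0[OF assms] vsub_fvec[of m]
  by (auto simp: mat_apply_vcomb vsub_def intro!: exI[of _ "\<lambda>_. 0"])

text \<open>The rows of the matrix are the partners of the unit vectors; linearity of the relation
  gives all other vectors.\<close>

lemma partial_iso_VI_hom:
  assumes R: "partial_iso R" and sub: "R \<subseteq> fvec m \<times> fvec n" and dom: "Domain R = fvec m"
  shows "\<exists>A \<in> VI_hom m n. \<forall>u\<in>fvec m. (u, mat_apply m A u) \<in> R"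
proof -
  have "\<forall>i. \<exists>v. i < m \<longrightarrow> (unit_vec i, v) \<in> R"
    using dom unit_vec_in_fvec by (metis Domain.cases)
  then obtain a where a: "\<And>i. i < m \<Longrightarrow> (unit_vec i, a i) \<in> R" by metis
  define A where "A = (\<lambda>i. if i < m then a i else (\<lambda>_. 0))"
  have ap: "(u, mat_apply m A u) \<in> R" if "u \<in> fvec m" for u
  proof -
    have "((\<lambda>j. \<Sum>i<m. u i * unit_vec i j), (\<lambda>j. \<Sum>i<m. u i * A i j)) \<in> R"
      by (rule partial_iso_sum[OF R]) (use a in \<open>auto simp: A_def\<close>)
    then show ?thesis using sum_unit_vec[OF that] by (simp add: mat_apply_def)
  qed
  have "A i j = 0" if "m \<le> i \<or> n \<le> j" for i j
    using a[of i] sub that by (auto simp: A_def fvec_def)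
  moreover have "u = (\<lambda>_. 0)" if "u \<in> fvec m" "mat_apply m A u = (\<lambda>_. 0)" for u
    using partial_isoD(3)[OF R ap[OF that(1)]] that by simp
  ultimately have "A \<in> VI_hom m n" by (simp add: VI_hom_def)
  then show ?thesis using ap by blast
qed

text \<open>Homogeneity of F_q^n, the source of nearly all group elements constructed below.
  \<open>VI_hom n n\<close> plays the role of GL_n, which \<open>GL_inverse\<close>
  justifies.\<close>

lemma partial_iso_extend_GL:
  fixes R :: "((nat \<Rightarrow> 'f::{finite,field}) \<times> (nat \<Rightarrow> 'f)) set"
  assumes "partial_iso R" "R \<subseteq> fvec n \<times> fvec n"
  shows "\<exists>x \<in> VI_hom n n. \<forall>(u, v) \<in> R. mat_apply n x u = v"
proof -
  obtain R' where R': "partial_iso R'" "R \<subseteq> R'" "R' \<subseteq> fvec n \<times> fvec n" "Domain R' = fvec n"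
    using partial_iso_extend[OF assms vsub_fvec vsub_fvec card_fvec(1) card_fvec(1)] by auto
  from partial_iso_VI_hom[OF R'(1,3,4)] obtain x where
    x: "x \<in> VI_hom n n" "\<And>u. u\<in>fvec n \<Longrightarrow> (u, mat_apply n x u) \<in> R'" by blast
  have "mat_apply n x u = v" if "(u, v) \<in> R" for u v
    using partial_iso_unique[OF R'(1) _ x(2), of u v u] that R'(2,3) by blast
  with x show ?thesis by blast
qed

lemma mat_apply_comp: "mat_apply m (VI_comp n B A) v = mat_apply n B (mat_apply m A v)"
proof
  fix k
  have "(\<Sum>i<m. v i * (\<Sum>j<n. A i j * B j k)) = (\<Sum>i<m. \<Sum>j<n. v i * A i j * B j k)"
    by (simp add: sum_distrib_left mult.assoc)
  also have "\<dots> = (\<Sum>j<n. \<Sum>i<m. v i * A i j * B j k)" by (rule sum.swap)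
  finally show "mat_apply m (VI_comp n B A) v k = mat_apply n B (mat_apply m A v) k"
    by (simp add: mat_apply_def VI_comp_def sum_distrib_right)
qed

lemma VI_comp_row: "VI_comp n B A i = mat_apply n B (A i)"
  by (simp add: VI_comp_def mat_apply_def)

lemma VI_comp_assoc: "VI_comp p C (VI_comp n B A) = VI_comp n (VI_comp p C B) A"
  by (rule ext) (simp add: VI_comp_row mat_apply_comp)

lemma mat_apply_id: "v \<in> fvec m \<Longrightarrow> mat_apply m (VI_id m) v = v"
proof -
  assume "v \<in> fvec m"
  from sum_unit_vec[OF this] show ?thesis
    by (simp add: mat_apply_def VI_id_def unit_vec_def fun_eq_iff if_distrib eq_commute cong: if_cong)
qed

text \<open>Because matrices are padded with zeros, \<open>VI_id m\<close> is at once the identity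
  of F_q^m and the standard inclusion into F_q^n. Both roles occur throughout.\<close>

lemma VI_id_in: "m \<le> n \<Longrightarrow> VI_id m \<in> VI_hom m n"
  unfolding VI_hom_def by (auto simp: mat_apply_id) (auto simp: VI_id_def)

lemma VI_comp_in: "A \<in> VI_hom m n \<Longrightarrow> B \<in> VI_hom n p \<Longrightarrow> VI_comp n B A \<in> VI_hom m p"
proof -
  assume A: "A \<in> VI_hom m n" and B: "B \<in> VI_hom n p"
  have "VI_comp n B A i j = 0" if "m \<le> i \<or> p \<le> j" for i j
    using that A B by (auto simp: VI_comp_def VI_hom_def)
  moreover have "v = (\<lambda>_. 0)" if "v \<in> fvec m" "mat_apply m (VI_comp n B A) v = (\<lambda>_. 0)" for v
    using that VI_hom_apply_eq_0[OF A] VI_hom_apply_eq_0[OF B] VI_hom_apply_in[OF A]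
    by (simp add: mat_apply_comp)
  ultimately show ?thesis by (simp add: VI_hom_def)
qed

lemma VI_hom_row_out: "A \<in> VI_hom m n \<Longrightarrow> m \<le> i \<Longrightarrow> A i = (\<lambda>_. 0)"
  by (auto simp: VI_hom_def)

lemma VI_hom_eqI:
  assumes "A \<in> VI_hom m n" "B \<in> VI_hom m p" "\<And>v. v \<in> fvec m \<Longrightarrow> mat_apply m A v = mat_apply m B v"
  shows "A = B"
proof
  fix i show "A i = B i"
  proof (cases "i < m")
    case True then show ?thesis using assms(3)[OF unit_vec_in_fvec] by (simp add: mat_apply_unit_vec)
  next
    case False then show ?thesis
      using VI_hom_row_out[OF assms(1)] VI_hom_row_out[OF assms(2)] by simp
  qed
qed

lemma VI_comp_id_left: "A \<in> VI_hom m n \<Longrightarrow> VI_comp n (VI_id n) A = A"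
  by (rule ext) (simp add: VI_comp_row mat_apply_id VI_hom_row)

lemma VI_comp_id_right: "A \<in> VI_hom m n \<Longrightarrow> VI_comp m A (VI_id m) = A"
proof -
  assume A: "A \<in> VI_hom m n"
  show ?thesis
    by (rule VI_hom_eqI[OF VI_comp_in[OF VI_id_in A] A]) (simp_all add: mat_apply_comp mat_apply_id)
qed

lemma VI_hom_mono: "n \<le> p \<Longrightarrow> VI_hom m n \<subseteq> VI_hom m p"
  by (auto simp: VI_hom_def)

lemma VI_hom_finite: "finite (VI_hom m n :: (nat \<Rightarrow> nat \<Rightarrow> 'f::{finite,field}) set)"
proof -
  have "inj_on (\<lambda>A. restrict A {..<m}) (VI_hom m n :: (nat \<Rightarrow> nat \<Rightarrow> 'f) set)"
  proof (rule inj_onI, rule ext)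
    fix A B :: "nat \<Rightarrow> nat \<Rightarrow> 'f" and i
    assume h: "A \<in> VI_hom m n" "B \<in> VI_hom m n" and "restrict A {..<m} = restrict B {..<m}"
    then have "restrict A {..<m} i = restrict B {..<m} i" by (rule_tac fun_cong)
    then show "A i = B i"
      using VI_hom_row_out[OF h(1), of i] VI_hom_row_out[OF h(2), of i] by (cases "i < m") auto
  qed
  moreover have "(\<lambda>A. restrict A {..<m}) ` (VI_hom m n :: (nat \<Rightarrow> nat \<Rightarrow> 'f) set) \<subseteq> {..<m} \<rightarrow>\<^sub>E fvec n"
    using VI_hom_row by auto
  ultimately show ?thesis
    by (meson card_fvec(1) finite_PiE finite_lessThan inj_on_finite)
qed

text \<open>The converse of the graph of \<open>x\<close> extends to a left inverse
  \<open>y\<close>. Applying this again to \<open>y\<close> gives \<open>z\<close>, and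
  \<open>z = z (y x) = x\<close> shows that \<open>y\<close> is also a right inverse.\<close>

lemma GL_inverse:
  fixes x :: "nat \<Rightarrow> nat \<Rightarrow> 'f::{finite,field}"
  assumes x: "x \<in> VI_hom n n"
  shows "\<exists>y\<in>VI_hom n n. VI_comp n y x = VI_id n \<and> VI_comp n x y = VI_id n"
proof -
  have left: "\<exists>y\<in>VI_hom n n. VI_comp n y x = VI_id n" if x: "x \<in> VI_hom n n" for x :: "nat \<Rightarrow> nat \<Rightarrow> 'f"
  proof -
    let ?R = "{(u, mat_apply n x u) | u. u \<in> fvec n}"
    note g = partial_iso_graph[OF x]
    have "partial_iso (?R\<inverse>)" using g unfolding partial_iso_def converse_iff by blast
    moreover have "?R\<inverse> \<subseteq> fvec n \<times> fvec n" using VI_hom_apply_in[OF x] by auto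
    ultimately obtain y where y: "y \<in> VI_hom n n" "\<forall>(u, v) \<in> ?R\<inverse>. mat_apply n y u = v"
      using partial_iso_extend_GL by blast
    have "VI_comp n y x = VI_id n"
    proof (rule VI_hom_eqI[OF VI_comp_in[OF x y(1)] VI_id_in[OF order_refl]])
      fix v :: "nat \<Rightarrow> 'f" assume "v \<in> fvec n"
      then show "mat_apply n (VI_comp n y x) v = mat_apply n (VI_id n) v"
        using y(2) by (force simp: mat_apply_comp mat_apply_id)
    qed
    with y show ?thesis by blast
  qed
  obtain y where y: "y \<in> VI_hom n n" "VI_comp n y x = VI_id n" using left[OF x] by blast
  obtain z where z: "z \<in> VI_hom n n" "VI_comp n z y = VI_id n" using left[OF y(1)] by blast
  have "z = VI_comp n z (VI_comp n y x)" unfolding y(2) VI_comp_id_right[OF z(1)] ..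
  also have "\<dots> = x" unfolding VI_comp_assoc z(2) VI_comp_id_left[OF x] ..
  finally have "VI_comp n x y = VI_id n" using z(2) by simp
  with y show ?thesis by (intro bexI[of _ y] conjI)
qed

definition ginv :: "nat \<Rightarrow> (nat \<Rightarrow> nat \<Rightarrow> 'f::{finite,field}) \<Rightarrow> (nat \<Rightarrow> nat \<Rightarrow> 'f)" where
  "ginv n x = (SOME y. y \<in> VI_hom n n \<and> VI_comp n y x = VI_id n \<and> VI_comp n x y = VI_id n)"

lemma ginv:
  assumes "x \<in> VI_hom n n"
  shows "ginv n x \<in> VI_hom n n" "VI_comp n (ginv n x) x = VI_id n" "VI_comp n x (ginv n x) = VI_id n"
proof -
  have "\<exists>y. y \<in> VI_hom n n \<and> VI_comp n y x = VI_id n \<and> VI_comp n x y = VI_id n"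
    using GL_inverse[OF assms] by blast
  then have "ginv n x \<in> VI_hom n n \<and> VI_comp n (ginv n x) x = VI_id n \<and> VI_comp n x (ginv n x) = VI_id n"
    unfolding ginv_def by (rule someI_ex)
  then show "ginv n x \<in> VI_hom n n" "VI_comp n (ginv n x) x = VI_id n" "VI_comp n x (ginv n x) = VI_id n"
    by auto
qed

lemma ginv_cancel:
  assumes "x \<in> VI_hom n n" "A \<in> VI_hom m n"
  shows "VI_comp n (ginv n x) (VI_comp n x A) = A" "VI_comp n x (VI_comp n (ginv n x) A) = A"
  unfolding VI_comp_assoc ginv(2)[OF assms(1)] ginv(3)[OF assms(1)]
  by (rule VI_comp_id_left[OF assms(2)])+

lemma ginv_apply:
  assumes "x \<in> VI_hom n n" "v \<in> fvec n"
  shows "mat_apply n (ginv n x) (mat_apply n x v) = v" "mat_apply n x (mat_apply n (ginv n x) v) = v"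
  unfolding mat_apply_comp[symmetric] ginv(2)[OF assms(1)] ginv(3)[OF assms(1)]
  by (rule mat_apply_id[OF assms(2)])+

section \<open>Sums of class functions over cosets\<close>

text \<open>A coset of the pointwise stabilizer of the image of \<open>f\<close>. The main case is
  \<open>f = VI_id e\<close> and \<open>f' = g\<close>: the elements that preserve F_q^e and
  restrict to \<open>g\<close> on it.\<close>

definition carry :: "nat \<Rightarrow> (nat \<Rightarrow> nat \<Rightarrow> 'f::{finite,field}) \<Rightarrow> (nat \<Rightarrow> nat \<Rightarrow> 'f) \<Rightarrow> (nat \<Rightarrow> nat \<Rightarrow> 'f) set" where
  "carry n f f' = {x \<in> VI_hom n n. VI_comp n x f = f'}"

definition class_fun :: "nat \<Rightarrow> ((nat \<Rightarrow> nat \<Rightarrow> 'f::{finite,field}) \<Rightarrow> 'k) \<Rightarrow> bool" where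
  "class_fun n \<psi> \<longleftrightarrow> (\<forall>x\<in>VI_hom n n. \<forall>y\<in>VI_hom n n. \<psi> (VI_comp n x y) = \<psi> (VI_comp n y x))"

text \<open>For invertible \<open>g\<close> this is the number of fixed points of f |-> x f g^(-1),
  the trace of \<open>(x, g)\<close> on the permutation module spanned by the injections from
  F_q^e.\<close>

definition theta :: "nat \<Rightarrow> (nat \<Rightarrow> nat \<Rightarrow> 'f::{finite,field}) \<Rightarrow> nat \<Rightarrow> (nat \<Rightarrow> nat \<Rightarrow> 'f) \<Rightarrow> nat" where
  "theta e g n x = card {f \<in> VI_hom e n. VI_comp n x f = VI_comp e f g}"

definition gconj :: "nat \<Rightarrow> (nat \<Rightarrow> nat \<Rightarrow> 'f::{finite,field}) \<Rightarrow> (nat \<Rightarrow> nat \<Rightarrow> 'f) \<Rightarrow> (nat \<Rightarrow> nat \<Rightarrow> 'f)" where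
  "gconj n h x = VI_comp n h (VI_comp n x (ginv n h))"

lemma gconj_in: "h \<in> VI_hom n n \<Longrightarrow> x \<in> VI_hom n n \<Longrightarrow> gconj n h x \<in> VI_hom n n"
  unfolding gconj_def by (intro VI_comp_in ginv(1))

lemma gconj_apply:
  "h \<in> VI_hom n n \<Longrightarrow> v \<in> fvec n \<Longrightarrow>
    mat_apply n (gconj n h x) (mat_apply n h v) = mat_apply n h (mat_apply n x v)"
  by (simp add: gconj_def mat_apply_comp ginv_apply)

lemma gconj_comp:
  "h \<in> VI_hom n n \<Longrightarrow> A \<in> VI_hom m n \<Longrightarrow>
    VI_comp n (gconj n h x) (VI_comp n h A) = VI_comp n h (VI_comp n x A)"
  by (simp add: gconj_def flip: VI_comp_assoc) (simp add: ginv_cancel)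

lemma gconj_inverse:
  fixes h x :: "nat \<Rightarrow> nat \<Rightarrow> 'f::{finite,field}"
  assumes h: "h \<in> VI_hom n n" and x: "x \<in> VI_hom n n"
  shows "gconj n (ginv n h) (gconj n h x) = x" "gconj n h (gconj n (ginv n h) x) = x"
proof -
  have eq: "gconj n k (gconj n h x) = x"
    if "h \<in> VI_hom n n" "k \<in> VI_hom n n" "VI_comp n k h = VI_id n" "x \<in> VI_hom n n" for h k x :: "nat \<Rightarrow> nat \<Rightarrow> 'f"
  proof (rule VI_hom_eqI[OF gconj_in[OF that(2) gconj_in[OF that(1,4)]] that(4)])
    fix v :: "nat \<Rightarrow> 'f" assume v: "v \<in> fvec n"
    have kh: "mat_apply n k (mat_apply n h w) = w" if "w \<in> fvec n" for w
      using \<open>VI_comp n k h = VI_id n\<close> mat_apply_id[OF that] by (metis mat_apply_comp)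
    have "mat_apply n (gconj n k (gconj n h x)) v
        = mat_apply n (gconj n k (gconj n h x)) (mat_apply n k (mat_apply n h v))"
      by (simp only: kh[OF v])
    also have "\<dots> = mat_apply n k (mat_apply n (gconj n h x) (mat_apply n h v))"
      by (rule gconj_apply[OF that(2) VI_hom_apply_in[OF that(1)]])
    also have "\<dots> = mat_apply n x v"
      by (simp only: gconj_apply[OF that(1) v] kh[OF VI_hom_apply_in[OF that(4)]])
    finally show "mat_apply n (gconj n k (gconj n h x)) v = mat_apply n x v" .
  qed
  show "gconj n (ginv n h) (gconj n h x) = x"
    by (rule eq[OF h ginv(1,2)[OF h] x])
  show "gconj n h (gconj n (ginv n h) x) = x"
    by (rule eq[OF ginv(1)[OF h] h ginv(3)[OF h] x])
qed

lemma class_fun_gconj: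
  assumes "class_fun n \<psi>" "h \<in> VI_hom n n" "x \<in> VI_hom n n"
  shows "\<psi> (gconj n h x) = \<psi> x"
proof -
  have "\<psi> (gconj n h x) = \<psi> (VI_comp n (VI_comp n x (ginv n h)) h)"
    unfolding gconj_def using assms ginv(1)[OF assms(2)] VI_comp_in unfolding class_fun_def by blast
  also have "VI_comp n (VI_comp n x (ginv n h)) h = x"
    unfolding VI_comp_assoc[symmetric] ginv(2)[OF assms(2)] by (rule VI_comp_id_right[OF assms(3)])
  finally show ?thesis .
qed

text \<open>Used to bring a condition on \<open>x\<close> into standard position: conjugation by
  \<open>h\<close> moves an arbitrary subspace or injection to F_q^e.\<close>

lemma class_fun_sum_conj:
  assumes "class_fun n \<psi>" "h \<in> VI_hom n n"
  shows "sum \<psi> {x \<in> VI_hom n n. Q x} = sum \<psi> {x \<in> VI_hom n n. Q (gconj n h x)}"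
proof (rule sum.reindex_bij_witness[where i = "gconj n h" and j = "gconj n (ginv n h)"])
  note inv = gconj_inverse[OF assms(2)]
  fix x assume "x \<in> {x \<in> VI_hom n n. Q x}"
  then show "gconj n h (gconj n (ginv n h) x) = x" "gconj n (ginv n h) x \<in> {x \<in> VI_hom n n. Q (gconj n h x)}"
    "\<psi> (gconj n (ginv n h) x) = \<psi> x"
    using inv gconj_in[OF ginv(1)[OF assms(2)]] class_fun_gconj[OF assms(1) ginv(1)[OF assms(2)]] by auto
next
  note inv = gconj_inverse[OF assms(2)]
  fix x assume "x \<in> {x \<in> VI_hom n n. Q (gconj n h x)}"
  then show "gconj n (ginv n h) (gconj n h x) = x" "gconj n h x \<in> {x \<in> VI_hom n n. Q x}"
    using inv gconj_in[OF assms(2)] by auto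
qed

lemma VI_comp_eq_iff_apply:
  assumes "f \<in> VI_hom e n" "h \<in> VI_hom n n" "f' \<in> VI_hom e n"
  shows "VI_comp n h f = f' \<longleftrightarrow> (\<forall>a\<in>fvec e. mat_apply n h (mat_apply e f a) = mat_apply e f' a)"
proof
  assume "VI_comp n h f = f'"
  then show "\<forall>a\<in>fvec e. mat_apply n h (mat_apply e f a) = mat_apply e f' a"
    by (simp flip: mat_apply_comp)
next
  assume "\<forall>a\<in>fvec e. mat_apply n h (mat_apply e f a) = mat_apply e f' a"
  then show "VI_comp n h f = f'"
    by (intro VI_hom_eqI[OF VI_comp_in[OF assms(1,2)] assms(3)]) (simp add: mat_apply_comp)
qed

text \<open>Sending \<open>f a\<close> to \<open>f' a\<close> is an isomorphism between the two
  images and extends to F_q^n.\<close>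

lemma GL_transitive:
  fixes f f' :: "nat \<Rightarrow> nat \<Rightarrow> 'f::{finite,field}"
  assumes f: "f \<in> VI_hom e n" and f': "f' \<in> VI_hom e n"
  shows "\<exists>h\<in>VI_hom n n. VI_comp n h f = f'"
proof -
  let ?R = "{(mat_apply e f a, mat_apply e f' a) | a. a \<in> fvec e}"
  have "partial_iso ?R"
    unfolding partial_iso_def
  proof (intro conjI allI impI)
    have "(\<lambda>_. 0) \<in> fvec e" by (simp add: fvec_def)
    then show "((\<lambda>_. 0), (\<lambda>_. 0)) \<in> ?R" by force
  next
    fix u u' v v' c assume "(u, u') \<in> ?R" "(v, v') \<in> ?R"
    then obtain a b where ab: "a \<in> fvec e" "b \<in> fvec e"
      "u = mat_apply e f a" "u' = mat_apply e f' a" "v = mat_apply e f b" "v' = mat_apply e f' b"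
      by auto
    have "vcomb a c b \<in> fvec e" by (rule vsub_vcomb[OF vsub_fvec ab(1,2)])
    then show "(vcomb u c v, vcomb u' c v') \<in> ?R"
      unfolding ab mat_apply_vcomb[symmetric] by auto
  next
    fix u u' assume "(u, u') \<in> ?R"
    then show "u = (\<lambda>_. 0) \<longleftrightarrow> u' = (\<lambda>_. 0)"
      using VI_hom_apply_eq_0[OF f] VI_hom_apply_eq_0[OF f'] by auto
  qed
  moreover have "?R \<subseteq> fvec n \<times> fvec n" using VI_hom_apply_in[OF f] VI_hom_apply_in[OF f'] by auto
  ultimately have "\<exists>h\<in>VI_hom n n. \<forall>(u, v)\<in>?R. mat_apply n h u = v"
    by (rule partial_iso_extend_GL)
  then obtain h where h: "h \<in> VI_hom n n" "\<forall>(u, v)\<in>?R. mat_apply n h u = v" by (elim bexE)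
  have "mat_apply n h (mat_apply e f a) = mat_apply e f' a" if "a \<in> fvec e" for a
    using bspec[OF h(2), of "(mat_apply e f a, mat_apply e f' a)"] that by auto
  then have "VI_comp n h f = f'" unfolding VI_comp_eq_iff_apply[OF f h(1) f'] by blast
  with h(1) show ?thesis by blast
qed

lemma carry_finite: "finite (carry n f f')"
  unfolding carry_def by (rule finite_subset[OF _ VI_hom_finite]) auto

text \<open>Orbit counting: GL_n is partitioned by the value of \<open>x f\<close>, and left
  multiplication by an element taking one value to another injects one block into the other.\<close>

lemma card_carry:
  fixes f f' :: "nat \<Rightarrow> nat \<Rightarrow> 'f::{finite,field}"
  assumes f: "f \<in> VI_hom e n" and f': "f' \<in> VI_hom e n"
  shows "card (VI_hom e n :: (nat \<Rightarrow> nat \<Rightarrow> 'f) set) * card (carry n f f')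
    = card (VI_hom n n :: (nat \<Rightarrow> nat \<Rightarrow> 'f) set)"
proof -
  have same: "card (carry n f f1) \<le> card (carry n f f2)" if f12: "f1 \<in> VI_hom e n" "f2 \<in> VI_hom e n" for f1 f2 :: "nat \<Rightarrow> nat \<Rightarrow> 'f"
  proof -
    obtain k where k: "k \<in> VI_hom n n" "VI_comp n k f1 = f2" using GL_transitive[OF f12] by blast
    have "inj_on (VI_comp n k) (carry n f f1)"
      by (rule inj_on_inverseI[where g = "VI_comp n (ginv n k)"])
         (use ginv_cancel(1)[OF k(1)] in \<open>auto simp: carry_def\<close>)
    moreover have "VI_comp n k ` carry n f f1 \<subseteq> carry n f f2"
      unfolding carry_def using k VI_comp_in[OF _ k(1)] by (auto simp flip: VI_comp_assoc)
    ultimately show ?thesis using carry_finite by (metis card_inj_on_le)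
  qed
  have "(VI_hom n n :: (nat \<Rightarrow> nat \<Rightarrow> 'f) set) = (\<Union>f1\<in>(VI_hom e n :: (nat \<Rightarrow> nat \<Rightarrow> 'f) set). carry n f f1)"
    using VI_comp_in[OF f] by (auto simp: carry_def)
  moreover have "card (\<Union>f1\<in>(VI_hom e n :: (nat \<Rightarrow> nat \<Rightarrow> 'f) set). carry n f f1) = (\<Sum>f1\<in>(VI_hom e n :: (nat \<Rightarrow> nat \<Rightarrow> 'f) set). card (carry n f f1))"
    by (rule card_UN_disjoint[OF VI_hom_finite]) (simp add: carry_finite, auto simp: carry_def)
  ultimately have "card (VI_hom n n :: (nat \<Rightarrow> nat \<Rightarrow> 'f) set) = (\<Sum>f1\<in>(VI_hom e n :: (nat \<Rightarrow> nat \<Rightarrow> 'f) set). card (carry n f f1))" by (simp only:)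
  also have "\<dots> = (\<Sum>f1\<in>(VI_hom e n :: (nat \<Rightarrow> nat \<Rightarrow> 'f) set). card (carry n f f'))"
    by (rule sum.cong) (use same f' in \<open>auto intro: antisym\<close>)
  finally show ?thesis by simp
qed

lemma sum_times_card:
  assumes "finite A" "finite B"
  shows "(\<Sum>x\<in>A. \<chi> x * of_nat (card {f\<in>B. P x f})) = (\<Sum>f\<in>B. sum \<chi> {x\<in>A. P x f} :: 'k::comm_semiring_1)"
proof -
  have "(\<Sum>x\<in>A. \<chi> x * of_nat (card {f\<in>B. P x f})) = (\<Sum>x\<in>A. \<Sum>f\<in>B. if P x f then \<chi> x else 0)"
    using assms by (intro sum.cong refl) (simp add: mult.commute flip: sum.inter_filter)
  also have "\<dots> = (\<Sum>f\<in>B. \<Sum>x\<in>A. if P x f then \<chi> x else 0)" by (rule sum.swap)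
  also have "\<dots> = (\<Sum>f\<in>B. sum \<chi> {x\<in>A. P x f})"
    using assms by (simp add: sum.inter_filter)
  finally show ?thesis .
qed

text \<open>Frobenius reciprocity in elementary form. After exchanging the sums every injection
  \<open>f\<close> contributes the same amount, by conjugation with an \<open>h\<close> that extends
  \<open>f\<close>.\<close>

lemma sum_class_fun_theta:
  fixes \<chi> :: "(nat \<Rightarrow> nat \<Rightarrow> 'f::{finite,field}) \<Rightarrow> 'k::comm_ring_1"
  assumes cl: "class_fun n \<chi>" and e: "e \<le> n" and g: "g \<in> VI_hom e e"
  shows "(\<Sum>x\<in>VI_hom n n. \<chi> x * of_nat (theta e g n x))
    = of_nat (card (VI_hom e n :: (nat \<Rightarrow> nat \<Rightarrow> 'f) set)) * sum \<chi> (carry n (VI_id e) g)"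
proof -
  have "(\<Sum>x\<in>VI_hom n n. \<chi> x * of_nat (theta e g n x))
      = (\<Sum>f\<in>VI_hom e n. sum \<chi> {x\<in>VI_hom n n. VI_comp n x f = VI_comp e f g})"
    unfolding theta_def by (rule sum_times_card[OF VI_hom_finite VI_hom_finite])
  also have "\<dots> = (\<Sum>f\<in>(VI_hom e n :: (nat \<Rightarrow> nat \<Rightarrow> 'f) set). sum \<chi> (carry n (VI_id e) g))"
  proof (rule sum.cong[OF refl])
    fix f :: "nat \<Rightarrow> nat \<Rightarrow> 'f" assume f: "f \<in> VI_hom e n"
    obtain h where h: "h \<in> VI_hom n n" "VI_comp n h (VI_id e) = f"
      using GL_transitive[OF VI_id_in[OF e] f] by blast
    have "VI_comp n (gconj n h x) f = VI_comp e f g \<longleftrightarrow> VI_comp n x (VI_id e) = g"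
      if x: "x \<in> VI_hom n n" for x
    proof -
      have 1: "VI_comp n (gconj n h x) f = VI_comp n h (VI_comp n x (VI_id e))"
        using gconj_comp[OF h(1) VI_id_in[OF e], of x] unfolding h(2) .
      have 2: "VI_comp e f g = VI_comp n h g"
        unfolding h(2)[symmetric] VI_comp_assoc[symmetric] VI_comp_id_left[OF g] ..
      have "g \<in> VI_hom e n" using g VI_hom_mono[OF e] by blast
      from ginv_cancel(1)[OF h(1) this] ginv_cancel(1)[OF h(1) VI_comp_in[OF VI_id_in[OF e] x]]
      show ?thesis unfolding 1 2 by auto
    qed
    then show "sum \<chi> {x\<in>VI_hom n n. VI_comp n x f = VI_comp e f g} = sum \<chi> (carry n (VI_id e) g)"
      unfolding carry_def class_fun_sum_conj[OF cl h(1), where Q = "\<lambda>x. VI_comp n x f = VI_comp e f g"]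
      by (intro sum.cong) auto
  qed
  finally show ?thesis by simp
qed

section \<open>Cosets of pointwise stabilizers of arbitrary subspaces\<close>

definition agree :: "nat \<Rightarrow> (nat \<Rightarrow> 'f::{finite,field}) set \<Rightarrow> (nat \<Rightarrow> nat \<Rightarrow> 'f) \<Rightarrow> (nat \<Rightarrow> nat \<Rightarrow> 'f) set" where
  "agree n D x0 = {x \<in> VI_hom n n. \<forall>v\<in>D. mat_apply n x v = mat_apply n x0 v}"

text \<open>\<open>e\<close> is chosen as the largest number for which some element of GL_n maps
  F_q^e into \<open>D\<close>. If a vector of \<open>D\<close> were missed, it could serve as the
  image of the next unit vector.\<close>

lemma vsub_eq_image:
  fixes D :: "(nat \<Rightarrow> 'f::{finite,field}) set"
  assumes D: "vsub D" "D \<subseteq> fvec n"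
  shows "\<exists>e\<le>n. \<exists>h\<in>VI_hom n n. mat_apply n h ` fvec e = D"
proof -
  define P where "P e \<longleftrightarrow> (e \<le> n \<and> (\<exists>h\<in>VI_hom n n. mat_apply n (h :: nat \<Rightarrow> nat \<Rightarrow> 'f) ` fvec e \<subseteq> D))" for e
  have "fvec 0 = {\<lambda>_. 0 :: 'f}" by (auto simp: fvec_def)
  then have "P 0" using VI_id_in[of n n] D(1) unfolding P_def vsub_def by auto
  define e where "e = (GREATEST e. P e)"
  have "P e" unfolding e_def by (rule GreatestI_nat[of P 0 n, OF \<open>P 0\<close>]) (simp add: P_def)
  then obtain h :: "nat \<Rightarrow> nat \<Rightarrow> 'f" where h: "h \<in> VI_hom n n" "mat_apply n h ` fvec e \<subseteq> D" and e: "e \<le> n"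
    unfolding P_def by blast
  have "mat_apply n h ` fvec e = D"
  proof (rule ccontr)
    assume "mat_apply n h ` fvec e \<noteq> D"
    then obtain v where v: "v \<in> D" "v \<notin> mat_apply n h ` fvec e" using h by blast
    have "e \<noteq> n"
    proof
      assume "e = n"
      then have "mat_apply n h (mat_apply n (ginv n h) v) \<in> mat_apply n h ` fvec e"
        using VI_hom_apply_in[OF ginv(1)[OF h(1)]] by blast
      then show False using v ginv_apply(2)[OF h(1)] D(2) by auto
    qed
    then have en: "e < n" using e by simp
    let ?R = "{(u, mat_apply n h u) | u. u \<in> fvec e}"
    have mono: "fvec e \<subseteq> (fvec n :: (nat \<Rightarrow> 'f) set)" by (rule fvec_mono[OF e])
    have R: "partial_iso ?R"
      unfolding partial_iso_def
    proof (intro conjI allI impI)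
      have "(\<lambda>_. 0 :: 'f) \<in> fvec e" by (simp add: fvec_def)
      then show "((\<lambda>_. 0), (\<lambda>_. 0)) \<in> ?R" by force
    next
      fix u u' v v' c assume "(u, u') \<in> ?R" "(v, v') \<in> ?R"
      then show "(vcomb u c v, vcomb u' c v') \<in> ?R"
        using vsub_vcomb[OF vsub_fvec] by (auto simp: mat_apply_vcomb)
    next
      fix u u' assume "(u, u') \<in> ?R"
      then show "u = (\<lambda>_. 0) \<longleftrightarrow> u' = (\<lambda>_. 0)"
        using VI_hom_apply_eq_0[OF h(1)] mono by auto
    qed
    have u: "unit_vec e \<notin> Domain ?R" by (auto simp: fvec_def unit_vec_def)
    have v': "v \<notin> Range ?R" using v by auto
    note ins = partial_iso_insert[OF R u v']
    let ?R' = "{(vcomb a c (unit_vec e), vcomb b c v) |a b c. (a, b) \<in> ?R}"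
    have "?R' \<subseteq> fvec n \<times> fvec n"
    proof
      fix p assume "p \<in> ?R'"
      then obtain a c where p: "p = (vcomb a c (unit_vec e), vcomb (mat_apply n h a) c v)" "a \<in> fvec e" by auto
      have "v \<in> fvec n" using v D by blast
      moreover have "a \<in> fvec n" using p(2) mono by blast
      ultimately show "p \<in> fvec n \<times> fvec n"
        unfolding p(1) using VI_hom_apply_in[OF h(1)]
        by (intro SigmaI vsub_vcomb[OF vsub_fvec] unit_vec_in_fvec[OF en])
    qed
    from partial_iso_extend_GL[OF ins(1) this]
    obtain h' where h': "h' \<in> VI_hom n n" "\<forall>(u,v)\<in>?R'. mat_apply n h' u = v" by (elim bexE)
    have "mat_apply n h' w \<in> D" if w: "w \<in> fvec (Suc e)" for w
    proof -
      \<comment> \<open>Splits \<open>w\<close> into its part in F_q^e and its multiple of the new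
        unit vector.\<close>
      define a where "a = w(e := 0)"
      have "j = e \<or> Suc e \<le> j" if "e \<le> j" for j using that by linarith
      then have a: "a \<in> fvec e" using w by (auto simp: fvec_def a_def)
      have eq: "w = vcomb a (w e) (unit_vec e)" by (auto simp: vcomb_def unit_vec_def a_def)
      have "(vcomb a (w e) (unit_vec e), vcomb (mat_apply n h a) (w e) v) \<in> ?R'" using a by auto
      from bspec[OF h'(2) this]
      have "mat_apply n h' (vcomb a (w e) (unit_vec e)) = vcomb (mat_apply n h a) (w e) v" by simp
      then have "mat_apply n h' w = vcomb (mat_apply n h a) (w e) v" by (simp only: eq[symmetric])
      moreover have "mat_apply n h a \<in> D" using a h(2) by blast
      ultimately show ?thesis using vsub_vcomb[OF D(1) _ v(1)] by simp
    qed
    then have "P (Suc e)" unfolding P_def using en h'(1) by auto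
    then have "Suc e \<le> e" unfolding e_def by (rule Greatest_le_nat[of P _ n]) (simp add: P_def)
    then show False by simp
  qed
  with h(1) e show ?thesis by blast
qed

text \<open>Zero padding lets the same matrix stand for the map with the smaller codomain.\<close>

lemma VI_hom_restrict:
  assumes "A \<in> VI_hom e n" "\<And>a. a \<in> fvec e \<Longrightarrow> mat_apply e A a \<in> fvec m"
  shows "A \<in> VI_hom e m"
proof -
  have "A i j = 0" if "m \<le> j" for i j
  proof (cases "i < e")
    case True
    then have "A i \<in> fvec m" using assms(2)[OF unit_vec_in_fvec[OF True]] mat_apply_unit_vec[OF True] by metis
    then show ?thesis using that by (rule fvecD)
  next
    case False then show ?thesis using VI_hom_row_out[OF assms(1), of i] by simp
  qed
  then show ?thesis using assms(1) unfolding VI_hom_def by auto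
qed

text \<open>The base case: \<open>x0\<close> preserves \<open>D\<close>. An \<open>h\<close> taking
  F_q^e onto \<open>D\<close> transports \<open>x0\<close> to some \<open>g\<close> on F_q^e and
  conjugates the coset into one covered by \<open>zero\<close>.\<close>

lemma coset_sum_stable:
  fixes \<psi> :: "(nat \<Rightarrow> nat \<Rightarrow> 'f::{finite,field}) \<Rightarrow> 'k::field_char_0"
  assumes cl: "class_fun n \<psi>"
    and zero: "\<And>e g. e \<le> d \<Longrightarrow> e \<le> n \<Longrightarrow> g \<in> VI_hom e e \<Longrightarrow> sum \<psi> (carry n (VI_id e) g) = 0"
    and D: "vsub D" "D \<subseteq> fvec n" "card D \<le> card (UNIV :: 'f set) ^ d"
    and x0: "x0 \<in> VI_hom n n" "\<And>v. v \<in> D \<Longrightarrow> mat_apply n x0 v \<in> D"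
  shows "sum \<psi> (agree n D x0) = 0"
proof -
  obtain e h where e: "e \<le> n" and h: "h \<in> VI_hom n n" "mat_apply n h ` fvec e = D"
    using vsub_eq_image[OF D(1,2)] by blast
  have fe: "u \<in> fvec n" if "u \<in> fvec e" for u :: "nat \<Rightarrow> 'f" using fvec_mono[OF e] that by blast
  have "inj_on (mat_apply n h) (fvec e)"
    using VI_hom_apply_inj[OF h(1)] fe by (auto simp: inj_on_def)
  then have "card D = card (UNIV :: 'f set) ^ e" unfolding h(2)[symmetric] by (simp add: card_image card_fvec)
  then have ed: "e \<le> d" using D(3) card_field_gt_1[where 'f='f] by simp
  define y where "y = gconj n (ginv n h) x0"
  have y: "y \<in> VI_hom n n" unfolding y_def by (rule gconj_in[OF ginv(1)[OF h(1)] x0(1)])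
  have hy: "mat_apply n h (mat_apply n y u) = mat_apply n x0 (mat_apply n h u)" if "u \<in> fvec n" for u
    using gconj_apply[OF h(1) that, of y] gconj_inverse(2)[OF h(1) x0(1)] unfolding y_def by simp
  have ye: "mat_apply n y u \<in> fvec e" if u: "u \<in> fvec e" for u
  proof -
    have "mat_apply n x0 (mat_apply n h u) \<in> D" using x0(2) h(2) u by blast
    then obtain w where w: "w \<in> fvec e" "mat_apply n x0 (mat_apply n h u) = mat_apply n h w" using h(2) by blast
    then have "mat_apply n y u = w"
      using hy[OF fe[OF u]] VI_hom_apply_inj[OF h(1) VI_hom_apply_in[OF y] fe[OF w(1)]] by simp
    with w show ?thesis by simp
  qed
  define g where "g = VI_comp n y (VI_id e)"
  have gu: "mat_apply e g u = mat_apply n y u" if "u \<in> fvec e" for u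
    unfolding g_def mat_apply_comp mat_apply_id[OF that] ..
  have gn: "g \<in> VI_hom e n" unfolding g_def by (rule VI_comp_in[OF VI_id_in[OF e] y])
  have g: "g \<in> VI_hom e e" by (rule VI_hom_restrict[OF gn]) (simp add: gu ye)
  have "(\<forall>v\<in>D. mat_apply n (gconj n h x) v = mat_apply n x0 v) \<longleftrightarrow> VI_comp n x (VI_id e) = g"
    if x: "x \<in> VI_hom n n" for x
  proof -
    have "mat_apply n (gconj n h x) (mat_apply n h u) = mat_apply n x0 (mat_apply n h u)
      \<longleftrightarrow> mat_apply n x (mat_apply e (VI_id e) u) = mat_apply e g u" if u: "u \<in> fvec e" for u
      unfolding gconj_apply[OF h(1) fe[OF u]] hy[OF fe[OF u], symmetric] mat_apply_id[OF u] gu[OF u]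
      by (rule VI_hom_apply_inj[OF h(1) VI_hom_apply_in[OF x] VI_hom_apply_in[OF y]])
    then show ?thesis unfolding VI_comp_eq_iff_apply[OF VI_id_in[OF e] x gn] h(2)[symmetric] by auto
  qed
  then have "sum \<psi> (agree n D x0) = sum \<psi> (carry n (VI_id e) g)"
    unfolding agree_def carry_def class_fun_sum_conj[OF cl h(1), where Q = "\<lambda>x. \<forall>v\<in>D. mat_apply n x v = mat_apply n x0 v"]
    by (intro sum.cong) auto
  with zero[OF ed e g] show ?thesis by simp
qed

text \<open>The conjugating element must fix \<open>D\<close> pointwise and send \<open>x b\<close>
  to \<open>y b\<close> for \<open>b\<close> in \<open>D\<close>. On the sum of \<open>D\<close> and
  \<open>x D\<close> this prescribes a + x b |-> a + y b. If a + x b = 0, then \<open>x b\<close>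
  lies in \<open>D\<close> and equals \<open>y b\<close>, and the same holds with \<open>x\<close>
  and \<open>y\<close> exchanged; so the prescription is an isomorphism.\<close>

lemma coset_sum_conj:
  fixes \<psi> :: "(nat \<Rightarrow> nat \<Rightarrow> 'f::{finite,field}) \<Rightarrow> 'k::comm_monoid_add"
  assumes cl: "class_fun n \<psi>"
    and D: "vsub D" "D \<subseteq> fvec n"
    and x: "x \<in> VI_hom n n" and y: "y \<in> VI_hom n n"
    and same: "\<And>v. v \<in> D \<Longrightarrow> mat_apply n x v \<in> D \<Longrightarrow> mat_apply n y v = mat_apply n x v"
      "\<And>v. v \<in> D \<Longrightarrow> mat_apply n y v \<in> D \<Longrightarrow> mat_apply n y v = mat_apply n x v"
  shows "sum \<psi> (agree n D y) = sum \<psi> (agree n D x)"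
proof -
  let ?R = "{(vcomb a 1 (mat_apply n x b), vcomb a 1 (mat_apply n y b)) | a b. a \<in> D \<and> b \<in> D}"
  have D0: "(\<lambda>_. 0) \<in> D" using D(1) unfolding vsub_def by blast
  have memD: "b' \<in> D" if "vcomb a 1 b' = (\<lambda>_. 0)" "a \<in> D" for a b'
  proof -
    have "b' = (\<lambda>j. -1 * a j)"
      using that(1) by (simp add: vcomb_def fun_eq_iff add_eq_0_iff)
    then show ?thesis using vsub_scale[OF D(1) that(2), of "-1"] by simp
  qed
  have "partial_iso ?R"
    unfolding partial_iso_def
  proof (intro conjI allI impI)
    show "((\<lambda>_. 0), (\<lambda>_. 0)) \<in> ?R"
      using D0 by (auto intro!: exI[of _ "\<lambda>_. 0"])
  next
    fix u u' v v' c assume "(u, u') \<in> ?R" "(v, v') \<in> ?R"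
    then obtain a b a' b' where ab: "a \<in> D" "b \<in> D" "a' \<in> D" "b' \<in> D"
      "u = vcomb a 1 (mat_apply n x b)" "u' = vcomb a 1 (mat_apply n y b)"
      "v = vcomb a' 1 (mat_apply n x b')" "v' = vcomb a' 1 (mat_apply n y b')" by blast
    have "vcomb u c v = vcomb (vcomb a c a') 1 (mat_apply n x (vcomb b c b'))"
      "vcomb u' c v' = vcomb (vcomb a c a') 1 (mat_apply n y (vcomb b c b'))"
      unfolding ab mat_apply_vcomb by (simp_all add: vcomb_def algebra_simps)
    then show "(vcomb u c v, vcomb u' c v') \<in> ?R" using vsub_vcomb[OF D(1)] ab by blast
  next
    fix u u' assume "(u, u') \<in> ?R"
    then obtain a b where ab: "a \<in> D" "b \<in> D"
      "u = vcomb a 1 (mat_apply n x b)" "u' = vcomb a 1 (mat_apply n y b)" by blast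
    show "u = (\<lambda>_. 0) \<longleftrightarrow> u' = (\<lambda>_. 0)"
      using memD[OF _ ab(1), of "mat_apply n x b"] memD[OF _ ab(1), of "mat_apply n y b"] same ab by metis
  qed
  moreover have "?R \<subseteq> fvec n \<times> fvec n"
    using vsub_vcomb[OF vsub_fvec] D(2) VI_hom_apply_in[OF x] VI_hom_apply_in[OF y] by blast
  ultimately have "\<exists>h\<in>VI_hom n n. \<forall>(u, v)\<in>?R. mat_apply n h u = v"
    by (rule partial_iso_extend_GL)
  then obtain h where h: "h \<in> VI_hom n n" "\<forall>(u, v)\<in>?R. mat_apply n h u = v" by (elim bexE)
  have hD: "mat_apply n h a = a" if "a \<in> D" for a
  proof -
    have "(vcomb a 1 (mat_apply n x (\<lambda>_. 0)), vcomb a 1 (mat_apply n y (\<lambda>_. 0))) \<in> ?R" using that D0 by blast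
    from bspec[OF h(2) this] show ?thesis by simp
  qed
  have hx: "mat_apply n h (mat_apply n x b) = mat_apply n y b" if "b \<in> D" for b
  proof -
    have "(vcomb (\<lambda>_. 0) 1 (mat_apply n x b), vcomb (\<lambda>_. 0) 1 (mat_apply n y b)) \<in> ?R" using that D0 by blast
    from bspec[OF h(2) this] show ?thesis by (simp add: vcomb_def)
  qed
  have "mat_apply n (gconj n h z) v = mat_apply n y v \<longleftrightarrow> mat_apply n z v = mat_apply n x v"
    if z: "z \<in> VI_hom n n" and v: "v \<in> D" for z v
  proof -
    have "mat_apply n (gconj n h z) v = mat_apply n h (mat_apply n z v)"
      using gconj_apply[OF h(1), of v z] hD[OF v] D(2) v by auto
    then show ?thesis
      unfolding hx[OF v, symmetric] using VI_hom_apply_inj[OF h(1) VI_hom_apply_in[OF z] VI_hom_apply_in[OF x]] by simp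
  qed
  then show ?thesis
    unfolding agree_def class_fun_sum_conj[OF cl h(1), where Q = "\<lambda>x. \<forall>v\<in>D. mat_apply n x v = mat_apply n y v"]
    by (intro sum.cong) auto
qed

text \<open>Let \<open>D'\<close> be the part of \<open>D\<close> that \<open>x0\<close> maps into \<open>D\<close>. The sum over \<open>{x. x = x0 on D'}\<close> vanishes by
  induction on \<open>D\<close> and splits according to \<open>x\<close> on \<open>D\<close>. The pieces in which \<open>x\<close> maps a larger part of \<open>D\<close> into \<open>D\<close>
  vanish by the inner induction; all others are conjugate under the pointwise stabilizer of \<open>D\<close>.\<close>
lemma coset_sum_zero:
  fixes \<psi> :: "(nat \<Rightarrow> nat \<Rightarrow> 'f::{finite,field}) \<Rightarrow> 'k::field_char_0"
  assumes cl: "class_fun n \<psi>"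
    and zero: "\<And>e g. e \<le> d \<Longrightarrow> e \<le> n \<Longrightarrow> g \<in> VI_hom e e \<Longrightarrow> sum \<psi> (carry n (VI_id e) g) = 0"
    and D: "vsub D" "D \<subseteq> fvec n" "card D \<le> card (UNIV :: 'f set) ^ d"
    and x0: "x0 \<in> VI_hom n n"
  shows "sum \<psi> (agree n D x0) = 0"
  using D x0
proof (induction "card D" arbitrary: D x0 rule: less_induct)
  case (less D)
  note outer = less.hyps
  note D = less.prems(1-3)
  have finD: "finite D" using D(2) card_fvec(1) finite_subset by blast
  define stay where "stay x = {v\<in>D. mat_apply n x v \<in> D}" for x
  from \<open>x0 \<in> VI_hom n n\<close> show ?case
  proof (induction "card (D - stay x0)" arbitrary: x0 rule: less_induct)
    case (less x0)
    show ?case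
    proof (cases "stay x0 = D")
      case True
      then show ?thesis
        using coset_sum_stable[OF cl zero D less.prems] by (auto simp: stay_def)
    next
      case False
      let ?D' = "stay x0"
      have sub: "?D' \<subset> D" using False by (auto simp: stay_def)
      have vD': "vsub ?D'"
        unfolding vsub_def
      proof (intro conjI ballI allI)
        show "(\<lambda>_. 0) \<in> ?D'" using D(1) unfolding vsub_def stay_def by simp
        show "vcomb u c v \<in> ?D'" if "u \<in> ?D'" "v \<in> ?D'" for u v c
          using that vsub_vcomb[OF D(1)] unfolding stay_def by (simp add: mat_apply_vcomb)
      qed
      have cD': "card ?D' < card D" using psubset_card_mono[OF finD sub] .
      define E where "E = agree n ?D' x0"
      have E0: "sum \<psi> E = 0"
        \<comment> \<open>The outer induction covers every element of GL_n, so \<open>x0\<close> may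
          map \<open>stay x0\<close> to a different subspace of \<open>D\<close>.\<close>
        unfolding E_def using cD' sub D by (intro outer vD' less.prems) auto
      have finE: "finite E" unfolding E_def agree_def by (rule finite_subset[OF _ VI_hom_finite]) auto
      define r where "r x = restrict (mat_apply n x) D" for x
      define S where "S = sum \<psi> (agree n D x0)"
      have Eg: "y \<in> VI_hom n n" if "y \<in> E" for y using that unfolding E_def agree_def by blast
      have stay_E: "?D' \<subseteq> stay y" if "y \<in> E" for y
        using that unfolding stay_def E_def agree_def by auto
      \<comment> \<open>The class of \<open>y\<close> is its coset over \<open>D\<close>. Either
        \<open>y\<close> keeps exactly as much of \<open>D\<close> inside \<open>D\<close> as
        \<open>x0\<close>, and the coset is conjugate to that of \<open>x0\<close>, or it keeps more
        and the inner induction applies.\<close>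
      have cls: "sum \<psi> {x\<in>E. r x = r y} = (if stay y = ?D' then S else 0)" if y: "y \<in> E" for y
      proof -
        have req: "r x = r y \<longleftrightarrow> (\<forall>v\<in>D. mat_apply n x v = mat_apply n y v)" for x
          unfolding r_def by (metis restrict_apply' restrict_ext)
        have eq: "{x\<in>E. r x = r y} = agree n D y"
          using y sub unfolding req E_def agree_def by auto
        show ?thesis
        proof (cases "stay y = ?D'")
          case True
          have "mat_apply n y v = mat_apply n x0 v" if "v \<in> ?D'" for v
            using y that unfolding E_def agree_def by blast
          then have "sum \<psi> (agree n D y) = S"
            unfolding S_def using True by (intro coset_sum_conj[OF cl D(1,2) less.prems Eg[OF y]]) (auto simp: stay_def)
          then show ?thesis using True eq by simp
        next
          case ne: False
          then have "D - stay y \<subset> D - stay x0" using stay_E[OF y] unfolding stay_def by blast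
          then have "card (D - stay y) < card (D - stay x0)"
            using finD by (intro psubset_card_mono) auto
          then have "sum \<psi> (agree n D y) = 0" by (rule less.hyps) (rule Eg[OF y])
          then show ?thesis using ne eq by simp
        qed
      qed
      define K where "K = {\<rho> \<in> r ` E. {v\<in>D. \<rho> v \<in> D} = ?D'}"
      have stay_r: "{v\<in>D. r y v \<in> D} = stay y" for y unfolding r_def stay_def by auto
      have "0 = (\<Sum>\<rho>\<in>r ` E. sum \<psi> {x\<in>E. r x = \<rho>})"
        using sum.image_gen[OF finE, of \<psi> r] E0 by simp
      also have "\<dots> = (\<Sum>\<rho>\<in>r ` E. if {v\<in>D. \<rho> v \<in> D} = ?D' then S else 0)"
      proof (rule sum.cong[OF refl])
        fix \<rho> assume "\<rho> \<in> r ` E"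
        then obtain y where y: "y \<in> E" "\<rho> = r y" by blast
        show "sum \<psi> {x\<in>E. r x = \<rho>} = (if {v\<in>D. \<rho> v \<in> D} = ?D' then S else 0)"
          unfolding y(2) stay_r by (rule cls[OF y(1)])
      qed
      also have "\<dots> = of_nat (card K) * S"
        unfolding K_def using finE by (simp add: sum.If_cases Int_def)
      finally have prod0: "of_nat (card K) * S = 0" by simp
      have "x0 \<in> E" using less.prems unfolding E_def agree_def by simp
      then have "r x0 \<in> K" unfolding K_def by (simp add: stay_r)
      moreover have "finite K" unfolding K_def using finE by simp
      \<comment> \<open>In characteristic zero a positive number of pieces, all with sum
        \<open>S\<close>, can only add up to zero if \<open>S = 0\<close>.\<close>
      ultimately have "card K \<noteq> 0" by auto
      with prod0 show ?thesis unfolding S_def by simp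
    qed
  qed
qed

section \<open>Gram matrices and relative positions\<close>

text \<open>A linear form vanishing on the common zeros of finitely many forms is a combination of
  them. It replaces inversion of the possibly singular Gram matrix.\<close>

lemma fredholm:
  fixes r :: "'i \<Rightarrow> 'j \<Rightarrow> 'k::field"
  assumes "finite I" and J: "finite J"
    and "\<And>c. (\<And>i. i \<in> I \<Longrightarrow> (\<Sum>j\<in>J. r i j * c j) = 0) \<Longrightarrow> (\<Sum>j\<in>J. b j * c j) = 0"
  shows "\<exists>y. \<forall>j\<in>J. b j = (\<Sum>i\<in>I. y i * r i j)"
  using assms(1,3)
proof (induction I arbitrary: b rule: finite_induct)
  case empty
  have "b j = 0" if "j \<in> J" for j
    using empty[of "\<lambda>i. if i = j then 1 else 0"] J that by (simp add: if_distrib cong: if_cong)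
  then show ?case by simp
next
  case (insert i0 I)
  show ?case
  proof (cases "\<exists>c0. (\<forall>i\<in>I. (\<Sum>j\<in>J. r i j * c0 j) = 0) \<and> (\<Sum>j\<in>J. r i0 j * c0 j) \<noteq> 0")
    case True
    then obtain c0 where c0: "\<And>i. i \<in> I \<Longrightarrow> (\<Sum>j\<in>J. r i j * c0 j) = 0" "(\<Sum>j\<in>J. r i0 j * c0 j) \<noteq> 0"
      by blast
    \<comment> \<open>\<open>c0\<close> is killed by all forms of \<open>I\<close> but not by form
      \<open>i0\<close>; subtracting \<open>t\<close> times form \<open>i0\<close> makes
      \<open>b\<close> vanish at \<open>c0\<close>.\<close>
    define s where "s = (\<Sum>j\<in>J. r i0 j * c0 j)"
    define t where "t = (\<Sum>j\<in>J. b j * c0 j) / s"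
    have s: "s \<noteq> 0" using c0(2) unfolding s_def .
    have lin: "(\<Sum>j\<in>J. a j * (c j - w * c0 j)) = (\<Sum>j\<in>J. a j * c j) - w * (\<Sum>j\<in>J. a j * c0 j)" for a c w
      by (simp add: algebra_simps sum_subtractf sum_distrib_left)
    have "(\<Sum>j\<in>J. (b j - t * r i0 j) * c j) = 0" if c: "\<And>i. i \<in> I \<Longrightarrow> (\<Sum>j\<in>J. r i j * c j) = 0" for c
    proof -
      \<comment> \<open>The multiple of \<open>c0\<close> to be subtracted from \<open>c\<close> so
        that form \<open>i0\<close> vanishes as well.\<close>
      define w where "w = (\<Sum>j\<in>J. r i0 j * c j) / s"
      have "(\<Sum>j\<in>J. r i j * (c j - w * c0 j)) = 0" if "i \<in> insert i0 I" for i
        using that c c0(1) s unfolding lin by (auto simp: s_def[symmetric] w_def)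
      then have "(\<Sum>j\<in>J. b j * (c j - w * c0 j)) = 0" by (rule insert.prems)
      then have "(\<Sum>j\<in>J. b j * c j) = w * (\<Sum>j\<in>J. b j * c0 j)" unfolding lin by simp
      also have "\<dots> = t * (\<Sum>j\<in>J. r i0 j * c j)" by (simp add: w_def t_def)
      finally show ?thesis by (simp add: left_diff_distrib sum_subtractf sum_distrib_left mult.assoc)
    qed
    from insert.IH[OF this] obtain y where y: "\<And>j. j \<in> J \<Longrightarrow> b j - t * r i0 j = (\<Sum>i\<in>I. y i * r i j)"
      by blast
    have "b j = (\<Sum>i\<in>insert i0 I. (y(i0 := t)) i * r i j)" if "j \<in> J" for j
    proof -
      have "(\<Sum>i\<in>I. (y(i0 := t)) i * r i j) = (\<Sum>i\<in>I. y i * r i j)"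
        using insert.hyps by (intro sum.cong) auto
      then show ?thesis using insert.hyps y[OF that] by (simp add: algebra_simps)
    qed
    then show ?thesis by blast
  next
    case False
    have "(\<Sum>j\<in>J. b j * c j) = 0" if "\<And>i. i \<in> I \<Longrightarrow> (\<Sum>j\<in>J. r i j * c j) = 0" for c
      using insert.prems[of c] False that by auto
    from insert.IH[OF this] obtain y where y: "\<And>j. j \<in> J \<Longrightarrow> b j = (\<Sum>i\<in>I. y i * r i j)" by blast
    have "b j = (\<Sum>i\<in>insert i0 I. (y(i0 := 0)) i * r i j)" if "j \<in> J" for j
    proof -
      have "(\<Sum>i\<in>I. (y(i0 := 0)) i * r i j) = (\<Sum>i\<in>I. y i * r i j)"
        using insert.hyps by (intro sum.cong) auto
      then show ?thesis using insert.hyps y[OF that] by simp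
    qed
    then show ?thesis by blast
  qed
qed

text \<open>Evaluation at \<open>x1\<close> is represented by an inner product with a combination of
  the \<open>T\<close>. For \<open>c\<close> in the kernel of the Gram matrix the function
  \<open>u\<close> has square sum zero, so it vanishes at \<open>x1\<close>. The order on the field
  is essential, hence the later use over the rationals only.\<close>

lemma gram_representation:
  fixes T :: "'i \<Rightarrow> 'x \<Rightarrow> 'k::linordered_field"
  assumes I: "finite I" and X: "finite X" and x1: "x1 \<in> X"
  shows "\<exists>c. \<forall>i\<in>I. T i x1 = (\<Sum>j\<in>I. c j * (\<Sum>x\<in>X. T j x * T i x))"
proof (rule fredholm[OF I I])
  fix c assume c: "\<And>i. i \<in> I \<Longrightarrow> (\<Sum>j\<in>I. (\<Sum>x\<in>X. T i x * T j x) * c j) = 0"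
  define u where "u x = (\<Sum>j\<in>I. T j x * c j)" for x
  have "(\<Sum>x\<in>X. u x * u x) = (\<Sum>x\<in>X. \<Sum>i\<in>I. \<Sum>j\<in>I. c i * (T i x * T j x * c j))"
    unfolding u_def sum_product by (simp add: mult_ac)
  also have "\<dots> = (\<Sum>i\<in>I. \<Sum>j\<in>I. \<Sum>x\<in>X. c i * (T i x * T j x * c j))"
    by (subst sum.swap, rule sum.cong[OF refl], rule sum.swap)
  also have "\<dots> = (\<Sum>i\<in>I. c i * (\<Sum>j\<in>I. (\<Sum>x\<in>X. T i x * T j x) * c j))"
    by (simp add: sum_distrib_left sum_distrib_right)
  also have "\<dots> = 0" using c by simp
  finally have "\<forall>x\<in>X. u x * u x = 0" using X by (subst (asm) sum_nonneg_eq_0_iff) auto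
  then show "(\<Sum>j\<in>I. T j x1 * c j) = 0" using x1 unfolding u_def by simp
qed

text \<open>The pullback of two injections: it determines their relative position up to \<open>GL_n\<close>.\<close>
definition pair_type where
  "pair_type e e' f f' = {(a, b). a \<in> fvec e \<and> b \<in> fvec e' \<and> mat_apply e f a = mat_apply e' f' b}"

definition pair_types :: "nat \<Rightarrow> nat \<Rightarrow> nat \<Rightarrow> ((nat \<Rightarrow> 'f::{finite,field}) \<times> (nat \<Rightarrow> 'f)) set set" where
  "pair_types e e' n = (\<lambda>(f, f'). pair_type e e' f f') ` (VI_hom e n \<times> VI_hom e' n)"

text \<open>The preimage of \<open>K\<close> under \<open>g\<close> and \<open>g'\<close>: the
  effect on a pullback of precomposing the two injections.\<close>

definition twist where
  "twist e e' g g' K = {(a, b). a \<in> fvec e \<and> b \<in> fvec e' \<and> (mat_apply e g a, mat_apply e' g' b) \<in> K}"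

lemma pair_type_twist:
  assumes "g \<in> VI_hom e e" "g' \<in> VI_hom e' e'"
  shows "pair_type e e' (VI_comp e f g) (VI_comp e' f' g') = twist e e' g g' (pair_type e e' f f')"
  unfolding pair_type_def twist_def
  using VI_hom_apply_in[OF assms(1)] VI_hom_apply_in[OF assms(2)] by (auto simp: mat_apply_comp)

lemma pair_type_comp:
  assumes "x \<in> VI_hom n n" "f \<in> VI_hom e n" "f' \<in> VI_hom e' n"
  shows "pair_type e e' (VI_comp n x f) (VI_comp n x f') = pair_type e e' f f'"
  unfolding pair_type_def mat_apply_comp
  using VI_hom_apply_inj[OF assms(1) VI_hom_apply_in[OF assms(2)] VI_hom_apply_in[OF assms(3)]] by simp

definition sum_space where
  "sum_space e e' f f' = {vcomb (mat_apply e f a) 1 (mat_apply e' f' b) | a b. a \<in> fvec e \<and> b \<in> fvec e'}"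

lemma fvec_0: "fvec 0 = {\<lambda>_. 0}"
  by (auto simp: fvec_def)

lemma fvec_0_in: "(\<lambda>_. 0) \<in> fvec n"
  by (simp add: fvec_def)

lemma vcomb_vcomb:
  "vcomb (vcomb a 1 b) c (vcomb a' 1 b') = vcomb (vcomb a c a') 1 (vcomb b c b')"
  by (simp add: vcomb_def algebra_simps)

lemma vsub_sum_space: "vsub (sum_space e e' f f')"
  unfolding vsub_def
proof (intro conjI ballI allI)
  have "vcomb (mat_apply e f (\<lambda>_. 0)) 1 (mat_apply e' f' (\<lambda>_. 0)) \<in> sum_space e e' f f'"
    unfolding sum_space_def using fvec_0_in by blast
  then show "(\<lambda>_. 0) \<in> sum_space e e' f f'" by simp
next
  fix u v c assume "u \<in> sum_space e e' f f'" "v \<in> sum_space e e' f f'"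
  then obtain a b a' b' where ab: "a \<in> fvec e" "b \<in> fvec e'" "a' \<in> fvec e" "b' \<in> fvec e'"
    "u = vcomb (mat_apply e f a) 1 (mat_apply e' f' b)" "v = vcomb (mat_apply e f a') 1 (mat_apply e' f' b')"
    unfolding sum_space_def by auto
  have "vcomb u c v = vcomb (mat_apply e f (vcomb a c a')) 1 (mat_apply e' f' (vcomb b c b'))"
    unfolding ab(5,6) mat_apply_vcomb by (rule vcomb_vcomb)
  then show "vcomb u c v \<in> sum_space e e' f f'"
    unfolding sum_space_def using vsub_vcomb[OF vsub_fvec ab(1,3)] vsub_vcomb[OF vsub_fvec ab(2,4)] by auto
qed

lemma sum_space_sub:
  assumes "f \<in> VI_hom e n" "f' \<in> VI_hom e' n"
  shows "sum_space e e' f f' \<subseteq> fvec n"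
  unfolding sum_space_def
  using vsub_vcomb[OF vsub_fvec VI_hom_apply_in[OF assms(1)] VI_hom_apply_in[OF assms(2)]] by auto

lemma sum_space_contains:
  shows "a \<in> fvec e \<Longrightarrow> mat_apply e f a \<in> sum_space e e' f f'"
    "b \<in> fvec e' \<Longrightarrow> mat_apply e' f' b \<in> sum_space e e' f f'"
proof -
  show "mat_apply e f a \<in> sum_space e e' f f'" if "a \<in> fvec e"
    unfolding sum_space_def using that fvec_0_in[of e']
    by (intro CollectI exI[of _ a] exI[of _ "\<lambda>_. 0"]) simp
  show "mat_apply e' f' b \<in> sum_space e e' f f'" if "b \<in> fvec e'"
    unfolding sum_space_def using that fvec_0_in[of e]
    by (intro CollectI exI[of _ "\<lambda>_. 0"] exI[of _ b]) (simp add: vcomb_def)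
qed

lemma card_sum_space:
  fixes f f' :: "nat \<Rightarrow> nat \<Rightarrow> 'f::{finite,field}"
  shows "card (sum_space e e' f f') \<le> card (UNIV :: 'f set) ^ (e + e')"
proof -
  have eq: "sum_space e e' f f'
    = (\<lambda>(a, b). vcomb (mat_apply e f a) 1 (mat_apply e' f' b)) ` (fvec e \<times> fvec e')"
    unfolding sum_space_def by auto
  have "card (sum_space e e' f f') \<le> card (fvec e \<times> fvec e' :: ((nat \<Rightarrow> 'f) \<times> (nat \<Rightarrow> 'f)) set)"
    unfolding eq by (rule card_image_le) (simp add: card_fvec(1))
  then show ?thesis by (simp add: card_cartesian_product card_fvec(2) power_add)
qed

text \<open>The identity of F_q^e extends to an embedding of \<open>D\<close> into F_q^m by the
  bound on its size, and then to an element of GL_n.\<close>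

lemma move_into:
  fixes D :: "(nat \<Rightarrow> 'f::{finite,field}) set"
  assumes D: "vsub D" "D \<subseteq> fvec n" "card D \<le> card (UNIV :: 'f set) ^ m"
    and e: "fvec e \<subseteq> D" "e \<le> m" "m \<le> n"
  shows "\<exists>x\<in>VI_hom n n. (\<forall>v\<in>fvec e. mat_apply n x v = v) \<and> (\<forall>v\<in>D. mat_apply n x v \<in> fvec m)"
proof -
  let ?R = "{(u, u) | u. u \<in> fvec e} :: ((nat \<Rightarrow> 'f) \<times> (nat \<Rightarrow> 'f)) set"
  have "partial_iso ?R"
    unfolding partial_iso_def using fvec_0_in vsub_vcomb[OF vsub_fvec] by auto
  moreover have "?R \<subseteq> D \<times> fvec m" using e(1) fvec_mono[OF e(2)] by auto
  moreover have "finite D" using D(2) card_fvec(1) finite_subset by blast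
  moreover have "card D \<le> card (fvec m :: (nat \<Rightarrow> 'f) set)" using D(3) by (simp add: card_fvec(2))
  ultimately have "\<exists>R'. partial_iso R' \<and> ?R \<subseteq> R' \<and> R' \<subseteq> D \<times> fvec m \<and> Domain R' = D"
    by (rule partial_iso_extend[OF _ _ D(1) vsub_fvec _ card_fvec(1)])
  then obtain R' where R': "partial_iso R'" "?R \<subseteq> R'" "R' \<subseteq> D \<times> fvec m" "Domain R' = D" by (elim exE conjE)
  have "R' \<subseteq> fvec n \<times> fvec n" using R'(3) D(2) fvec_mono[OF e(3)] by auto
  from partial_iso_extend_GL[OF R'(1) this]
  obtain x where x: "x \<in> VI_hom n n" "\<forall>(u, v)\<in>R'. mat_apply n x u = v" by (elim bexE)
  have "mat_apply n x v = v" if "v \<in> fvec e" for v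
  proof -
    have "(v, v) \<in> R'" using R'(2) that by auto
    from bspec[OF x(2) this] show ?thesis by simp
  qed
  moreover have "mat_apply n x v \<in> fvec m" if v: "v \<in> D" for v
  proof -
    obtain w where w: "(v, w) \<in> R'" using R'(4) v by auto
    from bspec[OF x(2) w] show ?thesis using w R'(3) by auto
  qed
  ultimately show ?thesis using x(1) by blast
qed

text \<open>Two images span at most e + e' dimensions, so an element of GL_n moves both into
  F_q^(e+e') and leaves the pullback unchanged.\<close>

lemma pair_types_stable:
  assumes n: "e + e' \<le> n"
  shows "pair_types e e' n = (pair_types e e' (e + e') :: ((nat \<Rightarrow> 'f::{finite,field}) \<times> (nat \<Rightarrow> 'f)) set set)"
proof
  show "pair_types e e' (e + e') \<subseteq> (pair_types e e' n :: ((nat \<Rightarrow> 'f) \<times> (nat \<Rightarrow> 'f)) set set)"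
    unfolding pair_types_def using VI_hom_mono[OF n] by (intro image_mono Sigma_mono)
  show "pair_types e e' n \<subseteq> (pair_types e e' (e + e') :: ((nat \<Rightarrow> 'f) \<times> (nat \<Rightarrow> 'f)) set set)"
  proof
    fix K :: "((nat \<Rightarrow> 'f) \<times> (nat \<Rightarrow> 'f)) set" assume "K \<in> pair_types e e' n"
    then obtain f f' where f: "f \<in> VI_hom e n" "f' \<in> VI_hom e' n" "K = pair_type e e' f f'"
      unfolding pair_types_def by auto
    have "fvec 0 \<subseteq> sum_space e e' f f'"
      using vsub_sum_space[of e e' f f'] unfolding vsub_def fvec_0 by blast
    from move_into[OF vsub_sum_space sum_space_sub[OF f(1,2)] card_sum_space this _ n]
    obtain x where x: "x \<in> VI_hom n n" "\<And>v. v \<in> sum_space e e' f f' \<Longrightarrow> mat_apply n x v \<in> fvec (e + e')"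
      by auto
    have "VI_comp n x f \<in> VI_hom e (e + e')" "VI_comp n x f' \<in> VI_hom e' (e + e')"
      using x(2) sum_space_contains[where f = f and f' = f' and e = e and e' = e']
      by (auto intro!: VI_hom_restrict[OF VI_comp_in[OF f(1) x(1)]] VI_hom_restrict[OF VI_comp_in[OF f(2) x(1)]]
          simp: mat_apply_comp)
    moreover have "K = pair_type e e' (VI_comp n x f) (VI_comp n x f')"
      unfolding f(3) pair_type_comp[OF x(1) f(1,2)] ..
    ultimately show "K \<in> pair_types e e' (e + e')" unfolding pair_types_def by auto
  qed
qed

text \<open>The map f a + f' b |-> h a + h' b extends to the desired element. Its source vanishes
  exactly if (a, -b) lies in the pullback of \<open>f\<close> and \<open>f'\<close>, its target
  exactly if (a, -b) lies in that of \<open>h\<close> and \<open>h'\<close>; equal pullbacks make it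
  well defined and injective.\<close>

lemma pair_transitive:
  fixes f f' h h' :: "nat \<Rightarrow> nat \<Rightarrow> 'f::{finite,field}"
  assumes f: "f \<in> VI_hom e n" "f' \<in> VI_hom e' n" and h: "h \<in> VI_hom e n" "h' \<in> VI_hom e' n"
    and K: "pair_type e e' f f' = pair_type e e' h h'"
  shows "\<exists>x\<in>VI_hom n n. VI_comp n x f = h \<and> VI_comp n x f' = h'"
proof -
  let ?R = "{(vcomb (mat_apply e f a) 1 (mat_apply e' f' b), vcomb (mat_apply e h a) 1 (mat_apply e' h' b))
    | a b. a \<in> fvec e \<and> b \<in> fvec e'}"
  have neg: "vcomb u 1 (mat_apply m A b) = (\<lambda>_. 0) \<longleftrightarrow> u = mat_apply m A (vcomb (\<lambda>_. 0) (-1) b)"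
    for u :: "nat \<Rightarrow> 'f" and m A b
    unfolding mat_apply_vcomb mat_apply_0 by (simp add: vcomb_def fun_eq_iff eq_neg_iff_add_eq_0)
  have "partial_iso ?R"
    unfolding partial_iso_def
  proof (intro conjI allI impI)
    show "((\<lambda>_. 0), (\<lambda>_. 0)) \<in> ?R"
      by (intro CollectI exI[of _ "\<lambda>_. 0"]) (simp add: fvec_0_in)
  next
    fix u u' v v' c assume "(u, u') \<in> ?R" "(v, v') \<in> ?R"
    then obtain a b a' b' where ab: "a \<in> fvec e" "b \<in> fvec e'" "a' \<in> fvec e" "b' \<in> fvec e'"
      "u = vcomb (mat_apply e f a) 1 (mat_apply e' f' b)" "v = vcomb (mat_apply e f a') 1 (mat_apply e' f' b')"
      "u' = vcomb (mat_apply e h a) 1 (mat_apply e' h' b)" "v' = vcomb (mat_apply e h a') 1 (mat_apply e' h' b')"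
      by auto
    show "(vcomb u c v, vcomb u' c v') \<in> ?R"
      unfolding ab(5-8) vcomb_vcomb mat_apply_vcomb[symmetric]
      using vsub_vcomb[OF vsub_fvec ab(1,3)] vsub_vcomb[OF vsub_fvec ab(2,4)] by blast
  next
    fix u u' assume "(u, u') \<in> ?R"
    then obtain a b where ab: "a \<in> fvec e" "b \<in> fvec e'"
      "u = vcomb (mat_apply e f a) 1 (mat_apply e' f' b)" "u' = vcomb (mat_apply e h a) 1 (mat_apply e' h' b)"
      by auto
    have "vcomb (\<lambda>_. 0) (-1) b \<in> fvec e'" by (rule vsub_vcomb[OF vsub_fvec fvec_0_in ab(2)])
    then have "(a, vcomb (\<lambda>_. 0) (-1) b) \<in> pair_type e e' f f' \<longleftrightarrow> u = (\<lambda>_. 0)"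
      "(a, vcomb (\<lambda>_. 0) (-1) b) \<in> pair_type e e' h h' \<longleftrightarrow> u' = (\<lambda>_. 0)"
      using ab(1) unfolding pair_type_def ab(3,4) neg by auto
    then show "u = (\<lambda>_. 0) \<longleftrightarrow> u' = (\<lambda>_. 0)" using K by simp
  qed
  moreover have "?R \<subseteq> fvec n \<times> fvec n"
    using vsub_vcomb[OF vsub_fvec VI_hom_apply_in[OF f(1)] VI_hom_apply_in[OF f(2)]]
      vsub_vcomb[OF vsub_fvec VI_hom_apply_in[OF h(1)] VI_hom_apply_in[OF h(2)]] by auto
  ultimately have "\<exists>x\<in>VI_hom n n. \<forall>(u, v)\<in>?R. mat_apply n x u = v"
    by (rule partial_iso_extend_GL)
  then obtain x where x: "x \<in> VI_hom n n" "\<forall>(u, v)\<in>?R. mat_apply n x u = v" by (elim bexE)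
  have eq: "mat_apply n x (vcomb (mat_apply e f a) 1 (mat_apply e' f' b)) = vcomb (mat_apply e h a) 1 (mat_apply e' h' b)"
    if "a \<in> fvec e" "b \<in> fvec e'" for a b
    using bspec[OF x(2), of "(vcomb (mat_apply e f a) 1 (mat_apply e' f' b), vcomb (mat_apply e h a) 1 (mat_apply e' h' b))"] that
    by auto
  have "VI_comp n x f = h"
    unfolding VI_comp_eq_iff_apply[OF f(1) x(1) h(1)] using eq[OF _ fvec_0_in] by simp
  moreover have "VI_comp n x f' = h'"
    unfolding VI_comp_eq_iff_apply[OF f(2) x(1) h(2)] using eq[OF fvec_0_in] by (simp add: vcomb_def)
  ultimately show ?thesis using x(1) by blast
qed

text \<open>Double counting of an element \<open>x\<close> with a pair \<open>p = (f, f')\<close> it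
  takes to \<open>tw p\<close>. For fixed \<open>p\<close> there is such an \<open>x\<close> only if
  \<open>p\<close> and \<open>tw p\<close> have the same type. Within a type the number of elements
  between two pairs is constant, so every type fixed by \<open>twist\<close> contributes exactly the
  order of GL_n.\<close>

lemma sum_theta_theta:
  fixes g g' :: "nat \<Rightarrow> nat \<Rightarrow> 'f::{finite,field}"
  assumes g: "g \<in> VI_hom e e" "g' \<in> VI_hom e' e'"
  shows "(\<Sum>x\<in>VI_hom n n. theta e g n x * theta e' g' n x)
    = card {K \<in> pair_types e e' n. twist e e' g g' K = K} * card (VI_hom n n :: (nat \<Rightarrow> nat \<Rightarrow> 'f) set)"
proof -
  let ?G = "VI_hom n n :: (nat \<Rightarrow> nat \<Rightarrow> 'f) set"
  define P where "P = (VI_hom e n :: (nat \<Rightarrow> nat \<Rightarrow> 'f) set) \<times> (VI_hom e' n :: (nat \<Rightarrow> nat \<Rightarrow> 'f) set)"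
  define act where "act x p = (VI_comp n x (fst p), VI_comp n x (snd p))"
    for x and p :: "(nat \<Rightarrow> nat \<Rightarrow> 'f) \<times> (nat \<Rightarrow> nat \<Rightarrow> 'f)"
  define tw where "tw p = (VI_comp e (fst p) g, VI_comp e' (snd p) g')"
    for p :: "(nat \<Rightarrow> nat \<Rightarrow> 'f) \<times> (nat \<Rightarrow> nat \<Rightarrow> 'f)"
  define ty where "ty p = pair_type e e' (fst p) (snd p)" for p :: "(nat \<Rightarrow> nat \<Rightarrow> 'f) \<times> (nat \<Rightarrow> nat \<Rightarrow> 'f)"
  define N where "N p p' = card {x\<in>?G. act x p = p'}" for p p'
  have finP: "finite P" unfolding P_def by (intro finite_cartesian_product VI_hom_finite)
  have finN: "finite {x\<in>?G. Q x}" for Q by (rule finite_subset[OF _ VI_hom_finite]) auto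
  have types: "pair_types e e' n = ty ` P" unfolding pair_types_def P_def ty_def by force
  have tw_P: "tw p \<in> P" if "p \<in> P" for p
    using that g VI_comp_in unfolding P_def tw_def by auto
  have ty_tw: "ty (tw p) = twist e e' g g' (ty p)" for p
    unfolding ty_def tw_def by (simp add: pair_type_twist[OF g])
  have act_P: "act x p \<in> P" if "p \<in> P" "x \<in> ?G" for p x
    using that VI_comp_in unfolding P_def act_def by auto
  have ty_act: "ty (act x p) = ty p" if "p \<in> P" "x \<in> ?G" for p x
    using that(1) pair_type_comp[OF that(2), of "fst p" e "snd p" e'] unfolding ty_def act_def P_def by auto
  have trans: "\<exists>x\<in>?G. act x p = p'" if "p \<in> P" "p' \<in> P" "ty p = ty p'" for p p'
  proof -
    have "\<exists>x\<in>?G. VI_comp n x (fst p) = fst p' \<and> VI_comp n x (snd p) = snd p'"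
      by (rule pair_transitive) (use that in \<open>auto simp: P_def ty_def\<close>)
    then show ?thesis unfolding act_def by (metis prod.collapse)
  qed
  have N_le: "N p p1 \<le> N p p2" if p: "p \<in> P" "p1 \<in> P" "p2 \<in> P" "ty p1 = ty p2" for p p1 p2
  proof -
    obtain k where k: "k \<in> ?G" "act k p1 = p2" using trans[OF p(2-4)] by blast
    have "inj_on (VI_comp n k) {x\<in>?G. act x p = p1}"
      by (rule inj_on_inverseI[where g = "VI_comp n (ginv n k)"]) (use ginv_cancel(1)[OF k(1)] in auto)
    moreover have "VI_comp n k ` {x\<in>?G. act x p = p1} \<subseteq> {x\<in>?G. act x p = p2}"
      using k VI_comp_in[OF _ k(1)] by (auto simp: act_def simp flip: VI_comp_assoc)
    ultimately have "card {x\<in>?G. act x p = p1} \<le> card {x\<in>?G. act x p = p2}"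
      by (rule card_inj_on_le[OF _ _ finN])
    then show ?thesis unfolding N_def .
  qed
  define PK where "PK K = {p\<in>P. ty p = K}" for K
  have finPK: "finite (PK K)" for K unfolding PK_def using finP by simp
  have N_total: "card (PK K) * N p p' = card ?G" if p: "p \<in> PK K" "p' \<in> PK K" for K p p'
  proof -
    have "?G = (\<Union>p1\<in>PK K. {x\<in>?G. act x p = p1})"
      using p act_P[of p] ty_act[of p] unfolding PK_def by auto
    then have "card ?G = card (\<Union>p1\<in>PK K. {x\<in>?G. act x p = p1})" by simp
    also have "\<dots> = (\<Sum>p1\<in>PK K. N p p1)"
      unfolding N_def by (rule card_UN_disjoint) (use finPK finN in auto)
    also have "\<dots> = (\<Sum>p1\<in>PK K. N p p')"
    proof (rule sum.cong[OF refl])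
      fix p1 assume "p1 \<in> PK K"
      then show "N p p1 = N p p'"
        using p N_le[of p p1 p'] N_le[of p p' p1] unfolding PK_def by simp
    qed
    finally show ?thesis by simp
  qed
  have "(\<Sum>x\<in>?G. theta e g n x * theta e' g' n x) = (\<Sum>x\<in>?G. 1 * of_nat (card {p\<in>P. act x p = tw p}))"
  proof (rule sum.cong[OF refl])
    fix x :: "nat \<Rightarrow> nat \<Rightarrow> 'f"
    have "{p\<in>P. act x p = tw p} = {f \<in> VI_hom e n. VI_comp n x f = VI_comp e f g}
        \<times> {f \<in> VI_hom e' n. VI_comp n x f = VI_comp e' f g'}"
      unfolding P_def act_def tw_def by auto
    then show "theta e g n x * theta e' g' n x = 1 * of_nat (card {p\<in>P. act x p = tw p})"
      by (simp add: theta_def card_cartesian_product)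
  qed
  also have "\<dots> = (\<Sum>p\<in>P. N p (tw p))"
    unfolding N_def by (subst sum_times_card[OF VI_hom_finite finP]) simp
  also have "\<dots> = (\<Sum>K\<in>ty ` P. \<Sum>p\<in>PK K. N p (tw p))"
    unfolding PK_def by (rule sum.image_gen[OF finP])
  also have "\<dots> = (\<Sum>K\<in>ty ` P. if twist e e' g g' K = K then card ?G else 0)"
  proof (rule sum.cong[OF refl])
    fix K assume "K \<in> ty ` P"
    then have ne: "card (PK K) \<noteq> 0" using finPK unfolding PK_def by auto
    show "(\<Sum>p\<in>PK K. N p (tw p)) = (if twist e e' g g' K = K then card ?G else 0)"
    proof (cases "twist e e' g g' K = K")
      case True
      have "tw p \<in> PK K" if "p \<in> PK K" for p
        using that tw_P[of p] ty_tw[of p] True unfolding PK_def by simp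
      \<comment> \<open>\<open>N_total\<close> is a product formula, so the sum is multiplied by the
        size of the class and the factor is cancelled afterwards.\<close>
      then have "card (PK K) * (\<Sum>p\<in>PK K. N p (tw p)) = card (PK K) * card ?G"
        unfolding sum_distrib_left using N_total by (simp cong: sum.cong)
      then show ?thesis using ne True by simp
    next
      case False
      have "N p (tw p) = 0" if "p \<in> PK K" for p
      proof -
        have "{x\<in>?G. act x p = tw p} = {}"
          using ty_act[of p] ty_tw[of p] that False unfolding PK_def by force
        then show ?thesis unfolding N_def by (simp only: card.empty)
      qed
      then show ?thesis using False by simp
    qed
  qed
  also have "\<dots> = card {K \<in> ty ` P. twist e e' g g' K = K} * card ?G"
    using finP by (simp add: sum.If_cases Int_def)
  finally show ?thesis unfolding types .
qed

section \<open>Traces on finite-dimensional subspaces\<close>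

text \<open>Finiteness is required of single subspaces, since the ambient type has to house all V_n
  together.\<close>

definition fin_subspace :: "('k::field \<Rightarrow> 'v::ab_group_add \<Rightarrow> 'v) \<Rightarrow> 'v set \<Rightarrow> bool" where
  "fin_subspace scale W \<longleftrightarrow> module.subspace scale W \<and> (\<exists>B. finite B \<and> W \<subseteq> module.span scale B)"

locale traced_space = vector_space scale
  for scale :: "'k::field \<Rightarrow> 'v::ab_group_add \<Rightarrow> 'v" (infixr "*s" 75)
begin

definition basis_of :: "'v set \<Rightarrow> 'v set" where
  "basis_of W = (SOME B. finite B \<and> independent B \<and> span B = W)"

definition trace_on :: "'v set \<Rightarrow> ('v \<Rightarrow> 'v) \<Rightarrow> 'k" where
  "trace_on W T = (\<Sum>b\<in>basis_of W. representation (basis_of W) (T b) b)"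

text \<open>Choosing the basis inside a given spanning set \<open>G\<close> matters later, where
  each basis vector of V_n must be the image of a generator.\<close>

lemma fin_subspace_basis:
  assumes "fin_subspace scale W" "W \<subseteq> span G" "G \<subseteq> W"
  shows "\<exists>B\<subseteq>G. finite B \<and> independent B \<and> span B = W"
proof -
  obtain C where C: "finite C" "W \<subseteq> span C" and W: "subspace W"
    using assms(1) unfolding fin_subspace_def by blast
  obtain B where B: "B \<subseteq> G" "independent B" "G \<subseteq> span B" by (rule maximal_independent_subset)
  have "finite B" using independent_span_bound[OF C(1) B(2)] B(1) assms(3) C(2) by blast
  moreover have "span B = W"
  proof
    show "span B \<subseteq> W" using B(1) assms(3) W by (intro span_minimal) auto
    show "W \<subseteq> span B" using assms(2) span_minimal[OF B(3) subspace_span] by blast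
  qed
  ultimately show ?thesis using B by blast
qed

lemma fin_subspace_basis':
  assumes "fin_subspace scale W"
  shows "\<exists>B. finite B \<and> independent B \<and> span B = W"
  using fin_subspace_basis[OF assms span_superset order_refl] by blast

lemma basis_of:
  assumes "fin_subspace scale W"
  shows "finite (basis_of W)" "independent (basis_of W)" "span (basis_of W) = W"
proof -
  have "finite (basis_of W) \<and> independent (basis_of W) \<and> span (basis_of W) = W"
    unfolding basis_of_def by (rule someI_ex) (rule fin_subspace_basis'[OF assms])
  then show "finite (basis_of W)" "independent (basis_of W)" "span (basis_of W) = W" by auto
qed

text \<open>Each diagonal entry of a composite expands over the other basis, and the two double sums
  agree after exchange. Allowing two different spaces yields basis independence, restriction to an
  image and transport along an isomorphism.\<close>

lemma trace_cyc_basis: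
  assumes B: "finite B" "independent B" and B': "finite B'" "independent B'"
    and S: "Vector_Spaces.linear scale scale S" and T: "Vector_Spaces.linear scale scale T"
    and SW: "S ` span B \<subseteq> span B'" and TW: "T ` span B' \<subseteq> span B"
  shows "(\<Sum>b\<in>B. representation B (T (S b)) b) = (\<Sum>b\<in>B'. representation B' (S (T b)) b)"
proof -
  have expand: "representation C (V (U c)) c = (\<Sum>c'\<in>C'. representation C' (U c) c' * representation C (V c') c)"
    if C: "finite C" "independent C" "finite C'" "independent C'"
      and V: "Vector_Spaces.linear scale scale V" and U: "U ` span C \<subseteq> span C'" and VC: "V ` span C' \<subseteq> span C"
      and c: "c \<in> C" for C C' U V c
  proof -
    interpret V: Vector_Spaces.linear scale scale V by (rule V)
    have Vc: "V c' \<in> span C" if "c' \<in> C'" for c' using VC span_base[OF that] by blast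
    have "U c \<in> span C'" using U c span_base by blast
    then have "U c = (\<Sum>c'\<in>C'. representation C' (U c) c' *s c')"
      using sum_representation_eq[OF C(4) _ C(3) order_refl] by simp
    then have "V (U c) = V (\<Sum>c'\<in>C'. representation C' (U c) c' *s c')" by simp
    also have "\<dots> = (\<Sum>c'\<in>C'. representation C' (U c) c' *s V c')"
      by (simp add: V.sum V.scale)
    finally have "representation C (V (U c)) c
        = representation C (\<Sum>c'\<in>C'. representation C' (U c) c' *s V c') c" by simp
    also have "\<dots> = (\<Sum>c'\<in>C'. representation C (representation C' (U c) c' *s V c') c)"
      by (subst representation_sum[OF C(2)]) (use Vc span_scale in auto)
    also have "\<dots> = (\<Sum>c'\<in>C'. representation C' (U c) c' * representation C (V c') c)"
      by (intro sum.cong refl, subst representation_scale[OF C(2)]) (use Vc in auto)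
    finally show ?thesis .
  qed
  have "(\<Sum>b\<in>B. representation B (T (S b)) b)
      = (\<Sum>b\<in>B. \<Sum>b'\<in>B'. representation B' (S b) b' * representation B (T b') b)"
    by (intro sum.cong refl expand B B' T SW TW)
  also have "\<dots> = (\<Sum>b'\<in>B'. \<Sum>b\<in>B. representation B (T b') b * representation B' (S b) b')"
    by (subst sum.swap) (simp add: mult.commute)
  also have "\<dots> = (\<Sum>b\<in>B'. representation B' (S (T b)) b)"
    by (intro sum.cong refl expand[symmetric] B B' S SW TW)
  finally show ?thesis .
qed

text \<open>Cyclicity with the identity as one factor, between the chosen basis and
  \<open>B\<close>.\<close>

lemma trace_on_basis:
  assumes B: "finite B" "independent B"
    and T: "Vector_Spaces.linear scale scale T" "T ` span B \<subseteq> span B"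
  shows "trace_on (span B) T = (\<Sum>b\<in>B. representation B (T b) b)"
proof -
  have "subspace (span B)" by (rule subspace_span)
  then have "fin_subspace scale (span B)" unfolding fin_subspace_def using B(1) by blast
  note C = basis_of[OF this]
  have "trace_on (span B) T = (\<Sum>b\<in>B. representation B (T b) b)"
    using trace_cyc_basis[OF C(1,2) B linear_id[unfolded id_def] T(1)] T(2) C(3) by (simp add: trace_on_def)
  then show ?thesis .
qed

lemma trace_on_cyc:
  assumes W: "fin_subspace scale W" and W': "fin_subspace scale W'"
    and S: "Vector_Spaces.linear scale scale S" and T: "Vector_Spaces.linear scale scale T"
    and SW: "S ` W \<subseteq> W'" and TW: "T ` W' \<subseteq> W"
  shows "trace_on W (\<lambda>v. T (S v)) = trace_on W' (\<lambda>v. S (T v))"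
proof -
  obtain B where B: "finite B" "independent B" "span B = W" using fin_subspace_basis'[OF W] by blast
  obtain B' where B': "finite B'" "independent B'" "span B' = W'" using fin_subspace_basis'[OF W'] by blast
  have TS: "Vector_Spaces.linear scale scale (\<lambda>v. T (S v))"
    using Vector_Spaces.linear_compose[OF S T] by (simp add: o_def)
  have ST: "Vector_Spaces.linear scale scale (\<lambda>v. S (T v))"
    using Vector_Spaces.linear_compose[OF T S] by (simp add: o_def)
  have "trace_on (span B) (\<lambda>v. T (S v)) = trace_on (span B') (\<lambda>v. S (T v))"
    using trace_on_basis[OF B(1,2) TS] trace_on_basis[OF B'(1,2) ST]
      trace_cyc_basis[OF B(1,2) B'(1,2) S T] SW TW unfolding B(3) B'(3) by fastforce
  then show ?thesis unfolding B(3) B'(3) .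
qed

lemma trace_on_cong:
  assumes "fin_subspace scale W" "\<And>v. v \<in> W \<Longrightarrow> S v = T v"
  shows "trace_on W S = trace_on W T"
  unfolding trace_on_def
proof (rule sum.cong[OF refl])
  fix b assume "b \<in> basis_of W"
  then have "b \<in> W" using basis_of(3)[OF assms(1)] span_base by blast
  then show "representation (basis_of W) (S b) b = representation (basis_of W) (T b) b"
    by (simp add: assms(2))
qed

lemma trace_on_sum:
  assumes W: "fin_subspace scale W" and T: "\<And>x v. x \<in> X \<Longrightarrow> v \<in> W \<Longrightarrow> T x v \<in> W"
  shows "trace_on W (\<lambda>v. c *s (\<Sum>x\<in>X. T x v)) = c * (\<Sum>x\<in>X. trace_on W (T x))"
proof -
  define B where "B = basis_of W"
  note B = basis_of[OF W, folded B_def]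
  have in_span: "T x b \<in> span B" if "x \<in> X" "b \<in> B" for x b
    using T that span_base B(3) by blast
  have "representation B (c *s (\<Sum>x\<in>X. T x b)) b = c * (\<Sum>x\<in>X. representation B (T x b) b)" if b: "b \<in> B" for b
  proof -
    have "representation B (c *s (\<Sum>x\<in>X. T x b)) b = c * representation B (\<Sum>x\<in>X. T x b) b"
      by (subst representation_scale[OF B(2)]) (auto intro: span_sum in_span[OF _ b])
    also have "\<dots> = c * (\<Sum>x\<in>X. representation B (T x b) b)"
      by (subst representation_sum[OF B(2)]) (use in_span b in auto)
    finally show ?thesis .
  qed
  then have "trace_on W (\<lambda>v. c *s (\<Sum>x\<in>X. T x v)) = (\<Sum>b\<in>B. c * (\<Sum>x\<in>X. representation B (T x b) b))"
    unfolding trace_on_def B_def[symmetric] by (intro sum.cong refl)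
  also have "\<dots> = c * (\<Sum>x\<in>X. trace_on W (T x))"
    unfolding trace_on_def B_def[symmetric] sum_distrib_left[symmetric] by (subst sum.swap) (rule refl)
  finally show ?thesis .
qed

lemma trace_on_id:
  assumes W: "fin_subspace scale W"
  shows "trace_on W (\<lambda>v. v) = of_nat (dim W)"
proof -
  define B where "B = basis_of W"
  note B = basis_of[OF W, folded B_def]
  have "trace_on W (\<lambda>v. v) = (\<Sum>b\<in>B. 1)"
    unfolding trace_on_def B_def[symmetric] by (intro sum.cong refl) (simp add: representation_basis[OF B(2)])
  then show ?thesis using dim_span_eq_card_independent[OF B(2)] B(3) by simp
qed

text \<open>By equality of dimensions a basis of \<open>W\<close> maps injectively onto a basis of
  \<open>W'\<close>; its inverse there extends to a total linear map.\<close>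

lemma linear_surj_iso:
  assumes W: "fin_subspace scale W" and s: "Vector_Spaces.linear scale scale s"
    and im: "s ` W = W'" and dim: "dim W' = dim W"
  shows "\<exists>t. Vector_Spaces.linear scale scale t \<and> (\<forall>v\<in>W. t (s v) = v)"
proof -
  interpret s: Vector_Spaces.linear scale scale s by (rule s)
  interpret vector_space_pair scale scale ..
  obtain B where B: "finite B" "independent B" "span B = W" using fin_subspace_basis'[OF W] by blast
  have cB: "card B = dim W" using dim_span_eq_card_independent[OF B(2)] B(3) by simp
  have sp: "span (s ` B) = W'" using s.span_image B(3) im by simp
  obtain B' where B': "B' \<subseteq> s ` B" "independent B'" "s ` B \<subseteq> span B'" by (rule maximal_independent_subset)
  have "span B' = W'"
    using span_mono[OF B'(1)] span_minimal[OF B'(3) subspace_span] sp by auto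
  then have cB': "card B' = card B" using dim_span_eq_card_independent[OF B'(2)] dim cB by simp
  have "card B' \<le> card (s ` B)" "card (s ` B) \<le> card B"
    using card_mono[OF _ B'(1)] B(1) card_image_le by auto
  then have eq: "B' = s ` B" and inj: "inj_on s B"
    using cB' card_subset_eq[OF _ B'(1)] B(1) eq_card_imp_inj_on[OF B(1)] by auto
  obtain t where t: "Vector_Spaces.linear scale scale t" "\<forall>x\<in>s ` B. t x = inv_into B s x"
    using linear_independent_extend[OF B'(2)[unfolded eq], of "inv_into B s"] by blast
  interpret t: Vector_Spaces.linear scale scale t by (rule t(1))
  have "subspace {v. t (s v) = v}"
    by (rule subspaceI) (simp_all add: s.zero t.zero s.add t.add s.scale t.scale)
  moreover have "B \<subseteq> {v. t (s v) = v}" using t(2) inj by auto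
  ultimately have "W \<subseteq> {v. t (s v) = v}" using span_minimal B(3) by metis
  then show ?thesis using t(1) by blast
qed

text \<open>Turns an action that is linear only on a subspace into a total linear map, by extending
  its values on a basis.\<close>

lemma linear_extend_subspace:
  assumes W: "subspace W" and add: "\<And>x y. x \<in> W \<Longrightarrow> y \<in> W \<Longrightarrow> f (x + y) = f x + f y"
    and sc: "\<And>c x. x \<in> W \<Longrightarrow> f (c *s x) = c *s f x"
  shows "\<exists>t. Vector_Spaces.linear scale scale t \<and> (\<forall>v\<in>W. t v = f v)"
proof -
  interpret vector_space_pair scale scale ..
  obtain B where B: "B \<subseteq> W" "independent B" "W \<subseteq> span B" by (rule maximal_independent_subset)
  obtain t where t: "Vector_Spaces.linear scale scale t" "\<forall>x\<in>B. t x = f x"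
    using linear_independent_extend[OF B(2), of f] by blast
  interpret t: Vector_Spaces.linear scale scale t by (rule t(1))
  have W0: "0 \<in> W" using W subspace_0 by blast
  have "f 0 = 0" using sc[OF W0, of 0] by simp
  then have "subspace {v\<in>W. t v = f v}"
    using W by (intro subspaceI) (auto simp: t.zero t.add t.scale add sc subspace_0 subspace_add subspace_scale)
  moreover have "B \<subseteq> {v\<in>W. t v = f v}" using t(2) B(1) by blast
  ultimately have "span B \<subseteq> {v\<in>W. t v = f v}" by (intro span_minimal)
  then show ?thesis using t(1) B(3) by blast
qed

end

section \<open>Stability of averaged characters\<close>

text \<open>The action is given by total linear maps, so that composites and inverses need no restriction to \<open>V n\<close>;
  functoriality is required on the spaces \<open>V n\<close> only.\<close>
locale linear_VI_module = traced_space scale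
  for scale :: "'k::field_char_0 \<Rightarrow> 'v::ab_group_add \<Rightarrow> 'v" (infixr "*s" 75) +
  fixes V :: "nat \<Rightarrow> 'v set"
    and \<rho> :: "nat \<Rightarrow> nat \<Rightarrow> (nat \<Rightarrow> nat \<Rightarrow> 'f::{finite,field}) \<Rightarrow> 'v \<Rightarrow> 'v"
    and S :: "(nat \<times> 'v) set" and d :: nat
  assumes subspace_V: "subspace (V n)"
    and linear_\<rho>: "A \<in> VI_hom m n \<Longrightarrow> Vector_Spaces.linear scale scale (\<rho> m n A)"
    and \<rho>_in: "A \<in> VI_hom m n \<Longrightarrow> v \<in> V m \<Longrightarrow> \<rho> m n A v \<in> V n"
    and \<rho>_id: "v \<in> V m \<Longrightarrow> \<rho> m m (VI_id m) v = v"
    and \<rho>_comp: "A \<in> VI_hom m n \<Longrightarrow> B \<in> VI_hom n p \<Longrightarrow> v \<in> V m \<Longrightarrow>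
      \<rho> m p (VI_comp n B A) v = \<rho> n p B (\<rho> m n A v)"
    and finite_S: "finite S"
    and S_in: "(m, s) \<in> S \<Longrightarrow> s \<in> V m"
    and S_bound: "(m, s) \<in> S \<Longrightarrow> m \<le> d"
    and generated: "V n \<subseteq> span {\<rho> m n f s | m s f. (m, s) \<in> S \<and> f \<in> VI_hom m n}"
begin

definition gens :: "nat \<Rightarrow> 'v set" where
  "gens n = {\<rho> m n f s | m s f. (m, s) \<in> S \<and> f \<in> VI_hom m n}"

lemma gens_in: "gens n \<subseteq> V n"
  unfolding gens_def using \<rho>_in S_in by auto

lemma finite_gens: "finite (gens n)"
proof -
  have "gens n \<subseteq> (\<Union>(m, s)\<in>S. (\<lambda>f. \<rho> m n f s) ` VI_hom m n)" unfolding gens_def by auto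
  moreover have "finite (\<Union>(m, s)\<in>S. (\<lambda>f. \<rho> m n f s) ` VI_hom m n)"
    using finite_S by (intro finite_UN_I) (auto intro: finite_imageI VI_hom_finite)
  ultimately show ?thesis by (rule finite_subset)
qed

lemma fin_V: "fin_subspace scale (V n)"
  unfolding fin_subspace_def using subspace_V finite_gens generated[of n, folded gens_def] by blast

definition \<chi> :: "nat \<Rightarrow> (nat \<Rightarrow> nat \<Rightarrow> 'f) \<Rightarrow> 'k" where
  "\<chi> n x = trace_on (V n) (\<rho> n n x)"

lemma class_fun_\<chi>: "class_fun n (\<chi> n)"
  unfolding class_fun_def
proof (intro ballI)
  fix x y :: "nat \<Rightarrow> nat \<Rightarrow> 'f" assume x: "x \<in> VI_hom n n" and y: "y \<in> VI_hom n n"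
  have "\<chi> n (VI_comp n x y) = trace_on (V n) (\<lambda>v. \<rho> n n x (\<rho> n n y v))"
    unfolding \<chi>_def by (rule trace_on_cong[OF fin_V \<rho>_comp[OF y x]])
  also have "\<dots> = trace_on (V n) (\<lambda>v. \<rho> n n y (\<rho> n n x v))"
    by (rule trace_on_cyc[OF fin_V fin_V linear_\<rho>[OF y] linear_\<rho>[OF x]]) (use \<rho>_in x y in auto)
  also have "\<dots> = \<chi> n (VI_comp n y x)"
    unfolding \<chi>_def by (rule trace_on_cong[OF fin_V \<rho>_comp[OF x y, symmetric]])
  finally show "\<chi> n (VI_comp n x y) = \<chi> n (VI_comp n y x)" .
qed

lemma \<chi>_id: "\<chi> n (VI_id n) = of_nat (dim (V n))"
  unfolding \<chi>_def trace_on_id[OF fin_V, symmetric] by (rule trace_on_cong[OF fin_V \<rho>_id])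

text \<open>With a basis of V_n taken from \<open>gens n\<close>, each basis vector is \<rho> f s
  for an injection \<open>f\<close> from F_q^m with m at most \<open>d\<close>. The matrix
  coefficient of \<open>x\<close> there depends only on \<open>x f\<close>, so the sum breaks up
  over cosets of the pointwise stabilizer of the image of \<open>f\<close>.\<close>

lemma sum_class_fun_\<chi>:
  assumes cl: "class_fun n \<psi>"
    and zero: "\<And>e g. e \<le> d \<Longrightarrow> e \<le> n \<Longrightarrow> g \<in> VI_hom e e \<Longrightarrow> sum \<psi> (carry n (VI_id e) g) = 0"
  shows "(\<Sum>x\<in>VI_hom n n. \<psi> x * \<chi> n x) = 0"
proof -
  obtain B where B: "B \<subseteq> gens n" "finite B" "independent B" "span B = V n"
    using fin_subspace_basis[OF fin_V generated[of n, folded gens_def] gens_in] by blast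
  have \<chi>: "\<chi> n x = (\<Sum>b\<in>B. representation B (\<rho> n n x b) b)" if x: "x \<in> VI_hom n n" for x
    unfolding \<chi>_def B(4)[symmetric] using \<rho>_in[OF x] B(4)
    by (intro trace_on_basis[OF B(2,3) linear_\<rho>[OF x]]) auto
  have "(\<Sum>x\<in>VI_hom n n. \<psi> x * \<chi> n x)
      = (\<Sum>x\<in>VI_hom n n. \<Sum>b\<in>B. \<psi> x * representation B (\<rho> n n x b) b)"
    by (intro sum.cong refl) (simp add: \<chi> sum_distrib_left)
  also have "\<dots> = (\<Sum>b\<in>B. \<Sum>x\<in>VI_hom n n. \<psi> x * representation B (\<rho> n n x b) b)"
    by (rule sum.swap)
  also have "\<dots> = 0"
  proof (rule sum.neutral, rule ballI)
    fix b assume "b \<in> B"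
    then obtain m s f where b: "b = \<rho> m n f s" "(m, s) \<in> S" "f \<in> VI_hom m n"
      using B(1) unfolding gens_def by blast
    define F where "F f' = representation B (\<rho> m n f' s) b" for f'
    let ?D = "mat_apply m f ` fvec m"
    have D: "vsub ?D" "?D \<subseteq> fvec n" "card ?D \<le> card (UNIV :: 'f set) ^ d"
    proof -
      \<comment> \<open>Adding the zero space presents a single image as a sum of two, so that
        \<open>vsub_sum_space\<close> applies.\<close>
      have "?D = sum_space m 0 f (VI_id 0)"
        unfolding sum_space_def fvec_0 by auto
      then show "vsub ?D" by (simp add: vsub_sum_space)
      show "?D \<subseteq> fvec n" using VI_hom_apply_in[OF b(3)] by blast
      have "card ?D \<le> card (UNIV :: 'f set) ^ m"
        using card_image_le[OF card_fvec(1)] card_fvec(2) by metis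
      also have "\<dots> \<le> card (UNIV :: 'f set) ^ d"
        using S_bound[OF b(2)] card_field_gt_1[where 'f='f] by (intro power_increasing) auto
      finally show "card ?D \<le> card (UNIV :: 'f set) ^ d" .
    qed
    have coset: "sum \<psi> {x \<in> VI_hom n n. VI_comp n x f = VI_comp n x0 f} = 0" if x0: "x0 \<in> VI_hom n n" for x0
    proof -
      have "{x \<in> VI_hom n n. VI_comp n x f = VI_comp n x0 f} = agree n ?D x0"
        unfolding agree_def using VI_comp_eq_iff_apply[OF b(3) _ VI_comp_in[OF b(3) x0]] by (auto simp: mat_apply_comp)
      then show ?thesis using coset_sum_zero[OF cl zero D x0] by simp
    qed
    have "(\<Sum>x\<in>VI_hom n n. \<psi> x * representation B (\<rho> n n x b) b)
        = (\<Sum>x\<in>VI_hom n n. \<psi> x * F (VI_comp n x f))"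
      unfolding F_def by (intro sum.cong refl) (simp add: b(1) \<rho>_comp[OF b(3) _ S_in[OF b(2)]])
    also have "\<dots> = (\<Sum>f'\<in>(\<lambda>x. VI_comp n x f) ` VI_hom n n.
        \<Sum>x\<in>{x \<in> VI_hom n n. VI_comp n x f = f'}. \<psi> x * F (VI_comp n x f))"
      by (rule sum.image_gen[OF VI_hom_finite])
    also have "\<dots> = (\<Sum>f'\<in>(\<lambda>x. VI_comp n x f) ` VI_hom n n.
        sum \<psi> {x \<in> VI_hom n n. VI_comp n x f = f'} * F f')"
      by (intro sum.cong refl) (auto simp: sum_distrib_right intro: sum.cong)
    also have "\<dots> = 0" using coset by (intro sum.neutral) auto
    finally show "(\<Sum>x\<in>VI_hom n n. \<psi> x * representation B (\<rho> n n x b) b) = 0" .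
  qed
  finally show ?thesis .
qed

section \<open>Coset averages and invariants of the pointwise stabilizer of F_q^e\<close>

text \<open>For \<open>g = VI_id e\<close> this is the projection of V_n onto the invariants
  \<open>inv_space e n\<close>; for general \<open>g\<close> it gives the action of \<open>g\<close>
  on them.\<close>

definition avg :: "nat \<Rightarrow> (nat \<Rightarrow> nat \<Rightarrow> 'f) \<Rightarrow> nat \<Rightarrow> 'v \<Rightarrow> 'v" where
  "avg e g n v = (1 / of_nat (card (carry n (VI_id e) g))) *s (\<Sum>x\<in>carry n (VI_id e) g. \<rho> n n x v)"

text \<open>The product of \<open>theta e g n\<close> with \<chi>, divided by the order of GL_n, as
  \<open>sum_\<Theta>_\<chi>\<close> shows for e at most n.\<close>

definition \<phi> :: "nat \<Rightarrow> (nat \<Rightarrow> nat \<Rightarrow> 'f) \<Rightarrow> nat \<Rightarrow> 'k" where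
  "\<phi> e g n = (1 / of_nat (card (carry n (VI_id e) g))) * sum (\<chi> n) (carry n (VI_id e) g)"

definition inv_space :: "nat \<Rightarrow> nat \<Rightarrow> 'v set" where
  "inv_space e n = {v \<in> V n. \<forall>h\<in>carry n (VI_id e) (VI_id e). \<rho> n n h v = v}"

lemma carry_in: "x \<in> carry n f f' \<Longrightarrow> x \<in> VI_hom n n"
  unfolding carry_def by simp

lemma card_carry_id:
  fixes g :: "nat \<Rightarrow> nat \<Rightarrow> 'f"
  assumes "e \<le> n" "g \<in> VI_hom e e"
  shows "card (carry n (VI_id e) g) = card (carry n (VI_id e) (VI_id e :: nat \<Rightarrow> nat \<Rightarrow> 'f))"
    "card (carry n (VI_id e) g) \<noteq> 0"
proof -
  have idn: "(VI_id e :: nat \<Rightarrow> nat \<Rightarrow> 'f) \<in> VI_hom e n" by (rule VI_id_in[OF assms(1)])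
  have g: "g \<in> VI_hom e n" using VI_hom_mono[OF assms(1)] assms(2) by blast
  have "VI_id n \<in> (VI_hom n n :: (nat \<Rightarrow> nat \<Rightarrow> 'f) set)" by (rule VI_id_in) simp
  then have pos: "card (VI_hom n n :: (nat \<Rightarrow> nat \<Rightarrow> 'f) set) \<noteq> 0" using VI_hom_finite by (auto simp: card_eq_0_iff)
  then show "card (carry n (VI_id e) g) \<noteq> 0"
    using card_carry[OF idn g] by (intro notI) simp
  show "card (carry n (VI_id e) g) = card (carry n (VI_id e) (VI_id e :: nat \<Rightarrow> nat \<Rightarrow> 'f))"
  proof -
    let ?c = "card (VI_hom e n :: (nat \<Rightarrow> nat \<Rightarrow> 'f) set)"
    have "?c * card (carry n (VI_id e) g) = ?c * card (carry n (VI_id e) (VI_id e :: nat \<Rightarrow> nat \<Rightarrow> 'f))"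
      using card_carry[OF idn g] card_carry[OF idn idn] by simp
    moreover have "?c \<noteq> 0" using card_carry[OF idn g] pos by (intro notI) simp
    ultimately show ?thesis by simp
  qed
qed

lemma carry_comp:
  assumes "e \<le> n" "x \<in> carry n (VI_id e) g" "y \<in> carry n (VI_id e) g'" "g' \<in> VI_hom e e"
  shows "VI_comp n x y \<in> carry n (VI_id e) (VI_comp e g g')"
proof -
  have "VI_comp n (VI_comp n x y) (VI_id e) = VI_comp n x (VI_comp e (VI_id e) g')"
    using assms(3) unfolding carry_def VI_comp_assoc[symmetric] VI_comp_id_left[OF assms(4)] by simp
  also have "\<dots> = VI_comp e g g'" using assms(2) unfolding VI_comp_assoc carry_def by simp
  finally show ?thesis using assms(2,3) VI_comp_in unfolding carry_def by auto
qed

lemma linear_avg: "Vector_Spaces.linear scale scale (avg e g n)"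
proof -
  interpret vector_space_pair scale scale ..
  have "Vector_Spaces.linear scale scale (\<lambda>v. \<Sum>x\<in>carry n (VI_id e) g. \<rho> n n x v)"
    by (intro linear_compose_sum ballI linear_\<rho> carry_in)
  from linear_compose_scale_right[OF this] show ?thesis unfolding avg_def[abs_def] .
qed

lemma avg_in: "v \<in> V n \<Longrightarrow> avg e g n v \<in> V n"
  unfolding avg_def using subspace_V \<rho>_in[OF carry_in]
  by (intro subspace_scale subspace_sum) auto

text \<open>Right multiplication by \<open>y\<close> is a bijection from the coset of
  \<open>g\<close> onto that of the product.\<close>

lemma avg_right:
  assumes e: "e \<le> n" and g: "g \<in> VI_hom e e" and y: "y \<in> carry n (VI_id e) g'" and g': "g' \<in> VI_hom e e"
    and v: "v \<in> V n"
  shows "avg e g n (\<rho> n n y v) = avg e (VI_comp e g g') n v"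
proof -
  let ?X = "carry n (VI_id e) g" and ?Y = "carry n (VI_id e) (VI_comp e g g')"
  have gg: "VI_comp e g g' \<in> VI_hom e e" by (rule VI_comp_in[OF g' g])
  have card: "card ?X = card ?Y" using card_carry_id(1)[OF e g] card_carry_id(1)[OF e gg] by simp
  have inj: "inj_on (\<lambda>x. VI_comp n x y) ?X"
  proof (rule inj_on_inverseI[where g = "\<lambda>z. VI_comp n z (ginv n y)"])
    fix x assume "x \<in> ?X"
    then show "VI_comp n (VI_comp n x y) (ginv n y) = x"
      unfolding VI_comp_assoc[symmetric] ginv(3)[OF carry_in[OF y]]
      by (intro VI_comp_id_right[where n = n] carry_in)
  qed
  have "(\<lambda>x. VI_comp n x y) ` ?X \<subseteq> ?Y" using carry_comp[OF e _ y g'] by auto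
  then have im: "(\<lambda>x. VI_comp n x y) ` ?X = ?Y"
    using card card_image[OF inj] by (intro card_subset_eq carry_finite) auto
  have "(\<Sum>x\<in>?X. \<rho> n n x (\<rho> n n y v)) = (\<Sum>x\<in>?X. \<rho> n n (VI_comp n x y) v)"
    by (intro sum.cong refl \<rho>_comp[symmetric] carry_in[OF y] carry_in v)
  also have "\<dots> = (\<Sum>z\<in>?Y. \<rho> n n z v)"
    unfolding im[symmetric] by (rule sum.reindex_cong[OF inj, symmetric]) auto
  finally show ?thesis unfolding avg_def card by simp
qed

lemma avg_left:
  assumes e: "e \<le> n" and g: "g \<in> VI_hom e e" and h: "h \<in> carry n (VI_id e) (VI_id e)" and v: "v \<in> V n"
  shows "\<rho> n n h (avg e g n v) = avg e g n v"
proof -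
  interpret h: Vector_Spaces.linear scale scale "\<rho> n n h" by (rule linear_\<rho>[OF carry_in[OF h]])
  let ?X = "carry n (VI_id e) g"
  have inj: "inj_on (VI_comp n h) ?X"
    by (rule inj_on_inverseI[where g = "VI_comp n (ginv n h)"], rule ginv_cancel(1)[OF carry_in[OF h] carry_in])
  have "VI_comp n h ` ?X \<subseteq> ?X"
    using carry_comp[OF e h _ g] VI_comp_id_left[OF g] by auto
  then have im: "VI_comp n h ` ?X = ?X"
    using card_image[OF inj] by (intro card_subset_eq carry_finite) auto
  have "(\<Sum>x\<in>?X. \<rho> n n h (\<rho> n n x v)) = (\<Sum>x\<in>?X. \<rho> n n (VI_comp n h x) v)"
    by (intro sum.cong refl \<rho>_comp[symmetric] carry_in[OF h] carry_in v)
  also have "\<dots> = (\<Sum>z\<in>VI_comp n h ` ?X. \<rho> n n z v)"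
    by (rule sum.reindex_cong[OF inj, symmetric]) auto
  finally show ?thesis unfolding avg_def im by (simp add: h.scale h.sum)
qed

lemma avg_inv_space:
  "e \<le> n \<Longrightarrow> g \<in> VI_hom e e \<Longrightarrow> v \<in> V n \<Longrightarrow> avg e g n v \<in> inv_space e n"
  unfolding inv_space_def using avg_in avg_left by blast

lemma avg_id_inv_space:
  assumes "e \<le> n" "v \<in> inv_space e n"
  shows "avg e (VI_id e) n v = v"
proof -
  have "(\<Sum>x\<in>carry n (VI_id e) (VI_id e). \<rho> n n x v) = (\<Sum>x\<in>carry n (VI_id e) (VI_id e :: nat \<Rightarrow> nat \<Rightarrow> 'f). v)"
    using assms(2) unfolding inv_space_def by (intro sum.cong) auto
  then show ?thesis
    using card_carry_id(2)[OF assms(1) VI_id_in[OF order_refl]] unfolding avg_def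
    by (simp add: sum_constant_scale)
qed

lemma subspace_inv_space: "subspace (inv_space e n)"
proof (rule subspaceI)
  have lin: "\<rho> n n h 0 = 0" "\<rho> n n h (x + y) = \<rho> n n h x + \<rho> n n h y" "\<rho> n n h (c *s x) = c *s \<rho> n n h x"
    if "h \<in> carry n (VI_id e) (VI_id e)" for h x y c
  proof -
    interpret h: Vector_Spaces.linear scale scale "\<rho> n n h" by (rule linear_\<rho>[OF carry_in[OF that]])
    show "\<rho> n n h 0 = 0" "\<rho> n n h (x + y) = \<rho> n n h x + \<rho> n n h y" "\<rho> n n h (c *s x) = c *s \<rho> n n h x"
      by (rule h.zero h.add h.scale)+
  qed
  show "0 \<in> inv_space e n" using lin subspace_0[OF subspace_V] unfolding inv_space_def by simp
  show "x + y \<in> inv_space e n" if "x \<in> inv_space e n" "y \<in> inv_space e n" for x y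
    using that lin subspace_add[OF subspace_V] unfolding inv_space_def by simp
  show "c *s x \<in> inv_space e n" if "x \<in> inv_space e n" for c x
    using that lin subspace_scale[OF subspace_V] unfolding inv_space_def by simp
qed

lemma inv_space_sub: "inv_space e n \<subseteq> V n"
  unfolding inv_space_def by auto

lemma fin_inv_space: "fin_subspace scale (inv_space e n)"
  using fin_V[of n] subspace_inv_space[of e n] inv_space_sub[of e n] unfolding fin_subspace_def by blast

text \<open>\<open>avg e g n\<close> maps \<open>V n\<close> into \<open>inv_space e n\<close>, so only that subspace contributes to its trace.\<close>
lemma \<phi>_trace:
  assumes "e \<le> n" "g \<in> VI_hom e e"
  shows "\<phi> e g n = trace_on (inv_space e n) (avg e g n)"
proof -
  have "\<phi> e g n = trace_on (V n) (avg e g n)"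
    unfolding avg_def[abs_def] \<phi>_def \<chi>_def
    by (rule trace_on_sum[OF fin_V, symmetric]) (rule \<rho>_in[OF carry_in])
  also have "\<dots> = trace_on (inv_space e n) (avg e g n)"
    using trace_on_cyc[OF fin_V fin_inv_space linear_avg linear_id[unfolded id_def]]
      avg_inv_space[OF assms] inv_space_sub by blast
  finally show ?thesis .
qed

text \<open>Surjectivity of this map for \<open>n \<ge> e + d\<close> needs only that generators live in degree at most \<open>d\<close>;
  no noetherianity enters.\<close>
definition \<sigma> :: "nat \<Rightarrow> nat \<Rightarrow> 'v \<Rightarrow> 'v" where
  "\<sigma> e n v = avg e (VI_id e) (Suc n) (\<rho> n (Suc n) (VI_id n) v)"

lemma VI_id_Suc: "VI_id n \<in> VI_hom n (Suc n)"
  by (rule VI_id_in) simp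

lemma linear_\<sigma>: "Vector_Spaces.linear scale scale (\<sigma> e n)"
  using Vector_Spaces.linear_compose[OF linear_\<rho>[OF VI_id_Suc] linear_avg]
  unfolding \<sigma>_def[abs_def] by (simp add: o_def)

lemma \<sigma>_\<rho>:
  assumes e: "e \<le> n" and x: "x \<in> carry n (VI_id e) g" and g: "g \<in> VI_hom e e" and v: "v \<in> V n"
  shows "\<sigma> e n (\<rho> n n x v) = avg e g (Suc n) (\<rho> n (Suc n) (VI_id n) v)"
proof -
  note xn = carry_in[OF x]
  have "x \<in> VI_hom n (Suc n)" using xn VI_hom_mono[of n "Suc n" n] by auto
  \<comment> \<open>\<open>x\<close> followed by the inclusion extends to \<open>y\<close> in
    GL_(n+1), which still acts as \<open>g\<close> on F_q^e and is therefore absorbed by the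
    average.\<close>
  then obtain y where y: "y \<in> VI_hom (Suc n) (Suc n)" "VI_comp (Suc n) y (VI_id n) = x"
    using GL_transitive[OF VI_id_Suc] by blast
  have idne: "VI_comp n (VI_id n) (VI_id e) = (VI_id e :: nat \<Rightarrow> nat \<Rightarrow> 'f)"
    by (rule VI_comp_id_left[OF VI_id_in[OF e]])
  have "VI_comp (Suc n) y (VI_id e) = VI_comp n x (VI_id e)"
    using VI_comp_assoc[of "Suc n" y n "VI_id n" "VI_id e"] unfolding idne y(2) .
  then have ye: "y \<in> carry (Suc n) (VI_id e) g" using x y(1) unfolding carry_def by simp
  have "\<rho> n (Suc n) (VI_id n) (\<rho> n n x v) = \<rho> n (Suc n) x v"
    using \<rho>_comp[OF xn VI_id_Suc v] unfolding VI_comp_id_left[OF xn] by simp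
  also have "\<dots> = \<rho> (Suc n) (Suc n) y (\<rho> n (Suc n) (VI_id n) v)"
    using \<rho>_comp[OF VI_id_Suc y(1) v] unfolding y(2) .
  finally have "\<sigma> e n (\<rho> n n x v) = avg e (VI_id e) (Suc n) (\<rho> (Suc n) (Suc n) y (\<rho> n (Suc n) (VI_id n) v))"
    unfolding \<sigma>_def by simp
  also have "\<dots> = avg e (VI_comp e (VI_id e) g) (Suc n) (\<rho> n (Suc n) (VI_id n) v)"
    by (rule avg_right[OF _ VI_id_in ye g \<rho>_in[OF VI_id_Suc v]]) (use e in auto)
  finally show ?thesis unfolding VI_comp_id_left[OF g] .
qed

lemma \<sigma>_avg:
  assumes e: "e \<le> n" and g: "g \<in> VI_hom e e" and v: "v \<in> V n"
  shows "\<sigma> e n (avg e g n v) = avg e g (Suc n) (\<rho> n (Suc n) (VI_id n) v)"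
proof -
  interpret s: Vector_Spaces.linear scale scale "\<sigma> e n" by (rule linear_\<sigma>)
  have "\<sigma> e n (avg e g n v) = (1 / of_nat (card (carry n (VI_id e) g))) *s
      (\<Sum>x\<in>carry n (VI_id e) g. avg e g (Suc n) (\<rho> n (Suc n) (VI_id n) v))"
    unfolding avg_def[of e g n v] s.scale s.sum
    by (intro arg_cong2[where f = scale] sum.cong refl \<sigma>_\<rho>[OF e _ g v])
  then show ?thesis using card_carry_id(2)[OF e g] by (simp add: sum_constant_scale)
qed

text \<open>Together with \<open>\<sigma>_avg\<close> this says that \<open>\<sigma>\<close>
  commutes with the averages for \<open>g\<close> at n and n + 1.\<close>

lemma avg_\<sigma>:
  assumes e: "e \<le> n" and g: "g \<in> VI_hom e e" and v: "v \<in> V n"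
  shows "avg e g (Suc n) (\<sigma> e n v) = avg e g (Suc n) (\<rho> n (Suc n) (VI_id n) v)"
proof -
  interpret s: Vector_Spaces.linear scale scale "avg e g (Suc n)" by (rule linear_avg)
  let ?w = "\<rho> n (Suc n) (VI_id n) v" and ?X = "carry (Suc n) (VI_id e) (VI_id e :: nat \<Rightarrow> nat \<Rightarrow> 'f)"
  have e': "e \<le> Suc n" using e by simp
  have w: "?w \<in> V (Suc n)" by (rule \<rho>_in[OF VI_id_Suc v])
  have ide: "(VI_id e :: nat \<Rightarrow> nat \<Rightarrow> 'f) \<in> VI_hom e e" by (rule VI_id_in) simp
  have "avg e g (Suc n) (\<sigma> e n v) = (1 / of_nat (card ?X)) *s (\<Sum>x\<in>?X. avg e g (Suc n) (\<rho> (Suc n) (Suc n) x ?w))"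
    unfolding \<sigma>_def avg_def[of e "VI_id e"] s.scale s.sum ..
  also have "(\<Sum>x\<in>?X. avg e g (Suc n) (\<rho> (Suc n) (Suc n) x ?w)) = (\<Sum>x\<in>?X. avg e g (Suc n) ?w)"
    by (intro sum.cong refl) (simp add: avg_right[OF e' g _ ide w] VI_comp_id_right[OF g])
  finally show ?thesis using card_carry_id(2)[OF e' ide] by (simp add: sum_constant_scale)
qed

text \<open>For a generator \<rho> f s at n + 1, F_q^e and the image of \<open>f\<close> span at
  most e + d dimensions. Some \<open>h\<close> fixing F_q^e pointwise moves both into F_q^n. The
  average does not notice \<open>h\<close>, so the averaged generator comes from V_n.\<close>

lemma \<sigma>_image:
  assumes n: "e + d \<le> n"
  shows "\<sigma> e n ` inv_space e n = inv_space e (Suc n)"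
proof
  have e: "e \<le> n" "e \<le> Suc n" using n by auto
  have ide: "(VI_id e :: nat \<Rightarrow> nat \<Rightarrow> 'f) \<in> VI_hom e e" by (rule VI_id_in) simp
  show "\<sigma> e n ` inv_space e n \<subseteq> inv_space e (Suc n)"
    unfolding \<sigma>_def using avg_inv_space[OF e(2) ide] \<rho>_in[OF VI_id_Suc] inv_space_sub by blast
  interpret s: Vector_Spaces.linear scale scale "\<sigma> e n" by (rule linear_\<sigma>)
  interpret a: Vector_Spaces.linear scale scale "avg e (VI_id e) (Suc n)" by (rule linear_avg)
  have sub: "subspace (\<sigma> e n ` inv_space e n)" by (rule s.subspace_image[OF subspace_inv_space])
  have gen: "avg e (VI_id e) (Suc n) u \<in> \<sigma> e n ` inv_space e n" if u: "u \<in> gens (Suc n)" for u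
  proof -
    obtain m s f where f: "u = \<rho> m (Suc n) f s" "(m, s) \<in> S" "f \<in> VI_hom m (Suc n)"
      using u unfolding gens_def by blast
    let ?D = "sum_space e m (VI_id e) f"
    have "card ?D \<le> card (UNIV :: 'f set) ^ (e + m)" by (rule card_sum_space)
    also have "\<dots> \<le> card (UNIV :: 'f set) ^ n"
      using S_bound[OF f(2)] n card_field_gt_1[where 'f='f] by (intro power_increasing) auto
    finally have cD: "card ?D \<le> card (UNIV :: 'f set) ^ n" .
    have eD: "fvec e \<subseteq> ?D"
    proof
      fix v :: "nat \<Rightarrow> 'f" assume v: "v \<in> fvec e"
      show "v \<in> ?D" using sum_space_contains(1)[OF v, of "VI_id e"] unfolding mat_apply_id[OF v] .
    qed
    obtain h where h: "h \<in> VI_hom (Suc n) (Suc n)" "\<And>v. v \<in> fvec e \<Longrightarrow> mat_apply (Suc n) h v = v"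
      "\<And>v. v \<in> ?D \<Longrightarrow> mat_apply (Suc n) h v \<in> fvec n"
      using move_into[OF vsub_sum_space sum_space_sub[OF VI_id_in[OF e(2)] f(3)] cD eD e(1)] by auto
    have hc: "h \<in> carry (Suc n) (VI_id e) (VI_id e)"
      unfolding carry_def using h(1,2) VI_comp_eq_iff_apply[OF VI_id_in[OF e(2)] h(1) VI_id_in[OF e(2)]]
      by (simp add: mat_apply_id)
    define f' where "f' = VI_comp (Suc n) h f"
    have f'S: "f' \<in> VI_hom m (Suc n)" unfolding f'_def by (rule VI_comp_in[OF f(3) h(1)])
    have f'n: "f' \<in> VI_hom m n"
      by (rule VI_hom_restrict[OF f'S]) (simp add: f'_def mat_apply_comp h(3) sum_space_contains(2))
    note s = S_in[OF f(2)]
    have "avg e (VI_id e) (Suc n) u = avg e (VI_id e) (Suc n) (\<rho> (Suc n) (Suc n) h u)"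
      unfolding avg_right[OF e(2) ide hc ide \<rho>_in[OF f(3) s, folded f(1)]] VI_comp_id_right[OF ide] ..
    also have "\<rho> (Suc n) (Suc n) h u = \<rho> m (Suc n) f' s"
      unfolding f(1) f'_def by (rule \<rho>_comp[OF f(3) h(1) s, symmetric])
    also have "\<dots> = \<rho> n (Suc n) (VI_id n) (\<rho> m n f' s)"
      using \<rho>_comp[OF f'n VI_id_Suc s] unfolding VI_comp_id_left[OF f'n] .
    also have "avg e (VI_id e) (Suc n) \<dots> = \<sigma> e n (avg e (VI_id e) n (\<rho> m n f' s))"
      by (rule \<sigma>_avg[OF e(1) ide \<rho>_in[OF f'n s], symmetric])
    finally show ?thesis using avg_inv_space[OF e(1) ide \<rho>_in[OF f'n s]] by blast
  qed
  have "subspace {u. avg e (VI_id e) (Suc n) u \<in> \<sigma> e n ` inv_space e n}"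
    using sub by (intro subspaceI) (auto simp: a.zero a.add a.scale intro: subspace_0 subspace_add subspace_scale)
  then have "span (gens (Suc n)) \<subseteq> {u. avg e (VI_id e) (Suc n) u \<in> \<sigma> e n ` inv_space e n}"
    using gen by (intro span_minimal) auto
  then have "avg e (VI_id e) (Suc n) u \<in> \<sigma> e n ` inv_space e n" if "u \<in> V (Suc n)" for u
    using that generated[of "Suc n", folded gens_def] by blast
  then show "inv_space e (Suc n) \<subseteq> \<sigma> e n ` inv_space e n"
    using avg_id_inv_space[OF e(2)] inv_space_sub by fastforce
qed

text \<open>Equal dimensions turn the surjection \<open>\<sigma>\<close> into an isomorphism of the
  invariants; it commutes with \<open>g\<close>, so the traces agree.\<close>

lemma \<phi>_Suc:
  assumes n: "e + d \<le> n" and g: "g \<in> VI_hom e e" and dim: "dim (inv_space e (Suc n)) = dim (inv_space e n)"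
  shows "\<phi> e g (Suc n) = \<phi> e g n"
proof -
  have e: "e \<le> n" "e \<le> Suc n" using n by auto
  let ?W = "inv_space e n" and ?W' = "inv_space e (Suc n)"
  note im = \<sigma>_image[OF n]
  obtain t where t: "Vector_Spaces.linear scale scale t" "\<And>v. v \<in> ?W \<Longrightarrow> t (\<sigma> e n v) = v"
    using linear_surj_iso[OF fin_inv_space linear_\<sigma> im dim] by blast
  have t': "\<sigma> e n (t w) = w" "t w \<in> ?W" if w: "w \<in> ?W'" for w
  proof -
    obtain v where "v \<in> ?W" "w = \<sigma> e n v" using w unfolding im[symmetric] by (elim imageE)
    then show "\<sigma> e n (t w) = w" "t w \<in> ?W" by (simp_all add: t(2))
  qed
  have lin: "Vector_Spaces.linear scale scale (\<lambda>v. avg e g (Suc n) (\<sigma> e n v))"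
    using Vector_Spaces.linear_compose[OF linear_\<sigma> linear_avg] by (simp add: o_def)
  have comm: "avg e g (Suc n) (\<sigma> e n v) = \<sigma> e n (avg e g n v)" if "v \<in> ?W" for v
    using \<sigma>_avg[OF e(1) g] avg_\<sigma>[OF e(1) g] that inv_space_sub[THEN subsetD, OF that] by simp
  have aW: "avg e g n v \<in> ?W" if "v \<in> ?W" for v
    using avg_inv_space[OF e(1) g] that inv_space_sub by blast
  have "\<phi> e g (Suc n) = trace_on ?W' (avg e g (Suc n))" by (rule \<phi>_trace[OF e(2) g])
  also have "\<dots> = trace_on ?W' (\<lambda>w. avg e g (Suc n) (\<sigma> e n (t w)))"
    by (rule trace_on_cong[OF fin_inv_space]) (simp add: t')
  also have "\<dots> = trace_on ?W (\<lambda>v. t (avg e g (Suc n) (\<sigma> e n v)))"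
    by (rule trace_on_cyc[OF fin_inv_space fin_inv_space t(1) lin]) (use t'(2) in blast, use comm aW im in auto)
  also have "\<dots> = trace_on ?W (avg e g n)"
    by (rule trace_on_cong[OF fin_inv_space]) (simp add: comm aW t(2))
  also have "\<dots> = \<phi> e g n" by (rule \<phi>_trace[OF e(1) g, symmetric])
  finally show ?thesis .
qed

lemma \<phi>_stable:
  "\<exists>N. \<forall>n\<ge>N. \<forall>g\<in>VI_hom e e. \<phi> e g n = \<phi> e g N"
proof -
  have le: "dim (inv_space e (Suc n)) \<le> dim (inv_space e n)" if n: "e + d \<le> n" for n
  proof -
    interpret s: Vector_Spaces.linear scale scale "\<sigma> e n" by (rule linear_\<sigma>)
    define B where "B = basis_of (inv_space e n)"
    note B = basis_of[OF fin_inv_space[of e n], folded B_def]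
    have "inv_space e (Suc n) \<subseteq> span (\<sigma> e n ` B)"
      unfolding \<sigma>_image[OF n, symmetric] s.span_image B(3) ..
    then have "dim (inv_space e (Suc n)) \<le> card (\<sigma> e n ` B)" using B(1) by (intro dim_le_card) auto
    also have "\<dots> \<le> card B" by (rule card_image_le[OF B(1)])
    finally show ?thesis using dim_span_eq_card_independent[OF B(2)] B(3) by simp
  qed
  \<comment> \<open>The minimum of a sequence that does not increase from e + d on; once attained it
    is kept.\<close>
  define k where "k = (LEAST k. \<exists>n\<ge>e + d. dim (inv_space e n) = k)"
  have ex: "\<exists>k. \<exists>n\<ge>e + d. dim (inv_space e n) = k" by blast
  obtain N where N: "N \<ge> e + d" "dim (inv_space e N) = k" using LeastI_ex[OF ex] unfolding k_def by blast
  have dim: "dim (inv_space e n) = k" if "N \<le> n" for n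
    using that
  proof (induction n rule: dec_induct)
    case base then show ?case by (rule N)
  next
    case (step n)
    have "k \<le> dim (inv_space e (Suc n))"
      unfolding k_def by (rule Least_le) (use N(1) step in \<open>auto intro!: exI[of _ "Suc n"]\<close>)
    then show ?case using le[of n] step N(1) by simp
  qed
  have "\<phi> e g n = \<phi> e g N" if "N \<le> n" "g \<in> VI_hom e e" for n g
    using that(1)
  proof (induction n rule: dec_induct)
    case base then show ?case ..
  next
    case (step n)
    then show ?case using \<phi>_Suc[of e n g] dim[of n] dim[of "Suc n"] N(1) that(2) by simp
  qed
  then show ?thesis by blast
qed

end

section \<open>Expansion of the dimension\<close>

lemma class_fun_theta:
  fixes g :: "nat \<Rightarrow> nat \<Rightarrow> 'f::{finite,field}"
  assumes g: "g \<in> VI_hom e e"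
  shows "class_fun n (theta e g n)"
proof -
  have le: "theta e g n (VI_comp n x y) \<le> theta e g n (VI_comp n y x)"
    if x: "x \<in> VI_hom n n" and y: "y \<in> VI_hom n n" for x y
    unfolding theta_def
  proof (rule card_inj_on_le)
    show "inj_on (VI_comp n y) {f \<in> VI_hom e n. VI_comp n (VI_comp n x y) f = VI_comp e f g}"
      by (rule inj_on_inverseI[where g = "VI_comp n (ginv n y)"], rule ginv_cancel(1)[OF y], blast)
    show "VI_comp n y ` {f \<in> VI_hom e n. VI_comp n (VI_comp n x y) f = VI_comp e f g}
        \<subseteq> {f \<in> VI_hom e n. VI_comp n (VI_comp n y x) f = VI_comp e f g}"
      using VI_comp_in[OF _ y] by (auto simp flip: VI_comp_assoc)
    show "finite {f \<in> VI_hom e n. VI_comp n (VI_comp n y x) f = VI_comp e f g}"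
      by (rule finite_subset[OF _ VI_hom_finite]) auto
  qed
  then show ?thesis unfolding class_fun_def by (intro ballI antisym)
qed

text \<open>An injective \<open>f\<close> with f = f g forces \<open>g\<close> to be the identity,
  so most terms of the expansion vanish at the identity.\<close>

lemma theta_id:
  fixes g :: "nat \<Rightarrow> nat \<Rightarrow> 'f::{finite,field}"
  assumes g: "g \<in> VI_hom e e"
  shows "theta e g n (VI_id n) = (if g = VI_id e then card (VI_hom e n :: (nat \<Rightarrow> nat \<Rightarrow> 'f) set) else 0)"
proof -
  have ide: "(VI_id e :: nat \<Rightarrow> nat \<Rightarrow> 'f) \<in> VI_hom e e" by (rule VI_id_in) simp
  have "VI_comp n (VI_id n) f = VI_comp e f g \<longleftrightarrow> g = VI_id e" if f: "f \<in> VI_hom e n" for f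
  proof
    assume "VI_comp n (VI_id n) f = VI_comp e f g"
    then have eq: "VI_comp e f g = f" using VI_comp_id_left[OF f] by simp
    show "g = VI_id e"
    proof (rule VI_hom_eqI[OF g ide])
      fix v :: "nat \<Rightarrow> 'f" assume v: "v \<in> fvec e"
      have "mat_apply e f (mat_apply e g v) = mat_apply e f v"
        using mat_apply_comp[of e e f g v] unfolding eq by simp
      then show "mat_apply e g v = mat_apply e (VI_id e) v"
        unfolding mat_apply_id[OF v] VI_hom_apply_inj[OF f VI_hom_apply_in[OF g] v] .
    qed
  qed (simp add: VI_comp_id_left[OF f] VI_comp_id_right[OF f])
  then have "{f \<in> VI_hom e n. VI_comp n (VI_id n) f = VI_comp e f g} = (if g = VI_id e then VI_hom e n else {})"
    by auto
  then show ?thesis unfolding theta_def by simp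
qed

text \<open>Makes the delta function at the identity a class function.\<close>

lemma VI_comp_eq_id_commute:
  fixes x y :: "nat \<Rightarrow> nat \<Rightarrow> 'f::{finite,field}"
  assumes "x \<in> VI_hom n n" "y \<in> VI_hom n n"
  shows "VI_comp n x y = VI_id n \<longleftrightarrow> VI_comp n y x = VI_id n"
proof -
  have "VI_comp n y x = VI_id n" if "x \<in> VI_hom n n" "y \<in> VI_hom n n" "VI_comp n x y = VI_id n"
    for x y :: "nat \<Rightarrow> nat \<Rightarrow> 'f"
  proof -
    have "y = ginv n x"
      using ginv_cancel(1)[OF that(1,2)] VI_comp_id_right[OF ginv(1)[OF that(1)]] unfolding that(3) by simp
    then show ?thesis using ginv(2)[OF that(1)] by simp
  qed
  with assms show ?thesis by blast
qed

text \<open>An injection from F_q^(e+1) is an injection \<open>f\<close> from F_q^e together with an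
  image of the last unit vector outside the image of \<open>f\<close>.\<close>

lemma card_VI_hom_Suc:
  "card (VI_hom (Suc e) n :: (nat \<Rightarrow> nat \<Rightarrow> 'f::{finite,field}) set)
    = card (VI_hom e n :: (nat \<Rightarrow> nat \<Rightarrow> 'f) set) * (card (UNIV :: 'f set) ^ n - card (UNIV :: 'f set) ^ e)"
proof -
  let ?S = "SIGMA f:(VI_hom e n :: (nat \<Rightarrow> nat \<Rightarrow> 'f) set). fvec n - mat_apply e f ` fvec e"
  have app: "mat_apply (Suc e) A w = vcomb (mat_apply e A w) (w e) (A e)" for A :: "nat \<Rightarrow> nat \<Rightarrow> 'f" and w
    by (simp add: mat_apply_def vcomb_def)
  have upd: "mat_apply e (A(e := v)) w = mat_apply e A w" for A :: "nat \<Rightarrow> nat \<Rightarrow> 'f" and v w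
    by (simp add: mat_apply_def)
  have trunc: "mat_apply e A (w(e := 0)) = mat_apply e A w" for A :: "nat \<Rightarrow> nat \<Rightarrow> 'f" and w
    by (simp add: mat_apply_def)
  have trunc_in: "w(e := 0) \<in> fvec e" if "w \<in> fvec (Suc e)" for w :: "nat \<Rightarrow> 'f"
    using that unfolding fvec_def by (simp add: le_eq_less_or_eq[of e] Suc_le_eq)
  have "bij_betw (\<lambda>(f, v). f(e := v)) ?S (VI_hom (Suc e) n)"
  proof (rule bij_betw_byWitness[where f' = "\<lambda>A. (A(e := (\<lambda>_. 0)), A e)"])
    show "\<forall>p\<in>?S. (\<lambda>A. (A(e := (\<lambda>_. 0)), A e)) ((\<lambda>(f, v). f(e := v)) p) = p"
    proof (clarsimp simp: fun_upd_idem_iff)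
      fix f :: "nat \<Rightarrow> nat \<Rightarrow> 'f" assume "f \<in> VI_hom e n"
      from VI_hom_row_out[OF this, of e] show "f e = (\<lambda>_. 0)" by simp
    qed
    show "\<forall>A\<in>VI_hom (Suc e) n. (\<lambda>(f, v). f(e := v)) (A(e := (\<lambda>_. 0)), A e) = A" by simp
    show "(\<lambda>(f, v). f(e := v)) ` ?S \<subseteq> VI_hom (Suc e) n"
    proof clarify
      fix f :: "nat \<Rightarrow> nat \<Rightarrow> 'f" and v
      assume f: "f \<in> VI_hom e n" and v: "v \<in> fvec n" "v \<notin> mat_apply e f ` fvec e"
      have "(f(e := v)) i j = 0" if "Suc e \<le> i \<or> n \<le> j" for i j
        using that f fvecD[OF v(1)] unfolding VI_hom_def by auto
      moreover have "w = (\<lambda>_. 0)" if w: "w \<in> fvec (Suc e)" "mat_apply (Suc e) (f(e := v)) w = (\<lambda>_. 0)" for w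
      proof -
        have z: "vcomb (mat_apply e f w) (w e) v = (\<lambda>_. 0)" using w(2) unfolding app upd by simp
        have "w e = 0"
        proof (rule ccontr)
          assume we: "w e \<noteq> 0"
          \<comment> \<open>Solving the vanishing combination for \<open>v\<close> would place it in
            the image of \<open>f\<close>.\<close>
          let ?u = "vcomb (\<lambda>_. 0) (- (1 / w e)) (w(e := 0))"
          have "mat_apply e f ?u = v"
          proof
            fix j
            have "mat_apply e f w j = - (w e * v j)"
              using fun_cong[OF z, of j] by (simp add: vcomb_def eq_neg_iff_add_eq_0)
            then show "mat_apply e f ?u j = v j" using we unfolding mat_apply_vcomb trunc by (simp add: vcomb_def)
          qed
          moreover have "?u \<in> fvec e" by (rule vsub_vcomb[OF vsub_fvec fvec_0_in trunc_in[OF w(1)]])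
          ultimately show False using v(2) by blast
        qed
        then have "w(e := 0) = w" by (simp add: fun_upd_idem)
        then have "w \<in> fvec e" using trunc_in[OF w(1)] by simp
        moreover have "mat_apply e f w = (\<lambda>_. 0)" using z \<open>w e = 0\<close> by simp
        ultimately show ?thesis using VI_hom_apply_eq_0[OF f] by simp
      qed
      ultimately show "f(e := v) \<in> VI_hom (Suc e) n" unfolding VI_hom_def by blast
    qed
    show "(\<lambda>A. (A(e := (\<lambda>_. 0)), A e)) ` VI_hom (Suc e) n \<subseteq> ?S"
    proof clarify
      fix A :: "nat \<Rightarrow> nat \<Rightarrow> 'f" assume A: "A \<in> VI_hom (Suc e) n"
      have mono: "w \<in> fvec (Suc e)" if "w \<in> fvec e" for w :: "nat \<Rightarrow> 'f" using fvec_mono[of e "Suc e"] that by auto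
      have app': "mat_apply (Suc e) A w = mat_apply e (A(e := (\<lambda>_. 0))) w" if w: "w \<in> fvec e" for w
        unfolding app upd using fvecD[OF w, of e] by simp
      have "(A(e := (\<lambda>_. 0))) i j = 0" if "e \<le> i \<or> n \<le> j" for i j
        using that A unfolding VI_hom_def by (cases "i = e") auto
      moreover have "w = (\<lambda>_. 0)" if w: "w \<in> fvec e" "mat_apply e (A(e := (\<lambda>_. 0))) w = (\<lambda>_. 0)" for w
        using VI_hom_apply_eq_0[OF A mono[OF w(1)]] w(2) unfolding app'[OF w(1)] by simp
      ultimately have 1: "A(e := (\<lambda>_. 0)) \<in> VI_hom e n" unfolding VI_hom_def by blast
      have 2: "A e \<noteq> mat_apply e (A(e := (\<lambda>_. 0))) w" if w: "w \<in> fvec e" for w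
      proof
        assume "A e = mat_apply e (A(e := (\<lambda>_. 0))) w"
        then have "mat_apply (Suc e) A (unit_vec e) = mat_apply (Suc e) A w"
          unfolding app'[OF w] by (simp add: mat_apply_unit_vec)
        then have "unit_vec e = w"
          using VI_hom_apply_inj[OF A unit_vec_in_fvec mono[OF w]] by simp
        then show False using fvecD[OF w, of e] by (auto simp: unit_vec_def)
      qed
      show "A(e := (\<lambda>_. 0)) \<in> VI_hom e n \<and> A e \<in> fvec n - mat_apply e (A(e := (\<lambda>_. 0))) ` fvec e"
        using 1 2 VI_hom_row[OF A] by blast
    qed
  qed
  then have "card (VI_hom (Suc e) n :: (nat \<Rightarrow> nat \<Rightarrow> 'f) set) = card ?S" by (rule bij_betw_same_card[symmetric])
  also have "\<dots> = (\<Sum>f\<in>(VI_hom e n :: (nat \<Rightarrow> nat \<Rightarrow> 'f) set). card (fvec n - mat_apply e f ` fvec e))"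
    by (rule card_SigmaI) (simp_all add: VI_hom_finite card_fvec(1))
  also have "\<dots> = (\<Sum>f\<in>(VI_hom e n :: (nat \<Rightarrow> nat \<Rightarrow> 'f) set). card (UNIV :: 'f set) ^ n - card (UNIV :: 'f set) ^ e)"
  proof (rule sum.cong[OF refl])
    fix f :: "nat \<Rightarrow> nat \<Rightarrow> 'f" assume f: "f \<in> VI_hom e n"
    have "inj_on (mat_apply e f) (fvec e)" using VI_hom_apply_inj[OF f] by (auto simp: inj_on_def)
    moreover have "mat_apply e f ` fvec e \<subseteq> fvec n" using VI_hom_apply_in[OF f] by blast
    ultimately show "card (fvec n - mat_apply e f ` fvec e) = card (UNIV :: 'f set) ^ n - card (UNIV :: 'f set) ^ e"
      by (simp add: card_Diff_subset finite_imageI card_fvec card_image)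
  qed
  finally show ?thesis by simp
qed

lemma card_VI_hom:
  assumes "e \<le> n"
  shows "rat_of_nat (card (VI_hom e n :: (nat \<Rightarrow> nat \<Rightarrow> 'f::{finite,field}) set))
    = poly (\<Prod>i<e. [:- of_nat (card (UNIV :: 'f set) ^ i), 1:]) (of_nat (card (UNIV :: 'f set) ^ n))"
  using assms
proof (induction e)
  case 0
  have "VI_hom 0 n = {\<lambda>_ _. 0 :: 'f}" unfolding VI_hom_def fvec_0 by auto
  then show ?case by simp
next
  case (Suc e)
  have "card (UNIV :: 'f set) ^ e \<le> card (UNIV :: 'f set) ^ n"
    using Suc.prems card_field_gt_1[where 'f='f] by (intro power_increasing) auto
  then show ?case using Suc by (simp add: card_VI_hom_Suc of_nat_diff algebra_simps)
qed

text \<open>The coefficients of the expansion lie in \<open>'k\<close>; this functional turns them into rationals.\<close>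
lemma rat_functional:
  "\<exists>L :: 'k::field_char_0 \<Rightarrow> rat. (\<forall>x y. L (x + y) = L x + L y) \<and> (\<forall>r x. L (of_rat r * x) = r * L x) \<and> L 1 = 1"
proof -
  interpret k: vector_space "\<lambda>r (x::'k). of_rat r * x"
    by standard (simp_all add: algebra_simps of_rat_add of_rat_mult)
  interpret q: vector_space "(*) :: rat \<Rightarrow> rat \<Rightarrow> rat"
    by standard (simp_all add: algebra_simps)
  interpret p: vector_space_pair "\<lambda>r (x::'k). of_rat r * x" "(*) :: rat \<Rightarrow> rat \<Rightarrow> rat" ..
  obtain L where L: "Vector_Spaces.linear (\<lambda>r (x::'k). of_rat r * x) ((*) :: rat \<Rightarrow> rat \<Rightarrow> rat) L" "L 1 = 1"
    using p.linear_independent_extend[of "{1}" "\<lambda>_. 1"] by (auto simp: k.independent_insert)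
  interpret L: Vector_Spaces.linear "\<lambda>r (x::'k). of_rat r * x" "(*) :: rat \<Rightarrow> rat \<Rightarrow> rat" L by (rule L(1))
  show ?thesis using L.add L.scale L(2) by blast
qed

section \<open>Solving for coefficients independent of n\<close>

context linear_VI_module
begin

text \<open>All \<open>g\<close> occur, not one per conjugacy class, so the functions repeat and
  \<open>gram\<close> may be singular.\<close>

definition theta_index :: "(nat \<times> (nat \<Rightarrow> nat \<Rightarrow> 'f)) set" where
  "theta_index = (SIGMA e:{..d}. VI_hom e e)"

definition \<Theta> :: "nat \<Rightarrow> nat \<times> (nat \<Rightarrow> nat \<Rightarrow> 'f) \<Rightarrow> (nat \<Rightarrow> nat \<Rightarrow> 'f) \<Rightarrow> nat" where
  "\<Theta> n = (\<lambda>(e, g). theta e g n)"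

definition \<Phi> :: "nat \<Rightarrow> nat \<times> (nat \<Rightarrow> nat \<Rightarrow> 'f) \<Rightarrow> 'k" where
  "\<Phi> n = (\<lambda>(e, g). \<phi> e g n)"

text \<open>The stable value of the product of two \<open>theta\<close> divided by the order of
  GL_n. Types are taken at e + e', where they have stabilized.\<close>

definition gram :: "nat \<times> (nat \<Rightarrow> nat \<Rightarrow> 'f) \<Rightarrow> nat \<times> (nat \<Rightarrow> nat \<Rightarrow> 'f) \<Rightarrow> nat" where
  "gram = (\<lambda>(e, g) (e', g'). card {K \<in> pair_types e e' (e + e'). twist e e' g g' K = K})"

definition order_GL :: "nat \<Rightarrow> nat" where
  "order_GL n = card (VI_hom n n :: (nat \<Rightarrow> nat \<Rightarrow> 'f) set)"

lemma finite_theta_index: "finite theta_index"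
  unfolding theta_index_def by (intro finite_SigmaI VI_hom_finite) simp

lemma order_GL_pos: "order_GL n \<noteq> 0"
proof -
  have "VI_id n \<in> (VI_hom n n :: (nat \<Rightarrow> nat \<Rightarrow> 'f) set)" by (rule VI_id_in) simp
  then show ?thesis unfolding order_GL_def using VI_hom_finite by (auto simp: card_eq_0_iff)
qed

lemma gram_\<Theta>:
  assumes "2 * d \<le> n" "i \<in> theta_index" "j \<in> theta_index"
  shows "(\<Sum>x\<in>VI_hom n n. \<Theta> n i x * \<Theta> n j x) = gram i j * order_GL n"
proof -
  obtain e g e' g' where ij: "i = (e, g)" "j = (e', g')" "e \<le> d" "e' \<le> d" "g \<in> VI_hom e e" "g' \<in> VI_hom e' e'"
    using assms(2,3) unfolding theta_index_def by auto
  then have "e + e' \<le> n" using assms(1) by linarith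
  from sum_theta_theta[OF ij(5,6), of n, unfolded pair_types_stable[OF this]]
  show ?thesis unfolding ij(1,2) \<Theta>_def gram_def order_GL_def by simp
qed

lemma sum_\<Theta>_class_fun:
  assumes "class_fun n \<psi>" "d \<le> n" "i \<in> theta_index"
  shows "\<exists>e g. e \<le> d \<and> g \<in> VI_hom e e \<and> i = (e, g) \<and>
    (\<Sum>x\<in>VI_hom n n. \<psi> x * of_nat (\<Theta> n i x))
      = of_nat (card (VI_hom e n :: (nat \<Rightarrow> nat \<Rightarrow> 'f) set)) * (sum \<psi> (carry n (VI_id e) g) :: 'k)"
proof -
  obtain e g where i: "i = (e, g)" "e \<le> d" "g \<in> VI_hom e e" using assms(3) unfolding theta_index_def by auto
  then show ?thesis using sum_class_fun_theta[OF assms(1) _ i(3)] assms(2) unfolding \<Theta>_def by auto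
qed

lemma sum_\<Theta>_\<chi>:
  assumes n: "d \<le> n" and i: "i \<in> theta_index"
  shows "(\<Sum>x\<in>VI_hom n n. of_nat (\<Theta> n i x) * \<chi> n x) = of_nat (order_GL n) * \<Phi> n i"
proof -
  obtain e g where e: "e \<le> d" "g \<in> VI_hom e e" "i = (e, g)"
    and eq: "(\<Sum>x\<in>VI_hom n n. \<chi> n x * of_nat (\<Theta> n i x))
      = of_nat (card (VI_hom e n :: (nat \<Rightarrow> nat \<Rightarrow> 'f) set)) * sum (\<chi> n) (carry n (VI_id e) g)"
    using sum_\<Theta>_class_fun[OF class_fun_\<chi> n i] by blast
  have en: "e \<le> n" using e n by simp
  have gn: "g \<in> VI_hom e n" using VI_hom_mono[OF en] e by blast
  have "sum (\<chi> n) (carry n (VI_id e) g) = of_nat (card (carry n (VI_id e) g)) * \<Phi> n i"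
    using card_carry_id(2)[OF en e(2)] unfolding \<Phi>_def \<phi>_def e(3) by simp
  then have "(\<Sum>x\<in>VI_hom n n. \<chi> n x * of_nat (\<Theta> n i x))
      = of_nat (card (VI_hom e n :: (nat \<Rightarrow> nat \<Rightarrow> 'f) set) * card (carry n (VI_id e) g)) * \<Phi> n i"
    unfolding eq by simp
  then show ?thesis unfolding card_carry[OF VI_id_in[OF en] gn] order_GL_def by (simp add: mult.commute)
qed

lemma orthogonal_\<chi>:
  assumes cl: "class_fun n \<psi>" and n: "d \<le> n"
    and zero: "\<And>i. i \<in> theta_index \<Longrightarrow> (\<Sum>x\<in>VI_hom n n. \<psi> x * of_nat (\<Theta> n i x)) = 0"
  shows "(\<Sum>x\<in>VI_hom n n. \<psi> x * \<chi> n x) = 0"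
proof (rule sum_class_fun_\<chi>[OF cl])
  fix e and g :: "nat \<Rightarrow> nat \<Rightarrow> 'f" assume e: "e \<le> d" "e \<le> n" and g: "g \<in> VI_hom e e"
  have i: "(e, g) \<in> theta_index" using e g unfolding theta_index_def by simp
  have "g \<in> VI_hom e n" using VI_hom_mono[OF e(2)] g by blast
  then have "card (VI_hom e n :: (nat \<Rightarrow> nat \<Rightarrow> 'f) set) \<noteq> 0" using VI_hom_finite by (auto simp: card_eq_0_iff)
  then show "sum \<psi> (carry n (VI_id e) g) = 0"
    using sum_\<Theta>_class_fun[OF cl n i] zero[OF i] by auto
qed

text \<open>Covers both test functions below: \<open>a = 0\<close> for a kernel vector of
  \<open>gram\<close>, and \<open>a = 1\<close> for the delta function corrected by a
  combination.\<close>

lemma class_fun_sum_\<Theta>: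
  "class_fun n (\<lambda>x. a * (if x = VI_id n then 1 else 0) + (\<Sum>j\<in>theta_index. c j * of_nat (\<Theta> n j x) :: 'k))"
proof -
  have "\<Theta> n j (VI_comp n x y) = \<Theta> n j (VI_comp n y x)"
    if j: "j \<in> theta_index" and xy: "x \<in> VI_hom n n" "y \<in> VI_hom n n" for j x y
  proof -
    obtain e g where "j = (e, g)" "g \<in> VI_hom e e" using j unfolding theta_index_def by auto
    then show ?thesis using class_fun_theta[of g e n] xy unfolding \<Theta>_def class_fun_def by simp
  qed
  then show ?thesis unfolding class_fun_def by (simp add: VI_comp_eq_id_commute)
qed

lemma sum_delta_\<Theta>:
  fixes h :: "(nat \<Rightarrow> nat \<Rightarrow> 'f) \<Rightarrow> 'k"
  shows "(\<Sum>x\<in>VI_hom n n. (a * (if x = VI_id n then 1 else 0) + (\<Sum>j\<in>theta_index. c j * of_nat (\<Theta> n j x))) * h x)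
    = a * h (VI_id n) + (\<Sum>j\<in>theta_index. c j * (\<Sum>x\<in>VI_hom n n. of_nat (\<Theta> n j x) * h x))"
proof -
  have idn: "(VI_id n :: nat \<Rightarrow> nat \<Rightarrow> 'f) \<in> VI_hom n n" by (rule VI_id_in) simp
  have "(\<Sum>x\<in>VI_hom n n. (a * (if x = VI_id n then 1 else 0) + (\<Sum>j\<in>theta_index. c j * of_nat (\<Theta> n j x))) * h x)
      = (\<Sum>x\<in>VI_hom n n. (if x = VI_id n then a * h x else 0)) + (\<Sum>x\<in>VI_hom n n. \<Sum>j\<in>theta_index. c j * (of_nat (\<Theta> n j x) * h x))"
    unfolding sum.distrib[symmetric] by (intro sum.cong refl) (simp add: distrib_right sum_distrib_right mult.assoc)
  also have "(\<Sum>x\<in>VI_hom n n. (if x = VI_id n then a * h x else 0)) = a * h (VI_id n)"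
    using idn by (simp add: VI_hom_finite)
  also have "(\<Sum>x\<in>VI_hom n n. \<Sum>j\<in>theta_index. c j * (of_nat (\<Theta> n j x) * h x))
      = (\<Sum>j\<in>theta_index. c j * (\<Sum>x\<in>VI_hom n n. of_nat (\<Theta> n j x) * h x))"
    by (subst sum.swap) (simp add: sum_distrib_left)
  finally show ?thesis .
qed

lemma dim_expansion:
  "\<exists>(y :: _ \<Rightarrow> 'k) N. \<forall>n\<ge>N. of_nat (dim (V n)) = (\<Sum>i\<in>theta_index. y i * of_nat (\<Theta> n i (VI_id n)))"
proof -
  have "\<exists>M. \<forall>e. \<forall>n\<ge>M e. \<forall>g\<in>VI_hom e e. \<phi> e g n = \<phi> e g (M e)" using \<phi>_stable by metis
  then obtain M where M: "\<And>e n g. M e \<le> n \<Longrightarrow> g \<in> VI_hom e e \<Longrightarrow> \<phi> e g n = \<phi> e g (M e)" by blast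
  \<comment> \<open>Beyond all stabilization points for e at most \<open>d\<close>, and beyond 2 d,
    which bounds e + e' for the Gram matrix.\<close>
  define N where "N = Max (M ` {..d}) + 2 * d"
  have "M e \<le> N" if "e \<le> d" for e
    unfolding N_def by (rule trans_le_add1, rule Max_ge) (use that in auto)
  then have MN: "M e \<le> n" if "e \<le> d" "N \<le> n" for e n using that le_trans by blast
  have \<Phi>: "\<Phi> n i = \<Phi> N i" if n: "N \<le> n" and i: "i \<in> theta_index" for n i
  proof -
    obtain e g where "i = (e, g)" "e \<le> d" "g \<in> VI_hom e e" using i unfolding theta_index_def by auto
    then show ?thesis using M[OF MN[of e n], of g] M[OF MN[of e N], of g] n unfolding \<Phi>_def by simp
  qed
  have dN: "d \<le> n" "2 * d \<le> n" if "N \<le> n" for n using that unfolding N_def by auto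
  have gr: "(\<Sum>x\<in>VI_hom n n. of_nat (\<Theta> n i x) * of_nat (\<Theta> n j x)) = (of_nat (gram i j) * of_nat (order_GL n) :: 'k)"
    if "N \<le> n" "i \<in> theta_index" "j \<in> theta_index" for n i j
    unfolding of_nat_mult[symmetric] of_nat_sum[symmetric] gram_\<Theta>[OF dN(2)[OF that(1)] that(2,3)] ..
  have sym: "gram i j = gram j i" if "i \<in> theta_index" "j \<in> theta_index" for i j
    using gram_\<Theta>[OF dN(2)[OF order_refl] that] gram_\<Theta>[OF dN(2)[OF order_refl] that(2,1)] order_GL_pos[of N]
    by (simp add: mult.commute)
  \<comment> \<open>Solvability: a kernel vector of \<open>gram\<close> gives a class function
    orthogonal to all \<open>theta\<close>, hence to \<chi>, which says that the vector annihilates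
    \<open>\<Phi> N\<close>.\<close>
  have "\<exists>y. \<forall>j\<in>theta_index. \<Phi> N j = (\<Sum>i\<in>theta_index. y i * of_nat (gram i j))"
  proof (rule fredholm[OF finite_theta_index finite_theta_index])
    fix c :: "nat \<times> (nat \<Rightarrow> nat \<Rightarrow> 'f) \<Rightarrow> 'k"
    assume c: "\<And>i. i \<in> theta_index \<Longrightarrow> (\<Sum>j\<in>theta_index. of_nat (gram i j) * c j) = 0"
    let ?\<psi> = "\<lambda>x. 0 * (if x = VI_id N then 1 else 0) + (\<Sum>j\<in>theta_index. c j * of_nat (\<Theta> N j x))"
    have "(\<Sum>x\<in>VI_hom N N. ?\<psi> x * \<chi> N x) = 0"
    proof (rule orthogonal_\<chi>[OF class_fun_sum_\<Theta> dN(1)[OF order_refl]])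
      fix i assume i: "i \<in> theta_index"
      have "(\<Sum>x\<in>VI_hom N N. ?\<psi> x * of_nat (\<Theta> N i x)) = (\<Sum>j\<in>theta_index. c j * (of_nat (gram i j) * of_nat (order_GL N)))"
        unfolding sum_delta_\<Theta> using gr[OF order_refl _ i] sym[OF i] by (simp cong: sum.cong)
      also have "\<dots> = of_nat (order_GL N) * (\<Sum>j\<in>theta_index. of_nat (gram i j) * c j)"
        by (simp add: sum_distrib_left mult_ac)
      finally show "(\<Sum>x\<in>VI_hom N N. ?\<psi> x * of_nat (\<Theta> N i x)) = 0" using c[OF i] by simp
    qed
    then have "(\<Sum>j\<in>theta_index. c j * (of_nat (order_GL N) * \<Phi> N j)) = 0"
      unfolding sum_delta_\<Theta> using sum_\<Theta>_\<chi>[OF dN(1)[OF order_refl]] by (simp cong: sum.cong)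
    then have "of_nat (order_GL N) * (\<Sum>j\<in>theta_index. \<Phi> N j * c j) = 0"
      by (simp add: sum_distrib_left mult_ac)
    then show "(\<Sum>j\<in>theta_index. \<Phi> N j * c j) = 0" using order_GL_pos[of N] by simp
  qed
  then obtain y where y: "\<And>j. j \<in> theta_index \<Longrightarrow> \<Phi> N j = (\<Sum>i\<in>theta_index. y i * of_nat (gram i j))" by blast
  have "of_nat (dim (V n)) = (\<Sum>i\<in>theta_index. y i * of_nat (\<Theta> n i (VI_id n)))" if n: "N \<le> n" for n
  proof -
    have idn: "(VI_id n :: nat \<Rightarrow> nat \<Rightarrow> 'f) \<in> VI_hom n n" by (rule VI_id_in) simp
    obtain c :: "nat \<times> (nat \<Rightarrow> nat \<Rightarrow> 'f) \<Rightarrow> rat" where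
      c: "\<And>i. i \<in> theta_index \<Longrightarrow> of_nat (\<Theta> n i (VI_id n))
        = (\<Sum>j\<in>theta_index. c j * (\<Sum>x\<in>VI_hom n n. of_nat (\<Theta> n j x) * of_nat (\<Theta> n i x)))"
      using gram_representation[OF finite_theta_index VI_hom_finite idn, where T = "\<lambda>i x. rat_of_nat (\<Theta> n i x)"] by blast
    \<comment> \<open>The rational identity is carried into the field of coefficients, where
      positivity could not have produced it.\<close>
    have ck: "of_nat (\<Theta> n i (VI_id n))
        = (\<Sum>j\<in>theta_index. of_rat (c j) * (\<Sum>x\<in>VI_hom n n. of_nat (\<Theta> n j x) * of_nat (\<Theta> n i x)) :: 'k)" if "i \<in> theta_index" for i
      using arg_cong[OF c[OF that], where f = "of_rat :: rat \<Rightarrow> 'k"]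
      by (simp add: of_rat_sum of_rat_mult)
    \<comment> \<open>By \<open>ck\<close> this function has product zero with every
      \<open>theta\<close>; its product with \<chi> then expresses the dimension.\<close>
    let ?\<psi> = "\<lambda>x. 1 * (if x = VI_id n then 1 else 0) + (\<Sum>j\<in>theta_index. - of_rat (c j) * of_nat (\<Theta> n j x)) :: 'k"
    have "(\<Sum>x\<in>VI_hom n n. ?\<psi> x * \<chi> n x) = 0"
    proof (rule orthogonal_\<chi>[OF class_fun_sum_\<Theta> dN(1)[OF n]])
      fix i assume i: "i \<in> theta_index"
      show "(\<Sum>x\<in>VI_hom n n. ?\<psi> x * of_nat (\<Theta> n i x)) = 0"
        by (subst sum_delta_\<Theta>) (simp only: ck[OF i], simp add: sum_negf)
    qed
    then have "\<chi> n (VI_id n) = (\<Sum>j\<in>theta_index. of_rat (c j) * (\<Sum>x\<in>VI_hom n n. of_nat (\<Theta> n j x) * \<chi> n x))"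
      unfolding sum_delta_\<Theta> by (simp add: sum_negf)
    also have "\<dots> = (\<Sum>j\<in>theta_index. of_rat (c j) * (of_nat (order_GL n) * (\<Sum>i\<in>theta_index. y i * of_nat (gram i j))))"
      using sum_\<Theta>_\<chi>[OF dN(1)[OF n]] \<Phi>[OF n] y by (simp cong: sum.cong)
    also have "\<dots> = (\<Sum>j\<in>theta_index. \<Sum>i\<in>theta_index. y i * (of_rat (c j) * (of_nat (gram i j) * of_nat (order_GL n))))"
      by (simp add: sum_distrib_left mult_ac)
    \<comment> \<open>After the exchange the inner sum is the value of a \<open>theta\<close> at the
      identity, again by \<open>ck\<close>; this removes \<open>c\<close>.\<close>
    also have "\<dots> = (\<Sum>i\<in>theta_index. y i * (\<Sum>j\<in>theta_index. of_rat (c j) * (of_nat (gram i j) * of_nat (order_GL n))))"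
      by (subst sum.swap) (simp add: sum_distrib_left)
    also have "\<dots> = (\<Sum>i\<in>theta_index. y i * of_nat (\<Theta> n i (VI_id n)))"
    proof (rule sum.cong[OF refl])
      fix i assume i: "i \<in> theta_index"
      show "y i * (\<Sum>j\<in>theta_index. of_rat (c j) * (of_nat (gram i j) * of_nat (order_GL n))) = y i * of_nat (\<Theta> n i (VI_id n))"
        unfolding ck[OF i] using gr[OF n _ i] sym[OF i] by (simp cong: sum.cong)
    qed
    finally show ?thesis unfolding \<chi>_id .
  qed
  then show ?thesis by blast
qed

lemma dim_polynomial:
  "\<exists>P :: rat poly. \<exists>N. \<forall>n\<ge>N. of_nat (dim (V n)) = poly P (of_nat (card (UNIV :: 'f set) ^ n))"
proof -
  obtain y :: "_ \<Rightarrow> 'k" and N where y: "\<And>n. N \<le> n \<Longrightarrow> of_nat (dim (V n)) = (\<Sum>i\<in>theta_index. y i * of_nat (\<Theta> n i (VI_id n)))"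
    using dim_expansion by blast
  obtain L :: "'k \<Rightarrow> rat" where L: "\<And>x y. L (x + y) = L x + L y" "\<And>r x. L (of_rat r * x) = r * L x" "L 1 = 1"
    using rat_functional by blast
  have L0: "L 0 = 0" using L(2)[of 0 0] by simp
  have Lsum: "L (sum f A) = (\<Sum>x\<in>A. L (f x))" for f and A :: "(nat \<times> (nat \<Rightarrow> nat \<Rightarrow> 'f)) set"
    by (induction A rule: infinite_finite_induct) (simp_all add: L0 L(1))
  have Lnat: "L (x * of_nat m) = L x * of_nat m" for x m
    using L(2)[of "of_nat m" x] by (simp add: mult.commute)
  have Lof: "L (of_nat m) = of_nat m" for m using Lnat[of 1 m] L(3) by simp
  let ?p = "\<lambda>e. \<Prod>i<e. [:- of_nat (card (UNIV :: 'f set) ^ i), 1:] :: rat poly"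
  \<comment> \<open>Only the terms with \<open>g\<close> the identity survive at the identity of
    GL_n. \<open>L\<close> replaces the coefficients by rationals and fixes the dimension
    itself.\<close>
  define P where "P = (\<Sum>(e, g)\<in>theta_index. if g = VI_id e then smult (L (y (e, g))) (?p e) else 0)"
  \<comment> \<open>The bound \<open>d\<close> guarantees that e is at most n, as
    \<open>card_VI_hom\<close> requires.\<close>
  have "of_nat (dim (V n)) = poly P (of_nat (card (UNIV :: 'f set) ^ n))" if n: "max N d \<le> n" for n
  proof -
    have "of_nat (dim (V n)) = L (of_nat (dim (V n)))" by (simp add: Lof)
    also have "\<dots> = (\<Sum>i\<in>theta_index. L (y i) * of_nat (\<Theta> n i (VI_id n)))"
      using y[of n] n by (simp add: Lsum Lnat)
    also have "\<dots> = (\<Sum>(e, g)\<in>theta_index. poly (if g = VI_id e then smult (L (y (e, g))) (?p e) else 0)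
        (of_nat (card (UNIV :: 'f set) ^ n)))"
    proof (rule sum.cong[OF refl])
      fix i assume "i \<in> theta_index"
      then obtain e g where i: "i = (e, g)" "e \<le> d" "g \<in> VI_hom e e" unfolding theta_index_def by auto
      have "e \<le> n" using i(2) n by simp
      from card_VI_hom[OF this, where 'f='f]
      show "L (y i) * of_nat (\<Theta> n i (VI_id n)) = (case i of (e, g) \<Rightarrow>
          poly (if g = VI_id e then smult (L (y (e, g))) (?p e) else 0) (of_nat (card (UNIV :: 'f set) ^ n)))"
        unfolding i(1) \<Theta>_def by (simp add: theta_id[OF i(3)])
    qed
    also have "\<dots> = poly P (of_nat (card (UNIV :: 'f set) ^ n))"
      unfolding P_def poly_sum by (simp add: case_prod_unfold)
    finally show ?thesis .
  qed
  then show ?thesis by blast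
qed

end

theorem theorem1p2:
  fixes scale :: "'k::field_char_0 \<Rightarrow> 'v::ab_group_add \<Rightarrow> 'v"
    and Vs :: "nat \<Rightarrow> 'v set"
    and act :: "nat \<Rightarrow> nat \<Rightarrow> (nat \<Rightarrow> nat \<Rightarrow> 'f::{finite,field}) \<Rightarrow> 'v \<Rightarrow> 'v"
  assumes "is_VI_module scale Vs act"
    and "VI_fin_gen scale Vs act"
  shows "\<exists>P :: rat poly. \<exists>N :: nat. \<forall>n\<ge>N.
           of_nat (vector_space.dim scale (Vs n)) = poly P (of_nat (card (UNIV :: 'f set) ^ n))"
proof -
  note mod = assms(1)[unfolded is_VI_module_def]
  interpret traced_space scale unfolding traced_space_def using mod by blast
  have sub: "subspace (Vs n)" for n using mod by blast
  have act_in: "act m n A x \<in> Vs n" if "A \<in> VI_hom m n" "x \<in> Vs m" for m n A x using mod that by blast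
  have act_add: "act m n A (x + y) = act m n A x + act m n A y"
    if "A \<in> VI_hom m n" "x \<in> Vs m" "y \<in> Vs m" for m n A x y using mod that by blast
  have act_scale: "act m n A (scale c x) = scale c (act m n A x)"
    if "A \<in> VI_hom m n" "x \<in> Vs m" for m n A x c using mod that by blast
  have act_id: "act m m (VI_id m) x = x" if "x \<in> Vs m" for m x using mod that by blast
  have act_comp: "act m p (VI_comp n B A) x = act n p B (act m n A x)"
    if "A \<in> VI_hom m n" "B \<in> VI_hom n p" "x \<in> Vs m" for m n p A B x using mod that by blast
  \<comment> \<open>\<open>act\<close> is additive and homogeneous only on \<open>Vs m\<close>; a
    total linear extension is chosen to fit the locale.\<close>
  define \<rho> where "\<rho> m n A = (SOME t. Vector_Spaces.linear scale scale t \<and> (\<forall>v\<in>Vs m. t v = act m n A v))" for m n A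
  have \<rho>: "Vector_Spaces.linear scale scale (\<rho> m n A) \<and> (\<forall>v\<in>Vs m. \<rho> m n A v = act m n A v)"
    if A: "A \<in> VI_hom m n" for m n A
  proof -
    have "\<exists>t. Vector_Spaces.linear scale scale t \<and> (\<forall>v\<in>Vs m. t v = act m n A v)"
      by (rule linear_extend_subspace[OF sub act_add[OF A] act_scale[OF A]])
    from someI_ex[OF this] show ?thesis unfolding \<rho>_def .
  qed
  obtain S where S: "finite S" "\<And>n x. (n, x) \<in> S \<Longrightarrow> x \<in> Vs n"
    "\<And>W. is_VI_submodule scale Vs act W \<Longrightarrow> (\<And>n x. (n, x) \<in> S \<Longrightarrow> x \<in> W n) \<Longrightarrow> W = Vs"
    using assms(2) unfolding VI_fin_gen_def by fast
  define G where "G n = {\<rho> m n f s | m s f. (m, s) \<in> S \<and> f \<in> VI_hom m n}" for n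
  have G_sub: "G n \<subseteq> Vs n" for n unfolding G_def using \<rho> act_in S(2) by auto
  \<comment> \<open>The spans of the translates of \<open>S\<close> form a submodule containing
    \<open>S\<close>, so finite generation makes them all of \<open>Vs\<close>: the explicit
    spanning form that the locale asks for.\<close>
  have "is_VI_submodule scale Vs act (\<lambda>n. span (G n))"
    unfolding is_VI_submodule_def
  proof (intro conjI allI impI ballI)
    show "subspace (span (G n))" "span (G n) \<subseteq> Vs n" for n
      using span_minimal[OF G_sub sub] by (auto simp: subspace_span)
    fix m n and A :: "nat \<Rightarrow> nat \<Rightarrow> 'f" and x assume A: "A \<in> VI_hom m n" and x: "x \<in> span (G m)"
    interpret r: Vector_Spaces.linear scale scale "\<rho> m n A" using \<rho>[OF A] by blast
    have "\<rho> m n A ` G m \<subseteq> G n"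
    proof clarify
      fix u assume "u \<in> G m"
      then obtain l s f where u: "u = \<rho> l m f s" "(l, s) \<in> S" "f \<in> VI_hom l m" unfolding G_def by blast
      note s = S(2)[OF u(2)] and fA = VI_comp_in[OF u(3) A]
      have "\<rho> m n A u = act m n A (act l m f s)"
        unfolding u(1) using \<rho>[OF A] \<rho>[OF u(3)] act_in[OF u(3) s] s by simp
      also have "\<dots> = \<rho> l n (VI_comp m A f) s" using act_comp[OF u(3) A s] \<rho>[OF fA] s by simp
      finally show "\<rho> m n A u \<in> G n" unfolding G_def using u(2) fA by blast
    qed
    then have "\<rho> m n A ` span (G m) \<subseteq> span (G n)"
      unfolding r.span_image[symmetric] by (rule span_mono)
    moreover have "\<rho> m n A x = act m n A x" using \<rho>[OF A] x span_minimal[OF G_sub sub] by blast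
    ultimately show "act m n A x \<in> span (G n)" using x by force
  qed
  moreover have "x \<in> span (G n)" if x: "(n, x) \<in> S" for n x
  proof -
    have idn: "(VI_id n :: nat \<Rightarrow> nat \<Rightarrow> 'f) \<in> VI_hom n n" by (rule VI_id_in) simp
    have "\<rho> n n (VI_id n) x = x" using \<rho>[OF idn] act_id S(2)[OF x] by simp
    then have "x \<in> G n" unfolding G_def using x idn by force
    then show ?thesis by (rule span_base)
  qed
  ultimately have gen: "(\<lambda>n. span (G n)) = Vs" by (rule S(3))
  \<comment> \<open>Inserting 0 keeps the maximum meaningful when \<open>S\<close> is empty.\<close>
  define d where "d = Max (insert 0 (fst ` S))"
  interpret linear_VI_module scale Vs \<rho> S d
  proof (intro linear_VI_module.intro linear_VI_module_axioms.intro)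
    show "traced_space scale" by (rule traced_space_axioms)
    show "m \<le> d" if "(m, s) \<in> S" for m s
      unfolding d_def using that S(1) by (intro Max_ge) (auto intro: rev_image_eqI)
    show "Vs n \<subseteq> span {\<rho> m n f s |m s f. (m, s) \<in> S \<and> f \<in> VI_hom m n}" for n
      using fun_cong[OF gen, of n] unfolding G_def by simp
    show "\<rho> m m (VI_id m) v = v" if "v \<in> Vs m" for m v
      using \<rho>[OF VI_id_in[OF order_refl]] act_id[OF that] that by simp
    show "\<rho> m p (VI_comp n B A) v = \<rho> n p B (\<rho> m n A v)"
      if "A \<in> VI_hom m n" "B \<in> VI_hom n p" "v \<in> Vs m" for A m n B p v
      using \<rho>[OF VI_comp_in[OF that(1,2)]] \<rho>[OF that(1)] \<rho>[OF that(2)] act_comp[OF that] act_in[OF that(1,3)] that(3)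
      by simp
    show "\<rho> m n A v \<in> Vs n" if "A \<in> VI_hom m n" "v \<in> Vs m" for A m n v
      using \<rho>[OF that(1)] act_in[OF that] that(2) by simp
  qed (use sub \<rho> S in auto)
  show ?thesis by (rule dim_polynomial)
qed

end
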